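(* Let $L\subset\mathbb{C}^2$ be an immersed Lagrangian surface (with respect to $\omega=\frac{i}{2}(dz_1\wedge d\bar z_1+dz_2\wedge d\bar z_2)$) that is mapped to itself by multiplication by $-1$ on $\mathbb{C}^2$. Then $$M=\{(u=e^{i\varphi},\zeta_1,\zeta_2):(e^{i\varphi/2}\zeta_1,e^{i\varphi/2}\zeta_2)\in L\}$$ is an immersed Lagrangian 3-manifold in $O(-1)\oplus O(-1)\to\mathbb{P}^1$ with respect to the symplectic form $\Omega$ given in the context. As an abstract manifold, $M$ is diffeomorphic to the quotient of $S^1\times L$ (with $S^1=\mathbb{R}/2\pi\mathbb{Z}$ having coordinate $t$) by the $\mathbb{Z}/2$ action $(t,z_1,z_2)\mapsto(t+\pi,-z_1,-z_2)$, the diffeomorphism being induced by $(t,z_1,z_2)\mapsto(\varphi=2t,\ \zeta_1=e^{-it}z_1,\ \zeta_2=e^{-it}z_2)$. If $L$ is embedded in $\mathbb{C}^2$, then $M$ is embedded in $O(-1)\oplus O(-1)$.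
   Context: Let $(z,w)\in\mathbb{C}^2\setminus\{0\}$ be homogeneous coordinates on $\mathbb{P}^1$. The total space $O(-1)\oplus O(-1)$ has homogeneous coordinates $((z,w),\eta_1,\eta_2)$, where $((z,w),\eta_1,\eta_2)$ and $((\lambda z,\lambda w),\lambda^{-1}\eta_1,\lambda^{-1}\eta_2)$ represent the same point for each $\lambda\in\mathbb{C}\setminus\{0\}$. Put $\zeta_i=(|z|^2+|w|^2)^{1/2}\eta_i$. On the part of $\mathbb{P}^1$ where $w\ne 0$ use the complex coordinate $u$ with $z=u$, $w=1$; then $(u,\zeta_1,\zeta_2)$ are coordinates on the corresponding part of $O(-1)\oplus O(-1)$. Let $A=(|u|^2+1)^{-1}\,\mathrm{Im}(\bar u\,du)$ and $\pi_j=d\zeta_j+iA\,\zeta_j$ for $j=1,2$. Fix $a>0$. The symplectic form on $O(-1)\oplus O(-1)$ is $$\Omega=\tfrac{i}{2}\left(\pi_1\wedge\bar\pi_1+\pi_2\wedge\bar\pi_2+(|u|^2+1)^{-2}(a+|\zeta_1|^2+|\zeta_2|^2)\,du\wedge d\bar u\right).$$ When $L$ is immersed but not embedded, it is the image of an immersion $\iota:\Sigma\to\mathbb{C}^2$, invariance under $-1$ means that there is an involution $\tau$ of $\Sigma$ with $\iota\circ\tau=-\iota$, and in the description of $M$ as an abstract manifold $L$ stands for $\Sigma$, with $\tau$ in place of $(z_1,z_2)\mapsto(-z_1,-z_2)$. *)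

theory Defs
  imports "HOL-Analysis.Analysis"
begin

section \<open>Smooth maps between open subsets of normed spaces\<close>

text \<open>\<open>Ck_on k f S\<close> is meant for open \<open>S\<close>. In finite dimension it is the usual notion:
  all iterated directional derivatives up to order \<open>k\<close> exist and are continuous.\<close>

primrec Ck_on :: "nat \<Rightarrow> ('a::real_normed_vector \<Rightarrow> 'b::real_normed_vector) \<Rightarrow> 'a set \<Rightarrow> bool" where
  "Ck_on 0 f S \<longleftrightarrow> continuous_on S f"
| "Ck_on (Suc k) f S \<longleftrightarrow>
     (\<forall>x\<in>S. f differentiable (at x)) \<and> (\<forall>v. Ck_on k (\<lambda>x. frechet_derivative f (at x) v) S)"

definition Cinf_on :: "('a::real_normed_vector \<Rightarrow> 'b::real_normed_vector) \<Rightarrow> 'a set \<Rightarrow> bool" where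
  "Cinf_on f S \<longleftrightarrow> (\<forall>k. Ck_on k f S)"

section \<open>Smooth manifolds\<close>

text \<open>A manifold modelled on the Euclidean space \<open>'e\<close> is a topological space with an atlas; its
  dimension is \<open>DIM('e)\<close>. A chart \<open>(U, \<phi>)\<close> has domain \<open>U\<close>; the values of \<open>\<phi>\<close> outside \<open>U\<close>
  are irrelevant.\<close>

type_synonym ('a, 'e) chart = "'a set \<times> ('a \<Rightarrow> 'e)"

record ('a, 'e) manifold =
  mtop :: "'a topology"
  atlas :: "('a, 'e) chart set"

abbreviation points :: "('a, 'e) manifold \<Rightarrow> 'a set" where
  "points X \<equiv> topspace (mtop X)"

definition smooth_manifold :: "('a, 'e::euclidean_space) manifold \<Rightarrow> bool" where
  "smooth_manifold X \<longleftrightarrow>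
     Hausdorff_space (mtop X) \<and> second_countable (mtop X) \<and>
     \<Union> (fst ` atlas X) = points X \<and>
     (\<forall>(U, \<phi>) \<in> atlas X. openin (mtop X) U \<and> open (\<phi> ` U) \<and>
        homeomorphic_map (subtopology (mtop X) U) (top_of_set (\<phi> ` U)) \<phi>) \<and>
     (\<forall>(U, \<phi>) \<in> atlas X. \<forall>(V, \<psi>) \<in> atlas X. Cinf_on (\<psi> \<circ> inv_into U \<phi>) (\<phi> ` (U \<inter> V)))"

definition smooth_map ::
  "('a, 'e::euclidean_space) manifold \<Rightarrow> ('b, 'f::euclidean_space) manifold \<Rightarrow> ('a \<Rightarrow> 'b) \<Rightarrow> bool" where
  "smooth_map X Y f \<longleftrightarrow>
     continuous_map (mtop X) (mtop Y) f \<and>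
     (\<forall>(U, \<phi>) \<in> atlas X. \<forall>(V, \<psi>) \<in> atlas Y.
        Cinf_on (\<psi> \<circ> f \<circ> inv_into U \<phi>) (\<phi> ` {x \<in> U. f x \<in> V}))"

text \<open>The differential of \<open>f\<close> at \<open>x\<close>, expressed in charts \<open>(U, \<phi>)\<close> around \<open>x\<close> and
  \<open>(V, \<psi>)\<close> around \<open>f x\<close>.\<close>

definition differential ::
  "('a, 'e::euclidean_space) chart \<Rightarrow> ('b, 'f::euclidean_space) chart \<Rightarrow> ('a \<Rightarrow> 'b) \<Rightarrow> 'a \<Rightarrow> 'e \<Rightarrow> 'f" where
  "differential c d f x =
     frechet_derivative (snd d \<circ> f \<circ> inv_into (fst c) (snd c)) (at (snd c x))"

definition smooth_immersion ::
  "('a, 'e::euclidean_space) manifold \<Rightarrow> ('b, 'f::euclidean_space) manifold \<Rightarrow> ('a \<Rightarrow> 'b) \<Rightarrow> bool" where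
  "smooth_immersion X Y f \<longleftrightarrow> smooth_map X Y f \<and>
     (\<forall>c \<in> atlas X. \<forall>d \<in> atlas Y. \<forall>x \<in> fst c. f x \<in> fst d \<longrightarrow> inj (differential c d f x))"

definition smooth_embedding ::
  "('a, 'e::euclidean_space) manifold \<Rightarrow> ('b, 'f::euclidean_space) manifold \<Rightarrow> ('a \<Rightarrow> 'b) \<Rightarrow> bool" where
  "smooth_embedding X Y f \<longleftrightarrow> smooth_immersion X Y f \<and> embedding_map (mtop X) (mtop Y) f"

definition open_submanifold :: "('a, 'e) manifold \<Rightarrow> 'a set \<Rightarrow> ('a, 'e) manifold" where
  "open_submanifold X W =
     \<lparr>mtop = subtopology (mtop X) W, atlas = {(U \<inter> W, \<phi>) | U \<phi>. (U, \<phi>) \<in> atlas X}\<rparr>"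

text \<open>\<open>f\<close> is a diffeomorphism of \<open>X\<close> onto the subset \<open>S\<close> of \<open>Y\<close>, where a map on a subset of a
  manifold is smooth if it extends locally to a smooth map on an open subset.\<close>

definition diffeomorphism_onto ::
  "('a, 'e::euclidean_space) manifold \<Rightarrow> ('b, 'f::euclidean_space) manifold \<Rightarrow> 'b set \<Rightarrow> ('a \<Rightarrow> 'b) \<Rightarrow> bool" where
  "diffeomorphism_onto X Y S f \<longleftrightarrow> smooth_map X Y f \<and> bij_betw f (points X) S \<and>
     (\<forall>y\<in>S. \<exists>W g. openin (mtop Y) W \<and> y \<in> W \<and> smooth_map (open_submanifold Y W) X g \<and>
        (\<forall>x\<in>points X. f x \<in> W \<longrightarrow> g (f x) = x))"

definition euclidean_manifold :: "('e::euclidean_space, 'e) manifold" where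
  "euclidean_manifold = \<lparr>mtop = euclidean, atlas = {(UNIV, id)}\<rparr>"

definition prod_manifold ::
  "('a, 'e) manifold \<Rightarrow> ('b, 'f) manifold \<Rightarrow> ('a \<times> 'b, 'e \<times> 'f) manifold" where
  "prod_manifold X Y =
     \<lparr>mtop = prod_topology (mtop X) (mtop Y),
      atlas = {(U \<times> V, map_prod \<phi> \<psi>) | U \<phi> V \<psi>. (U, \<phi>) \<in> atlas X \<and> (V, \<psi>) \<in> atlas Y}\<rparr>"

definition quotient_topology :: "'a topology \<Rightarrow> ('a \<Rightarrow> 'b) \<Rightarrow> 'b topology" where
  "quotient_topology X q =
     topology (\<lambda>V. V \<subseteq> q ` topspace X \<and> openin X {x \<in> topspace X. q x \<in> V})"

lemma openin_quotient_topology: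
  "openin (quotient_topology X q) V \<longleftrightarrow>
     V \<subseteq> q ` topspace X \<and> openin X {x \<in> topspace X. q x \<in> V}"
proof -
  have "istopology (\<lambda>V. V \<subseteq> q ` topspace X \<and> openin X {x \<in> topspace X. q x \<in> V})"
    unfolding istopology_def
  proof (intro conjI allI impI)
    fix S T
    assume "S \<subseteq> q ` topspace X \<and> openin X {x \<in> topspace X. q x \<in> S}"
      and "T \<subseteq> q ` topspace X \<and> openin X {x \<in> topspace X. q x \<in> T}"
    moreover have "{x \<in> topspace X. q x \<in> S \<inter> T} =
        {x \<in> topspace X. q x \<in> S} \<inter> {x \<in> topspace X. q x \<in> T}"
      by auto
    ultimately show "S \<inter> T \<subseteq> q ` topspace X" "openin X {x \<in> topspace X. q x \<in> S \<inter> T}"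
      by (auto intro: openin_Int)
  next
    fix K
    assume K: "\<forall>S\<in>K. S \<subseteq> q ` topspace X \<and> openin X {x \<in> topspace X. q x \<in> S}"
    then show "\<Union> K \<subseteq> q ` topspace X"
      by blast
    have "{x \<in> topspace X. q x \<in> \<Union> K} = (\<Union>S\<in>K. {x \<in> topspace X. q x \<in> S})"
      by auto
    then show "openin X {x \<in> topspace X. q x \<in> \<Union> K}"
      using K by (auto intro: openin_Union)
  qed
  then show ?thesis
    unfolding quotient_topology_def by (simp add: topology_inverse')
qed

text \<open>The quotient by a covering projection \<open>q\<close>, with the smooth structure for which \<open>q\<close> is a
  local diffeomorphism: every chart of \<open>X\<close>, cut down to an open set on which \<open>q\<close> is injective,
  is pushed forward along \<open>q\<close>.\<close>

definition quotient_manifold :: "('a, 'e) manifold \<Rightarrow> ('a \<Rightarrow> 'b) \<Rightarrow> ('b, 'e) manifold" where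
  "quotient_manifold X q =
     \<lparr>mtop = quotient_topology (mtop X) q,
      atlas = {(q ` V, \<phi> \<circ> inv_into V q) | U \<phi> V.
                 (U, \<phi>) \<in> atlas X \<and> V \<subseteq> U \<and> openin (mtop X) V \<and> inj_on q V}\<rparr>"

section \<open>Two-forms and Lagrangian immersions\<close>

text \<open>\<open>\<Omega> y v w\<close> is the value at \<open>y\<close> on tangent vectors \<open>v\<close>, \<open>w\<close>. The forms are written with
  complex-valued one-forms, so their values lie in \<open>complex\<close>, although they are real.\<close>

type_synonym 'e two_form = "'e \<Rightarrow> 'e \<Rightarrow> 'e \<Rightarrow> complex"

definition wedge :: "('e \<Rightarrow> complex) \<Rightarrow> ('e \<Rightarrow> complex) \<Rightarrow> 'e \<Rightarrow> 'e \<Rightarrow> complex" where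
  "wedge \<alpha> \<beta> v w = \<alpha> v * \<beta> w - \<alpha> w * \<beta> v"

text \<open>The form \<open>\<Omega>\<close> is given in the coordinates of one chart \<open>d\<close> of \<open>Y\<close>; the image of the
  immersion has to lie in the domain of \<open>d\<close>.\<close>

definition lagrangian_immersion ::
  "('a, 'e::euclidean_space) manifold \<Rightarrow> ('b, 'f::euclidean_space) manifold \<Rightarrow>
   ('b, 'f) chart \<Rightarrow> 'f two_form \<Rightarrow> ('a \<Rightarrow> 'b) \<Rightarrow> bool" where
  "lagrangian_immersion X Y d \<Omega> f \<longleftrightarrow>
     smooth_immersion X Y f \<and> 2 * DIM('e) = DIM('f) \<and>
     d \<in> atlas Y \<and> f ` points X \<subseteq> fst d \<and>
     (\<forall>c \<in> atlas X. \<forall>x \<in> fst c. \<forall>v w.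
        \<Omega> (snd d (f x)) (differential c d f x v) (differential c d f x w) = 0)"

definition \<omega>_std :: "(complex \<times> complex) two_form" where
  "\<omega>_std y v w = \<i> / 2 * (wedge fst (cnj \<circ> fst) v w + wedge snd (cnj \<circ> snd) v w)"

section \<open>The bundle \<open>O(-1) \<oplus> O(-1)\<close>\<close>

type_synonym bundle_point = "(complex \<times> complex \<times> complex \<times> complex) set"

definition hpoint :: "complex \<times> complex \<times> complex \<times> complex \<Rightarrow> bundle_point" where
  "hpoint = (\<lambda>(z, w, \<eta>1, \<eta>2).
     {(c * z, c * w, inverse c * \<eta>1, inverse c * \<eta>2) | c. c \<noteq> 0})"

definition herm_norm :: "complex \<Rightarrow> complex" where
  "herm_norm u = complex_of_real (sqrt ((cmod u)\<^sup>2 + 1))"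

text \<open>The points with coordinates \<open>(u, \<zeta>1, \<zeta>2)\<close> over \<open>w \<noteq> 0\<close>, and symmetrically over \<open>z \<noteq> 0\<close>;
  \<open>\<zeta>j\<close> is \<open>(|z|^2 + |w|^2)^(1/2) \<eta>j\<close> for the representative with \<open>w = 1\<close>, respectively \<open>z = 1\<close>.\<close>

definition pt_w :: "complex \<times> complex \<times> complex \<Rightarrow> bundle_point" where
  "pt_w = (\<lambda>(u, \<zeta>1, \<zeta>2). hpoint (u, 1, \<zeta>1 / herm_norm u, \<zeta>2 / herm_norm u))"

definition pt_z :: "complex \<times> complex \<times> complex \<Rightarrow> bundle_point" where
  "pt_z = (\<lambda>(v, \<zeta>1, \<zeta>2). hpoint (1, v, \<zeta>1 / herm_norm v, \<zeta>2 / herm_norm v))"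

definition chart_w :: "(bundle_point, complex \<times> complex \<times> complex) chart" where
  "chart_w = (range pt_w, inv pt_w)"

definition chart_z :: "(bundle_point, complex \<times> complex \<times> complex) chart" where
  "chart_z = (range pt_z, inv pt_z)"

definition total_space :: "(bundle_point, complex \<times> complex \<times> complex) manifold" where
  "total_space =
     \<lparr>mtop = quotient_topology (top_of_set {(z, w, \<eta>1, \<eta>2). (z, w) \<noteq> (0, 0)}) hpoint,
      atlas = {chart_w, chart_z}\<rparr>"

text \<open>The one-forms \<open>A\<close> and \<open>\<pi>\<close> and the symplectic form, in the coordinates of \<open>chart_w\<close>.\<close>

definition A_form :: "complex \<times> complex \<times> complex \<Rightarrow> complex \<times> complex \<times> complex \<Rightarrow> real" where
  "A_form = (\<lambda>(u, \<zeta>1, \<zeta>2) (du, d\<zeta>1, d\<zeta>2). Im (cnj u * du) / ((cmod u)\<^sup>2 + 1))"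

definition \<pi>1_form :: "complex \<times> complex \<times> complex \<Rightarrow> complex \<times> complex \<times> complex \<Rightarrow> complex" where
  "\<pi>1_form = (\<lambda>(u, \<zeta>1, \<zeta>2) (du, d\<zeta>1, d\<zeta>2).
     d\<zeta>1 + \<i> * complex_of_real (A_form (u, \<zeta>1, \<zeta>2) (du, d\<zeta>1, d\<zeta>2)) * \<zeta>1)"

definition \<pi>2_form :: "complex \<times> complex \<times> complex \<Rightarrow> complex \<times> complex \<times> complex \<Rightarrow> complex" where
  "\<pi>2_form = (\<lambda>(u, \<zeta>1, \<zeta>2) (du, d\<zeta>1, d\<zeta>2).
     d\<zeta>2 + \<i> * complex_of_real (A_form (u, \<zeta>1, \<zeta>2) (du, d\<zeta>1, d\<zeta>2)) * \<zeta>2)"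

definition \<Omega>_form :: "real \<Rightarrow> (complex \<times> complex \<times> complex) two_form" where
  "\<Omega>_form a = (\<lambda>(u, \<zeta>1, \<zeta>2) v w. \<i> / 2 *
     (wedge (\<pi>1_form (u, \<zeta>1, \<zeta>2)) (cnj \<circ> \<pi>1_form (u, \<zeta>1, \<zeta>2)) v w +
      wedge (\<pi>2_form (u, \<zeta>1, \<zeta>2)) (cnj \<circ> \<pi>2_form (u, \<zeta>1, \<zeta>2)) v w +
      complex_of_real ((a + (cmod \<zeta>1)\<^sup>2 + (cmod \<zeta>2)\<^sup>2) / ((cmod u)\<^sup>2 + 1)\<^sup>2) *
        wedge fst (cnj \<circ> fst) v w))"

section \<open>The circle, the \<open>\<int>/2\<close> quotient and the set \<open>M\<close>\<close>

definition circ :: "real \<Rightarrow> real set" where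
  "circ t = {t + 2 * pi * of_int k | k :: int. True}"

definition circle_manifold :: "(real set, real) manifold" where
  "circle_manifold = quotient_manifold euclidean_manifold circ"

definition deck :: "('a \<Rightarrow> 'a) \<Rightarrow> real set \<times> 'a \<Rightarrow> real set \<times> 'a" where
  "deck \<tau> = (\<lambda>(T, p). ((\<lambda>t. t + pi) ` T, \<tau> p))"

text \<open>Since \<open>\<tau>\<close> will be an involution, \<open>{x, deck \<tau> x}\<close> is the orbit of \<open>x\<close>.\<close>

definition deck_class :: "('a \<Rightarrow> 'a) \<Rightarrow> real set \<times> 'a \<Rightarrow> (real set \<times> 'a) set" where
  "deck_class \<tau> x = {x, deck \<tau> x}"

definition twisted_product ::
  "('a, 'e) manifold \<Rightarrow> ('a \<Rightarrow> 'a) \<Rightarrow> ((real set \<times> 'a) set, real \<times> 'e) manifold" where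
  "twisted_product S \<tau> = quotient_manifold (prod_manifold circle_manifold S) (deck_class \<tau>)"

definition minus_involution ::
  "('a, 'e::euclidean_space) manifold \<Rightarrow> ('a \<Rightarrow> complex \<times> complex) \<Rightarrow> ('a \<Rightarrow> 'a) \<Rightarrow> bool" where
  "minus_involution S \<iota> \<tau> \<longleftrightarrow> smooth_map S S \<tau> \<and> (\<forall>p\<in>points S. \<tau> (\<tau> p) = p \<and> \<iota> (\<tau> p) = - \<iota> p)"

definition M_set :: "(complex \<times> complex) set \<Rightarrow> bundle_point set" where
  "M_set L = {pt_w (cis \<phi>, \<zeta>1, \<zeta>2) | \<phi> \<zeta>1 \<zeta>2. (cis (\<phi> / 2) * \<zeta>1, cis (\<phi> / 2) * \<zeta>2) \<in> L}"

end

theory Submission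
  imports Defs
begin

text \<open>
  In the coordinates \<open>(u, \<zeta>\<^sub>1, \<zeta>\<^sub>2)\<close> the map is
  \<open>(t, p) \<mapsto> (exp (2it), exp (-it) \<iota> p)\<close>, which is invariant under
  \<open>(t, p) \<mapsto> (t + \<pi>, \<tau> p)\<close>. On \<open>|u| = 1\<close> we have \<open>A = dt\<close>, so the connection
  term of \<open>\<pi>\<^sub>j\<close> cancels the derivative of the factor \<open>exp (-it)\<close> and \<open>\<pi>\<^sub>j\<close> pulls back to
  \<open>exp (-it) d\<iota>\<^sub>j\<close>, while \<open>du \<and> d\<bar>u\<close> pulls back to \<open>0\<close>; hence \<open>\<Omega>\<close> pulls back to
  the pullback of \<open>\<omega>\<close> along \<open>\<iota>\<close>, which vanishes. If \<open>\<iota>\<close> is an embedding, a point of the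
  image determines \<open>t\<close> up to \<open>\<pi>\<close> through a local branch of \<open>arg u / 2\<close>, and then \<open>p\<close>; a smooth
  embedding has local smooth left inverses because a linear left inverse of its differential
  reduces it to the inverse function theorem.\<close>

section \<open>Smooth maps between normed spaces\<close>

text \<open>The source of the immersion is a quotient of a quotient: the line modulo 2 pi, then
  circle times surface modulo the deck involution. Both are instances of one construction, so every
  chart of the result reads a real angle together with a chart of the surface, and in such charts
  the map is an elementary formula. The second action is free because of its circle factor alone;
  fixed points of \<open>\<tau>\<close> do no harm. The bundle has two charts and the immersion
  property is demanded in both, although the form is written in one. On \<open>|u| = 1\<close>
  passing to the other chart amounts to replacing t by -t in the phase factors, so a sign
  \<open>\<sigma>\<close> treats both at once. Smoothness is defined by iterated derivatives in
  fixed directions. The chain rule and the inverse function theorem produce derivatives in moving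
  directions and inverses of varying operators; expansion in a basis brings them back to fixed
  directions, so that induction on the order can run. Local left inverses have a second use: for an
  embedded surface they make the involution \<open>\<tau>\<close>, which is the inverse of
  \<open>\<iota>\<close> applied to \<open>- \<iota>\<close>, a smooth map.\<close>

lemma Ck_on_cong:
  "open S \<Longrightarrow> (\<And>x. x \<in> S \<Longrightarrow> f x = g x) \<Longrightarrow> Ck_on k f S \<Longrightarrow> Ck_on k g S"
proof (induction k arbitrary: f g)
  case 0
  then show ?case by (simp cong: continuous_on_cong)
next
  case (Suc k)
  have d: "(g has_derivative frechet_derivative f (at x)) (at x)" if "x \<in> S" for x
  proof (rule has_derivative_transform_within_open[OF _ \<open>open S\<close> that])
    show "(f has_derivative frechet_derivative f (at x)) (at x)"
      using Suc.prems(3) that by (simp add: frechet_derivative_works)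
  qed (use Suc.prems in auto)
  have "Ck_on k (\<lambda>x. frechet_derivative g (at x) v) S" for v
  proof (rule Suc.IH[OF \<open>open S\<close>])
    show "frechet_derivative f (at x) v = frechet_derivative g (at x) v" if "x \<in> S" for x
      using frechet_derivative_at[OF d[OF that]] by simp
    show "Ck_on k (\<lambda>x. frechet_derivative f (at x) v) S"
      using Suc.prems(3) by simp
  qed
  then show ?case
    using d by (auto simp: differentiable_def)
qed

text \<open>Lets an explicit formula replace the choice operator \<open>frechet_derivative\<close>;
  the derivative at a point is unique, so the two agree on \<open>S\<close>.\<close>

lemma Ck_on_Suc_intro:
  assumes "open S" "\<And>x. x \<in> S \<Longrightarrow> (f has_derivative f' x) (at x)"
    and "\<And>v. Ck_on k (\<lambda>x. f' x v) S"
  shows "Ck_on (Suc k) f S"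
  unfolding Ck_on.simps
proof (intro conjI ballI allI)
  show "f differentiable at x" if "x \<in> S" for x
    using assms(2)[OF that] by (auto simp: differentiable_def)
  show "Ck_on k (\<lambda>x. frechet_derivative f (at x) v) S" for v
    by (rule Ck_on_cong[OF assms(1) _ assms(3)[of v]])
       (simp add: frechet_derivative_at[OF assms(2), symmetric])
qed

lemma Ck_on_subset: "Ck_on k f S \<Longrightarrow> T \<subseteq> S \<Longrightarrow> Ck_on k f T"
  by (induction k arbitrary: f) (auto intro: continuous_on_subset)

lemma Ck_on_local:
  "(\<And>x. x \<in> S \<Longrightarrow> \<exists>T. open T \<and> x \<in> T \<and> Ck_on k f T) \<Longrightarrow> Ck_on k f S"
proof (induction k arbitrary: f)
  case 0
  then show ?case
    by (simp, metis continuous_at_imp_continuous_on continuous_on_eq_continuous_at)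
next
  case (Suc k)
  show ?case
    unfolding Ck_on.simps
  proof (intro conjI ballI allI)
    show "f differentiable at x" if "x \<in> S" for x
      using Suc.prems[OF that] by auto
    show "Ck_on k (\<lambda>x. frechet_derivative f (at x) v) S" for v
      by (rule Suc.IH) (use Suc.prems in fastforce)
  qed
qed

lemma Ck_on_Suc_D: "Ck_on (Suc k) f S \<Longrightarrow> Ck_on k f S"
proof (induction k arbitrary: f)
  case 0
  then show ?case
    by (auto intro!: continuous_at_imp_continuous_on simp: differentiable_imp_continuous_within)
qed auto

lemma Ck_on_continuous_on: "Ck_on k f S \<Longrightarrow> continuous_on S f"
proof (induction k)
  case (Suc k)
  then show ?case using Ck_on_Suc_D by blast
qed simp

section \<open>Linear, bilinear and chain rules for C^k maps\<close>

lemma Ck_on_const: "Ck_on k (\<lambda>x. c) S"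
  by (induction k arbitrary: c) (auto intro: continuous_on_const)

lemma Ck_on_bounded_linear:
  assumes L: "bounded_linear L" and "open S"
  shows "Ck_on k f S \<Longrightarrow> Ck_on k (\<lambda>x. L (f x)) S"
proof (induction k arbitrary: f)
  case 0
  then show ?case
    by (auto intro: bounded_linear.continuous_on[OF L])
next
  case (Suc k)
  show ?case
    by (rule Ck_on_Suc_intro[OF \<open>open S\<close>, where f' = "\<lambda>x v. L (frechet_derivative f (at x) v)"])
       (use Suc in \<open>auto intro!: bounded_linear.has_derivative[OF L] simp: frechet_derivative_works\<close>)
qed

lemma Ck_on_add:
  assumes "open S"
  shows "Ck_on k f S \<Longrightarrow> Ck_on k g S \<Longrightarrow> Ck_on k (\<lambda>x. f x + g x) S"
proof (induction k arbitrary: f g)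
  case 0
  then show ?case by (auto intro: continuous_on_add)
next
  case (Suc k)
  show ?case
    by (rule Ck_on_Suc_intro[OF \<open>open S\<close>, where
          f' = "\<lambda>x v. frechet_derivative f (at x) v + frechet_derivative g (at x) v"])
       (use Suc in \<open>auto intro!: has_derivative_add simp: frechet_derivative_works\<close>)
qed

lemma Ck_on_bounded_bilinear:
  assumes B: "bounded_bilinear B" and "open S"
  shows "Ck_on k f S \<Longrightarrow> Ck_on k g S \<Longrightarrow> Ck_on k (\<lambda>x. B (f x) (g x)) S"
proof (induction k arbitrary: f g)
  case 0
  then show ?case by (auto intro: bounded_bilinear.continuous_on[OF B])
next
  case (Suc k)
  have *: "Ck_on k f S" "Ck_on k g S"
    using Suc.prems[THEN Ck_on_Suc_D] .
  show ?case
    by (rule Ck_on_Suc_intro[OF \<open>open S\<close>, where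
          f' = "\<lambda>x v. B (f x) (frechet_derivative g (at x) v) + B (frechet_derivative f (at x) v) (g x)"])
       (use Suc * in \<open>auto intro!: bounded_bilinear.FDERIV[OF B] Ck_on_add[OF \<open>open S\<close>]
          simp: frechet_derivative_works\<close>)
qed

lemma Ck_on_sum:
  assumes "open S" "\<And>i. i \<in> I \<Longrightarrow> Ck_on k (f i) S"
  shows "Ck_on k (\<lambda>x. \<Sum>i\<in>I. f i x) S"
  using assms by (induction I rule: infinite_finite_induct) (auto intro: Ck_on_const Ck_on_add)

lemma linear_apply_basis_expansion:
  fixes f :: "'a::euclidean_space \<Rightarrow> 'b::real_normed_vector"
  assumes "linear f"
  shows "f x = (\<Sum>b\<in>Basis. (x \<bullet> b) *\<^sub>R f b)"
proof -
  have "f x = f (\<Sum>b\<in>Basis. (x \<bullet> b) *\<^sub>R b)"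
    by (simp add: euclidean_representation)
  then show ?thesis
    by (simp add: linear_sum[OF assms] linear_scale[OF assms])
qed

text \<open>The chain rule evaluates the derivative of \<open>g\<close> in the direction
  \<open>?f' x v\<close>, which moves with \<open>x\<close>, whereas \<open>Ck_on\<close> speaks
  only of fixed directions. Expanding that direction in \<open>Basis\<close> leaves the derivatives
  of \<open>g\<close> along basis vectors, to which the induction hypothesis applies, with scalar
  C^k coefficients.\<close>

lemma Ck_on_compose:
  fixes f :: "'a::real_normed_vector \<Rightarrow> 'b::euclidean_space"
  assumes "open S" "open T" "f ` S \<subseteq> T"
  shows "Ck_on k f S \<Longrightarrow> Ck_on k g T \<Longrightarrow> Ck_on k (\<lambda>x. g (f x)) S"
proof (induction k arbitrary: g)
  case 0
  then show ?case
    using assms by (auto intro: continuous_on_compose2)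
next
  case (Suc k)
  let ?f' = "\<lambda>x. frechet_derivative f (at x)" and ?g' = "\<lambda>x. frechet_derivative g (at x)"
  have g: "(g has_derivative ?g' y) (at y)" if "y \<in> T" for y
    using Suc.prems that by (auto simp: frechet_derivative_works)
  have f: "(f has_derivative ?f' x) (at x)" if "x \<in> S" for x
    using Suc.prems that by (auto simp: frechet_derivative_works)
  have "((\<lambda>x. g (f x)) has_derivative (\<lambda>v. \<Sum>b\<in>Basis. (?f' x v \<bullet> b) *\<^sub>R ?g' (f x) b)) (at x)"
    if "x \<in> S" for x
  proof -
    have fx: "f x \<in> T" using that assms by auto
    have "((\<lambda>x. g (f x)) has_derivative (\<lambda>v. ?g' (f x) (?f' x v))) (at x)"
      using has_derivative_compose[OF f[OF that] g[OF fx]] .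
    then show ?thesis
      by (rule has_derivative_eq_rhs)
         (rule ext, rule linear_apply_basis_expansion[OF has_derivative_linear[OF g[OF fx]]])
  qed
  moreover have "Ck_on k (\<lambda>x. \<Sum>b\<in>Basis. (?f' x v \<bullet> b) *\<^sub>R ?g' (f x) b) S" for v
  proof (intro \<open>open S\<close> Ck_on_sum Ck_on_bounded_bilinear[OF bounded_bilinear_scaleR])
    show "Ck_on k (\<lambda>x. ?f' x v \<bullet> b) S" for b
      using Suc.prems(1) by (intro Ck_on_bounded_linear[OF bounded_linear_inner_left \<open>open S\<close>]) simp
    show "Ck_on k (\<lambda>x. ?g' (f x) b) S" for b
      using Suc.IH[of "\<lambda>y. ?g' y b", OF Ck_on_Suc_D[OF Suc.prems(1)]] Suc.prems(2) by simp
  qed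
  ultimately show ?case
    by (rule Ck_on_Suc_intro[OF \<open>open S\<close>])
qed

section \<open>The same rules for smooth maps\<close>

lemma Cinf_on_cong:
  "Cinf_on f S \<Longrightarrow> open S \<Longrightarrow> (\<And>x. x \<in> S \<Longrightarrow> f x = g x) \<Longrightarrow> Cinf_on g S"
  unfolding Cinf_on_def using Ck_on_cong by blast

lemma Cinf_on_subset: "Cinf_on f S \<Longrightarrow> T \<subseteq> S \<Longrightarrow> Cinf_on f T"
  unfolding Cinf_on_def using Ck_on_subset by blast

lemma Cinf_on_local:
  "(\<And>x. x \<in> S \<Longrightarrow> \<exists>T. open T \<and> x \<in> T \<and> Cinf_on f T) \<Longrightarrow> Cinf_on f S"
  unfolding Cinf_on_def by (intro allI Ck_on_local) fast

lemma Cinf_on_differentiable: "Cinf_on f S \<Longrightarrow> x \<in> S \<Longrightarrow> f differentiable (at x)"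
  unfolding Cinf_on_def by (metis Ck_on.simps(2))

lemma Cinf_on_has_derivative:
  "Cinf_on f S \<Longrightarrow> x \<in> S \<Longrightarrow> (f has_derivative frechet_derivative f (at x)) (at x)"
  using Cinf_on_differentiable frechet_derivative_works by blast

lemma Cinf_on_continuous_on: "Cinf_on f S \<Longrightarrow> continuous_on S f"
  unfolding Cinf_on_def by (metis Ck_on.simps(1))

lemma Cinf_on_frechet_derivative:
  "Cinf_on f S \<Longrightarrow> Cinf_on (\<lambda>x. frechet_derivative f (at x) v) S"
  unfolding Cinf_on_def by (metis Ck_on.simps(2))

lemma Cinf_on_const: "Cinf_on (\<lambda>x. c) S"
  unfolding Cinf_on_def by (auto intro: Ck_on_const)

lemma Cinf_on_bounded_linear:
  "bounded_linear L \<Longrightarrow> open S \<Longrightarrow> Cinf_on f S \<Longrightarrow> Cinf_on (\<lambda>x. L (f x)) S"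
  unfolding Cinf_on_def by (auto intro: Ck_on_bounded_linear)

lemma Cinf_on_bounded_bilinear:
  "bounded_bilinear B \<Longrightarrow> open S \<Longrightarrow> Cinf_on f S \<Longrightarrow> Cinf_on g S \<Longrightarrow> Cinf_on (\<lambda>x. B (f x) (g x)) S"
  unfolding Cinf_on_def by (auto intro: Ck_on_bounded_bilinear)

lemma Cinf_on_add:
  "open S \<Longrightarrow> Cinf_on f S \<Longrightarrow> Cinf_on g S \<Longrightarrow> Cinf_on (\<lambda>x. f x + g x) S"
  unfolding Cinf_on_def by (auto intro: Ck_on_add)

lemma Cinf_on_compose:
  fixes f :: "'a::real_normed_vector \<Rightarrow> 'b::euclidean_space"
  shows "Cinf_on g T \<Longrightarrow> Cinf_on f S \<Longrightarrow> open S \<Longrightarrow> open T \<Longrightarrow> f ` S \<subseteq> T \<Longrightarrow> Cinf_on (\<lambda>x. g (f x)) S"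
  unfolding Cinf_on_def by (auto intro: Ck_on_compose)

lemma Ck_on_id: "Ck_on k (\<lambda>x. x) S"
  by (cases k) (auto intro: Ck_on_const continuous_on_id)

lemma Cinf_on_id: "Cinf_on (\<lambda>x. x) S"
  unfolding Cinf_on_def by (auto intro: Ck_on_id)

lemma Cinf_on_Pair:
  assumes "open S" "Cinf_on f S" "Cinf_on g S"
  shows "Cinf_on (\<lambda>x. (f x, g x)) S"
proof -
  have "bounded_linear (\<lambda>x. (x, 0::'c))" "bounded_linear (\<lambda>y. (0::'b, y))"
    by (auto intro: bounded_linear_Pair bounded_linear_ident bounded_linear_zero)
  then have "Cinf_on (\<lambda>x. (f x, 0) + (0, g x)) S"
    using assms by (intro Cinf_on_add) (auto intro: Cinf_on_bounded_linear)
  then show ?thesis by simp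
qed

lemma Cinf_on_fst: "open S \<Longrightarrow> Cinf_on f S \<Longrightarrow> Cinf_on (\<lambda>x. fst (f x)) S"
  by (rule Cinf_on_bounded_linear[OF bounded_linear_fst])

lemma Cinf_on_snd: "open S \<Longrightarrow> Cinf_on f S \<Longrightarrow> Cinf_on (\<lambda>x. snd (f x)) S"
  by (rule Cinf_on_bounded_linear[OF bounded_linear_snd])

lemma Cinf_on_mult:
  fixes f g :: "'a::real_normed_vector \<Rightarrow> 'b::real_normed_algebra"
  shows "open S \<Longrightarrow> Cinf_on f S \<Longrightarrow> Cinf_on g S \<Longrightarrow> Cinf_on (\<lambda>x. f x * g x) S"
  by (rule Cinf_on_bounded_bilinear[OF bounded_bilinear_mult])

lemma Cinf_on_uminus: "open S \<Longrightarrow> Cinf_on f S \<Longrightarrow> Cinf_on (\<lambda>x. - f x) S"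
  by (rule Cinf_on_bounded_linear[OF bounded_linear_minus[OF bounded_linear_ident]])

section \<open>Smoothness of \<open>cis\<close>, \<open>inverse\<close> and
  \<open>sqrt\<close>\<close>

lemma Cinf_on_cis: "Cinf_on cis UNIV"
proof -
  have "Ck_on k cis UNIV" for k
  proof (induction k)
    case 0
    then show ?case by (simp add: continuous_on_cis)
  next
    case (Suc k)
    \<comment> \<open>The derivative is a linear image of \<open>cis\<close> itself, so the
      induction on the order closes. The next two lemmas follow the same pattern, with derivatives
      that are products built from the function and \<open>inverse\<close>.\<close>
    have "(cis has_derivative (\<lambda>v. v *\<^sub>R (\<i> * cis t))) (at t)" for t
      by (auto intro!: derivative_eq_intros)
    moreover have "Ck_on k (\<lambda>t. v *\<^sub>R (\<i> * cis t)) UNIV" for v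
      by (intro Ck_on_bounded_linear[OF bounded_linear_scaleR_right]
          Ck_on_bounded_linear[OF bounded_linear_mult_right] open_UNIV Suc)
    ultimately show ?case
      using Ck_on_Suc_intro[of UNIV cis "\<lambda>t v. v *\<^sub>R (\<i> * cis t)" k] by blast
  qed
  then show ?thesis by (simp add: Cinf_on_def)
qed

lemma Cinf_on_inverse: "Cinf_on (inverse :: 'a::real_normed_field \<Rightarrow> 'a) (- {0})"
proof -
  have op: "open (- {0::'a})" by auto
  have "Ck_on k (inverse :: 'a \<Rightarrow> 'a) (- {0})" for k
  proof (induction k)
    case 0
    then show ?case by (auto intro!: continuous_intros)
  next
    case (Suc k)
    have "(inverse has_derivative (\<lambda>v. - (inverse t * v * inverse t))) (at t)" if "t \<in> - {0}" for t :: 'a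
      using has_derivative_inverse'[of t UNIV] that by auto
    moreover have "Ck_on k (\<lambda>t::'a. - (inverse t * v * inverse t)) (-{0})" for v
      by (intro op Ck_on_bounded_linear[of "\<lambda>z. - z"] Ck_on_bounded_bilinear[OF bounded_bilinear_mult] Suc Ck_on_const
             bounded_linear_minus bounded_linear_ident)
    ultimately show ?case
      using Ck_on_Suc_intro[OF op, of inverse "\<lambda>t v. - (inverse t * v * inverse t)" k] by blast
  qed
  then show ?thesis by (simp add: Cinf_on_def)
qed

lemma Cinf_on_sqrt: "Cinf_on sqrt {0<..}"
proof -
  have op: "open {0::real<..}" by auto
  have "Ck_on k sqrt {0<..}" for k
  proof (induction k)
    case 0
    then show ?case by (auto intro!: continuous_intros)
  next
    case (Suc k)
    have "(sqrt has_derivative (\<lambda>v. (v / 2) * inverse (sqrt t))) (at t)" if "t \<in> {0<..}" for t :: real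
      using DERIV_real_sqrt[of t] that unfolding has_field_derivative_def
      by (auto elim!: has_derivative_eq_rhs simp: field_simps)
    moreover have "Ck_on k (\<lambda>t. (v / 2) * inverse (sqrt t)) {0<..}" for v
    proof (intro op Ck_on_bounded_bilinear[OF bounded_bilinear_mult] Ck_on_const)
      show "Ck_on k (\<lambda>t. inverse (sqrt t)) {0<..}"
        by (rule Ck_on_compose[OF op _ _ Suc, of "-{0}"]) (use Cinf_on_inverse in \<open>auto simp: Cinf_on_def\<close>)
    qed
    ultimately show ?case
      using Ck_on_Suc_intro[OF op, of sqrt "\<lambda>t v. (v / 2) * inverse (sqrt t)" k] by blast
  qed
  then show ?thesis by (simp add: Cinf_on_def)
qed

section \<open>Local inversion of smooth maps\<close>

text \<open>A product rule in which one factor is merely continuous. It holds at a zero of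
  \<open>g\<close> because \<open>g\<close> is O(|y - x|) there and \<open>p y - p x\<close> tends
  to 0, so replacing \<open>p y\<close> by \<open>p x\<close> costs only o(|y - x|). It serves to
  differentiate inverse operators before anything beyond their continuity is known.\<close>

lemma has_derivative_scaleR_vanishing:
  fixes g :: "'a::real_normed_vector \<Rightarrow> real" and p :: "'a \<Rightarrow> 'b::real_normed_vector"
  assumes g: "(g has_derivative g') (at x)" and g0: "g x = 0" and p: "isCont p x"
  shows "((\<lambda>y. g y *\<^sub>R p y) has_derivative (\<lambda>h. g' h *\<^sub>R p x)) (at x)"
proof -
  obtain K where K: "\<And>h. norm (g' h) \<le> norm h * K"
    using bounded_linear.bounded[OF has_derivative_bounded_linear[OF g]] by blast
  have "((\<lambda>y. norm (g y - g' (y - x)) / norm (y - x)) \<longlongrightarrow> 0) (at x)"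
    using g g0 by (simp add: has_derivative_iff_norm)
  moreover have "((\<lambda>y. norm (p y - p x)) \<longlongrightarrow> 0) (at x)"
    using p by (intro tendsto_norm_zero) (simp add: isCont_def LIM_zero)
  ultimately have "((\<lambda>y. (norm (g y - g' (y - x)) / norm (y - x) + K) * norm (p y - p x))
      \<longlongrightarrow> (0 + K) * 0) (at x)"
    by (intro tendsto_intros)
  then have lim: "((\<lambda>y. (norm (g y - g' (y - x)) / norm (y - x) + K) * norm (p y - p x)) \<longlongrightarrow> 0) (at x)"
    by simp
  have "((\<lambda>y. g y *\<^sub>R (p y - p x)) has_derivative (\<lambda>h. 0)) (at x)"
    unfolding has_derivative_iff_norm
  proof (intro conjI bounded_linear_zero tendsto_sandwich[OF _ _ tendsto_const lim])
    show "\<forall>\<^sub>F y in at x. 0 \<le> norm (g y *\<^sub>R (p y - p x) - g x *\<^sub>R (p x - p x) - 0) / norm (y - x)"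
      by simp
    have "norm (g y *\<^sub>R (p y - p x)) / norm (y - x)
        \<le> (norm (g y - g' (y - x)) / norm (y - x) + K) * norm (p y - p x)" if "y \<noteq> x" for y
    proof -
      have "norm (g y) \<le> norm (g y - g' (y - x)) + norm (y - x) * K"
        using norm_triangle_sub[of "g y" "g' (y - x)"] K[of "y - x"] by linarith
      then have "norm (g y) / norm (y - x) \<le> norm (g y - g' (y - x)) / norm (y - x) + K"
        using that by (simp add: divide_simps mult.commute)
      then have "norm (g y) / norm (y - x) * norm (p y - p x)
          \<le> (norm (g y - g' (y - x)) / norm (y - x) + K) * norm (p y - p x)"
        by (intro mult_right_mono) auto
      then show ?thesis by simp
    qed
    then show "\<forall>\<^sub>F y in at x. norm (g y *\<^sub>R (p y - p x) - g x *\<^sub>R (p x - p x) - 0) / norm (y - x)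
        \<le> (norm (g y - g' (y - x)) / norm (y - x) + K) * norm (p y - p x)"
      by (auto simp: eventually_at_filter)
  qed
  moreover have "((\<lambda>y. g y *\<^sub>R p x) has_derivative (\<lambda>h. g' h *\<^sub>R p x)) (at x)"
    by (rule has_derivative_scaleR_left[OF g])
  ultimately have "((\<lambda>y. g y *\<^sub>R (p y - p x) + g y *\<^sub>R p x) has_derivative (\<lambda>h. 0 + g' h *\<^sub>R p x)) (at x)"
    by (rule has_derivative_add)
  then show ?thesis by (simp add: scaleR_diff_right)
qed

text \<open>The identity \<open>B y v - B z v = - B y (A y (B z v) - v)\<close> exhibits the increment as a continuous
  family applied to a differentiable map vanishing at \<open>z\<close>; this gives the derivative of \<open>B\<close> in terms
  of \<open>B\<close> and the derivative of \<open>A\<close>, and the induction on \<open>k\<close> runs.\<close>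

lemma Ck_on_inverse_linear:
  fixes A B :: "'y::real_normed_vector \<Rightarrow> 'e::euclidean_space \<Rightarrow> 'e"
  assumes S: "open S"
    and bound: "\<And>y w. y \<in> S \<Longrightarrow> norm w \<le> C * norm (A y w)"
    and linA: "\<And>y. y \<in> S \<Longrightarrow> linear (A y)" and linB: "\<And>y. y \<in> S \<Longrightarrow> linear (B y)"
    and AB: "\<And>y v. y \<in> S \<Longrightarrow> A y (B y v) = v" and BA: "\<And>y v. y \<in> S \<Longrightarrow> B y (A y v) = v"
  shows "(\<And>w. Ck_on k (\<lambda>y. A y w) S) \<Longrightarrow> Ck_on k (\<lambda>y. B y v) S"
proof -
  have diff: "B y v - B z v = - B y (A y (B z v) - v)" if "y \<in> S" "z \<in> S" for y z v
    using that by (simp add: linear_diff[OF linB] BA)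
  have cont: "isCont (\<lambda>y. B y v) z" if A0: "\<And>w. Ck_on 0 (\<lambda>y. A y w) S" and z: "z \<in> S" for v z
  proof -
    have "isCont (\<lambda>y. A y (B z v)) z"
      using A0 S z by (simp add: continuous_on_eq_continuous_at)
    then have "((\<lambda>y. A y (B z v) - v) \<longlongrightarrow> 0) (at z)"
      using z by (simp add: isCont_def AB LIM_zero)
    then have lim: "((\<lambda>y. C * norm (A y (B z v) - v)) \<longlongrightarrow> 0) (at z)"
      by (intro tendsto_mult_right_zero tendsto_norm_zero)
    \<comment> \<open>\<open>bound\<close> says that all \<open>B y\<close> have norm at most
      \<open>C\<close>. This uniformity lets the convergence of \<open>A y (B z v)\<close> to
      \<open>v\<close> control \<open>B y v\<close>.\<close>
    have "norm (B y v - B z v) \<le> C * norm (A y (B z v) - v)" if "y \<in> S" for y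
      using bound[OF that, of "B y (A y (B z v) - v)"] that by (simp add: diff[OF that z] AB)
    then have "((\<lambda>y. B y v - B z v) \<longlongrightarrow> 0) (at z)"
      using eventually_at_in_open'[OF S z]
      by (intro Lim_null_comparison[OF _ lim]) (auto elim: eventually_mono)
    then show ?thesis by (simp add: isCont_def LIM_zero_iff)
  qed
  show "Ck_on k (\<lambda>y. B y v) S" if "\<And>w. Ck_on k (\<lambda>y. A y w) S"
    using that
  proof (induction k arbitrary: v)
    case 0
    then show ?case
      using cont by (simp add: continuous_at_imp_continuous_on)
  next
    case (Suc k)
    have A: "Ck_on k (\<lambda>y. A y w) S" for w
      by (rule Ck_on_Suc_D[OF Suc.prems])
    have "Ck_on 0 (\<lambda>y. A y w) S" for w
      using Ck_on_continuous_on[OF Suc.prems] by simp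
    then have contB: "isCont (\<lambda>y. B y v) z" if "z \<in> S" for v z
      using cont that by blast
    let ?A' = "\<lambda>z c. frechet_derivative (\<lambda>y. A y c) (at z)"
    let ?D = "\<lambda>z h. - (\<Sum>b\<in>Basis. ((\<Sum>c\<in>Basis. (B z v \<bullet> c) *\<^sub>R ?A' z c h) \<bullet> b) *\<^sub>R B z b)"
    have der: "((\<lambda>y. B y v) has_derivative ?D z) (at z)" if z: "z \<in> S" for z
    proof -
      \<comment> \<open>The coefficients are frozen at \<open>z\<close>, so that only the maps
        \<open>A y c\<close> in fixed directions \<open>c\<close> have to be differentiated.\<close>
      define g where "g y = (\<Sum>c\<in>Basis. (B z v \<bullet> c) *\<^sub>R A y c) - v" for y
      have g: "g y = A y (B z v) - v" if "y \<in> S" for y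
        unfolding g_def by (subst linear_apply_basis_expansion[OF linA[OF that]]) simp
      have "((\<lambda>y. A y c) has_derivative ?A' z c) (at z)" for c
        using Suc.prems[of c] z by (simp add: frechet_derivative_works)
      then have "(g has_derivative (\<lambda>h. \<Sum>c\<in>Basis. (B z v \<bullet> c) *\<^sub>R ?A' z c h)) (at z)"
        unfolding g_def by (auto intro!: derivative_eq_intros)
      then have gb: "((\<lambda>y. g y \<bullet> b) has_derivative (\<lambda>h. (\<Sum>c\<in>Basis. (B z v \<bullet> c) *\<^sub>R ?A' z c h) \<bullet> b)) (at z)"
        for b by (rule has_derivative_inner_left)
      \<comment> \<open>The function is \<open>B y v\<close>, rewritten by \<open>diff\<close>. Each
        summand is a differentiable scalar that vanishes at \<open>z\<close> times a vector known
        only to be continuous.\<close>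
      have "((\<lambda>y. B z v - (\<Sum>b\<in>Basis. (g y \<bullet> b) *\<^sub>R B y b)) has_derivative
          (\<lambda>h. 0 - (\<Sum>b\<in>Basis. ((\<Sum>c\<in>Basis. (B z v \<bullet> c) *\<^sub>R ?A' z c h) \<bullet> b) *\<^sub>R B z b))) (at z)"
        by (intro has_derivative_diff has_derivative_const has_derivative_sum
            has_derivative_scaleR_vanishing[OF gb _ contB[OF z]])
           (simp add: g[OF z] AB[OF z])
      then have "((\<lambda>y. B z v - (\<Sum>b\<in>Basis. (g y \<bullet> b) *\<^sub>R B y b)) has_derivative ?D z) (at z)"
        by simp
      then show ?thesis
      proof (rule has_derivative_transform_within_open[OF _ S z])
        fix y assume y: "y \<in> S"
        have "(\<Sum>b\<in>Basis. (g y \<bullet> b) *\<^sub>R B y b) = B y (g y)"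
          by (rule linear_apply_basis_expansion[OF linB[OF y], symmetric])
        then show "B z v - (\<Sum>b\<in>Basis. (g y \<bullet> b) *\<^sub>R B y b) = B y v"
          using diff[OF y z, of v] by (simp add: g[OF y] algebra_simps)
      qed
    qed
    have D: "Ck_on k (\<lambda>z. ?D z h) S" for h
      using Suc.IH[OF A] Suc.prems
      by (intro S Ck_on_bounded_linear[OF bounded_linear_minus[OF bounded_linear_ident]] Ck_on_sum
          Ck_on_bounded_bilinear[OF bounded_bilinear_scaleR]
          Ck_on_bounded_linear[OF bounded_linear_inner_left]) simp_all
    show ?case
      by (rule Ck_on_Suc_intro[OF S der D])
  qed
qed

text \<open>The classical theorem gives an inverse \<open>g\<close> that is differentiable with
  derivative the inverse of \<open>f' (g y)\<close>. Higher regularity is a bootstrap. The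
  normalisation of the derivative at \<open>x0\<close> to the identity gives the uniform bound that
  \<open>Ck_on_inverse_linear\<close> asks for.\<close>

lemma smooth_local_inverse:
  fixes f :: "'e::euclidean_space \<Rightarrow> 'e"
  assumes f: "Cinf_on f U" and U: "open U" and x0: "x0 \<in> U"
    and id: "frechet_derivative f (at x0) = (\<lambda>v. v)"
  obtains U' V g where "open U'" "U' \<subseteq> U" "x0 \<in> U'" "open V" "homeomorphism U' V f g" "Cinf_on g V"
proof -
  define f' where "f' x = Blinfun (frechet_derivative f (at x))" for x
  have f': "blinfun_apply (f' x) = frechet_derivative f (at x)" if "x \<in> U" for x
    unfolding f'_def
    by (rule bounded_linear_Blinfun_apply)
       (use Cinf_on_has_derivative[OF f that] has_derivative_bounded_linear in blast)
  have cont: "continuous_on U f'"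
  proof (rule continuous_on_blinfun_componentwise)
    fix i :: 'e
    have "continuous_on U (\<lambda>x. frechet_derivative f (at x) i)"
      by (rule Cinf_on_continuous_on[OF Cinf_on_frechet_derivative[OF f]])
    then show "continuous_on U (\<lambda>x. blinfun_apply (f' x) i)"
      by (rule continuous_on_eq) (simp add: f')
  qed
  \<comment> \<open>Within distance 1/2 of the identity an operator satisfies
    \<open>|f' x w - w| \<le> |w| / 2\<close>, hence \<open>|w| \<le> 2 |f' x w|\<close>; this is
    the constant 2 below.\<close>
  define U1 where "U1 = {x \<in> U. norm (f' x - id_blinfun) < 1 / 2}"
  have "open U1"
  proof -
    have "continuous_on U (\<lambda>x. norm (f' x - id_blinfun))"
      by (intro continuous_intros cont)
    then have "open (U \<inter> (\<lambda>x. norm (f' x - id_blinfun)) -` {..<1/2})"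
      by (rule continuous_open_preimage[OF _ U]) auto
    moreover have "U \<inter> (\<lambda>x. norm (f' x - id_blinfun)) -` {..<1/2} = U1"
      by (auto simp: U1_def)
    ultimately show ?thesis by simp
  qed
  have f'x0: "f' x0 = id_blinfun"
    by (rule blinfun_eqI) (simp add: f'[OF x0] id)
  then have "x0 \<in> U1"
    using x0 by (simp add: U1_def)
  have U1: "U1 \<subseteq> U" by (auto simp: U1_def)
  have bound: "norm w \<le> 2 * norm (blinfun_apply (f' x) w)" if "x \<in> U1" for x w
  proof -
    have "norm (blinfun_apply (f' x - id_blinfun) w) \<le> norm (f' x - id_blinfun) * norm w"
      by (rule norm_blinfun)
    also have "\<dots> \<le> 1 / 2 * norm w"
      using that by (intro mult_right_mono) (auto simp: U1_def)
    finally have "norm (blinfun_apply (f' x) w - w) \<le> 1 / 2 * norm w"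
      by (simp add: blinfun.diff_left)
    then show ?thesis
      using norm_triangle_ineq2[of w "blinfun_apply (f' x) w"] by (simp add: norm_minus_commute)
  qed
  obtain U' V g g' where *: "open U'" "U' \<subseteq> U1" "x0 \<in> U'" "open V" "homeomorphism U' V f g"
      "\<And>y. y \<in> V \<Longrightarrow> (g has_derivative (g' y)) (at y)"
      "\<And>y. y \<in> V \<Longrightarrow> g' y = inv (blinfun_apply (f' (g y)))"
      "\<And>y. y \<in> V \<Longrightarrow> bij (blinfun_apply (f' (g y)))"
  proof (rule inverse_function_theorem[of U1 f f' x0 id_blinfun])
    show "(f has_derivative blinfun_apply (f' x)) (at x)" if "x \<in> U1" for x
      using Cinf_on_has_derivative[OF f] f' U1 that by auto
    show "id_blinfun o\<^sub>L f' x0 = id_blinfun"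
      by (rule blinfun_eqI) (simp add: f'x0)
  qed (use \<open>open U1\<close> \<open>x0 \<in> U1\<close> cont U1 continuous_on_subset in auto)
  have gV: "g ` V \<subseteq> U1"
    using *(2,5) by (auto simp: homeomorphism_def)
  have "Ck_on k g V" for k
  \<comment> \<open>Bootstrap: if \<open>g\<close> is C^k then so is \<open>f' (g y)\<close> in each
    fixed direction, hence so is its inverse \<open>g' y\<close>, and \<open>g\<close> is
    C^(k+1).\<close>
  proof (induction k)
    case 0
    then show ?case using *(5) by (simp add: homeomorphism_def)
  next
    case (Suc k)
    show ?case
    proof (rule Ck_on_Suc_intro[OF \<open>open V\<close> *(6)])
      show "Ck_on k (\<lambda>y. g' y v) V" for v
      proof (rule Ck_on_inverse_linear[where C = 2 and A = "\<lambda>y. blinfun_apply (f' (g y))", OF \<open>open V\<close>])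
        show "Ck_on k (\<lambda>y. blinfun_apply (f' (g y)) w) V" for w
        proof (rule Ck_on_cong[OF \<open>open V\<close>])
          show "Ck_on k (\<lambda>y. frechet_derivative f (at (g y)) w) V"
            by (rule Ck_on_compose[OF \<open>open V\<close> \<open>open U1\<close> gV Suc])
               (use Cinf_on_subset[OF Cinf_on_frechet_derivative[OF f] U1] in \<open>auto simp: Cinf_on_def\<close>)
          show "frechet_derivative f (at (g y)) w = blinfun_apply (f' (g y)) w" if "y \<in> V" for y
          proof -
            have "g y \<in> U" using that gV U1 by blast
            then show ?thesis by (simp add: f')
          qed
        qed
        show "linear (g' y)" if "y \<in> V" for y
          using *(6)[OF that] by (rule has_derivative_linear)
        show "norm w \<le> 2 * norm (blinfun_apply (f' (g y)) w)" if "y \<in> V" for y w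
          using that gV by (intro bound) auto
        show "linear (blinfun_apply (f' (g y)))" for y
          by (rule bounded_linear.linear[OF blinfun.bounded_linear_right])
        show "blinfun_apply (f' (g y)) (g' y v) = v" if "y \<in> V" for y v
          using *(7,8)[OF that] by (simp add: bij_is_surj surj_f_inv_f)
        show "g' y (blinfun_apply (f' (g y)) v) = v" if "y \<in> V" for y v
          using *(7,8)[OF that] by (simp add: bij_is_inj inv_f_f)
      qed
    qed
  qed
  then have "Cinf_on g V" by (simp add: Cinf_on_def)
  then show thesis
    using that *(1-5) U1 by blast
qed

text \<open>\<open>P\<close> is a linear left inverse of the derivative at \<open>x0\<close>, so
  \<open>P\<close> after \<open>f\<close> has derivative the identity there. The resulting
  \<open>r\<close>, a local inverse of this map composed with \<open>P\<close>, lives on a whole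
  open set of the target and not only on the image of \<open>f\<close>, as smoothness on a subset
  demands.\<close>

lemma immersion_local_left_inverse:
  fixes f :: "'e::euclidean_space \<Rightarrow> 'f::euclidean_space"
  assumes f: "Cinf_on f D" and D: "open D" and x0: "x0 \<in> D"
    and inj: "inj (frechet_derivative f (at x0))"
  obtains U V r where "open U" "U \<subseteq> D" "x0 \<in> U" "open V" "f ` U \<subseteq> V" "r ` V \<subseteq> U" "Cinf_on r V"
    "\<And>x. x \<in> U \<Longrightarrow> r (f x) = x"
proof -
  have der: "(f has_derivative frechet_derivative f (at x)) (at x)" if "x \<in> D" for x
    by (rule Cinf_on_has_derivative[OF f that])
  obtain P :: "'f \<Rightarrow> 'e" where P: "linear P" "P \<circ> frechet_derivative f (at x0) = id"
    using linear_injective_left_inverse[OF has_derivative_linear[OF der[OF x0]] inj] by auto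
  have blP: "bounded_linear P"
    using P(1) by (simp add: linear_conv_bounded_linear)
  have "((\<lambda>x. P (f x)) has_derivative (\<lambda>v. P (frechet_derivative f (at x0) v))) (at x0)"
    by (rule bounded_linear.has_derivative[OF blP der[OF x0]])
  then have "frechet_derivative (\<lambda>x. P (f x)) (at x0) = (\<lambda>v. P (frechet_derivative f (at x0) v))"
    by (rule frechet_derivative_at[symmetric])
  also have "\<dots> = (\<lambda>v. v)"
    using P(2) by (simp add: fun_eq_iff)
  finally obtain U V g where *: "open U" "U \<subseteq> D" "x0 \<in> U" "open V"
      "homeomorphism U V (\<lambda>x. P (f x)) g" "Cinf_on g V"
    using smooth_local_inverse[OF Cinf_on_bounded_linear[OF blP D f] D x0] by blast
  have op: "open (P -` V)"
    by (rule open_vimage[OF \<open>open V\<close> linear_continuous_on[OF blP]])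
  have "Cinf_on P (P -` V)"
    by (rule Cinf_on_bounded_linear[OF blP op Cinf_on_id])
  then have "Cinf_on (\<lambda>y. g (P y)) (P -` V)"
    by (rule Cinf_on_compose[OF \<open>Cinf_on g V\<close> _ op \<open>open V\<close>]) auto
  moreover have "f ` U \<subseteq> P -` V" "(\<lambda>y. g (P y)) ` (P -` V) \<subseteq> U" "\<And>x. x \<in> U \<Longrightarrow> g (P (f x)) = x"
    using *(5) by (auto simp: homeomorphism_def)
  ultimately show thesis
    using that[of U "P -` V" "\<lambda>y. g (P y)"] *(1-3) op by blast
qed

section \<open>Manifolds and smooth maps\<close>

text \<open>The chart conditions alone: arguments about smooth maps are stated for them, and for
  \<open>total_space\<close> they are read off from its two explicit charts.\<close>

definition smooth_atlas :: "('a, 'e::euclidean_space) manifold \<Rightarrow> bool" where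
  "smooth_atlas X \<longleftrightarrow>
     \<Union> (fst ` atlas X) = points X \<and>
     (\<forall>(U, \<phi>) \<in> atlas X. openin (mtop X) U \<and> open (\<phi> ` U) \<and>
        homeomorphic_map (subtopology (mtop X) U) (top_of_set (\<phi> ` U)) \<phi>) \<and>
     (\<forall>(U, \<phi>) \<in> atlas X. \<forall>(V, \<psi>) \<in> atlas X. Cinf_on (\<psi> \<circ> inv_into U \<phi>) (\<phi> ` (U \<inter> V)))"

lemma smooth_manifold_iff_smooth_atlas:
  "smooth_manifold X \<longleftrightarrow>
     Hausdorff_space (mtop X) \<and> second_countable (mtop X) \<and> smooth_atlas X"
  unfolding smooth_manifold_def smooth_atlas_def by blast

lemma continuous_map_local:
  assumes "\<And>x. x \<in> topspace X \<Longrightarrow>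
    \<exists>W. openin X W \<and> x \<in> W \<and> continuous_map (subtopology X W) Y f"
  shows "continuous_map X Y f"
  by (rule pasting_lemma[where I = "{W. openin X W \<and> continuous_map (subtopology X W) Y f}"
        and T = "\<lambda>W. W" and f = "\<lambda>_. f"]) (use assms in auto)

lemma smooth_atlasD:
  assumes "smooth_atlas X" "(U, \<phi>) \<in> atlas X"
  shows chart_openin: "openin (mtop X) U"
    and chart_subset: "U \<subseteq> points X"
    and chart_open_range: "open (\<phi> ` U)"
    and chart_homeomorphic: "homeomorphic_map (subtopology (mtop X) U) (top_of_set (\<phi> ` U)) \<phi>"
    and chart_inj_on: "inj_on \<phi> U"
proof -
  show *: "openin (mtop X) U" "open (\<phi> ` U)"
    "homeomorphic_map (subtopology (mtop X) U) (top_of_set (\<phi> ` U)) \<phi>"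
    using assms unfolding smooth_atlas_def by auto
  show "U \<subseteq> points X"
    by (rule openin_subset[OF *(1)])
  then show "inj_on \<phi> U"
    using homeomorphic_imp_injective_map[OF *(3)] by (simp add: inf_absorb2)
qed

lemma smooth_atlas_transition:
  "smooth_atlas X \<Longrightarrow> (U, \<phi>) \<in> atlas X \<Longrightarrow> (V, \<psi>) \<in> atlas X \<Longrightarrow>
    Cinf_on (\<psi> \<circ> inv_into U \<phi>) (\<phi> ` (U \<inter> V))"
  unfolding smooth_atlas_def by fast

lemma smooth_atlas_cover:
  assumes "smooth_atlas X" "x \<in> points X"
  obtains U \<phi> where "(U, \<phi>) \<in> atlas X" "x \<in> U"
proof -
  have "x \<in> \<Union> (fst ` atlas X)"
    using assms unfolding smooth_atlas_def by blast
  then show thesis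
    using that by auto
qed

lemma chart_inv_into:
  "smooth_atlas X \<Longrightarrow> (U, \<phi>) \<in> atlas X \<Longrightarrow> x \<in> U \<Longrightarrow> inv_into U \<phi> (\<phi> x) = x"
  by (simp add: chart_inj_on)

lemma chart_open_image:
  assumes X: "smooth_atlas X" "(U, \<phi>) \<in> atlas X" and W: "openin (mtop X) W" "W \<subseteq> U"
  shows "open (\<phi> ` W)"
proof -
  have "openin (subtopology (mtop X) U) W"
    using W by (auto simp: openin_subtopology)
  then have "openin (top_of_set (\<phi> ` U)) (\<phi> ` W)"
    using homeomorphic_imp_open_map[OF chart_homeomorphic[OF X]] by (simp add: open_map_def)
  then show ?thesis
    using chart_open_range[OF X] by (simp add: openin_open_eq)
qed

lemma chart_continuous_map:
  assumes X: "smooth_atlas X" "(U, \<phi>) \<in> atlas X"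
  shows "continuous_map (subtopology (mtop X) U) euclidean \<phi>"
  using homeomorphic_imp_continuous_map[OF chart_homeomorphic[OF X]]
  by (rule continuous_map_into_fulltopology)

lemma chart_inv_continuous_map:
  assumes X: "smooth_atlas X" "(U, \<phi>) \<in> atlas X"
  shows "continuous_map (top_of_set (\<phi> ` U)) (subtopology (mtop X) U) (inv_into U \<phi>)"
proof -
  obtain g where g: "homeomorphic_maps (subtopology (mtop X) U) (top_of_set (\<phi> ` U)) \<phi> g"
    using chart_homeomorphic[OF X] by (auto simp: homeomorphic_map_maps)
  then have "continuous_map (top_of_set (\<phi> ` U)) (subtopology (mtop X) U) g"
    by (simp add: homeomorphic_maps_def)
  moreover have "g y = inv_into U \<phi> y" if y: "y \<in> \<phi> ` U" for y
  proof -
    obtain x where x: "x \<in> U" "y = \<phi> x" using y by blast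
    then have "g y = x"
      using g chart_subset[OF X] by (auto simp: homeomorphic_maps_def)
    then show ?thesis
      using x chart_inv_into[OF X] by simp
  qed
  ultimately show ?thesis
    by (rule continuous_map_eq) simp
qed

lemma openin_preimage:
  "continuous_map X Y f \<Longrightarrow> openin X U \<Longrightarrow> openin Y V \<Longrightarrow> openin X {x \<in> U. f x \<in> V}"
proof -
  assume f: "continuous_map X Y f" and U: "openin X U" and V: "openin Y V"
  have "openin X (U \<inter> {x \<in> topspace X. f x \<in> V})"
    by (intro openin_Int U openin_continuous_map_preimage[OF f V])
  moreover have "U \<inter> {x \<in> topspace X. f x \<in> V} = {x \<in> U. f x \<in> V}"
    using openin_subset[OF U] by auto
  ultimately show ?thesis by simp
qed

lemma smooth_map_continuous: "smooth_map X Y f \<Longrightarrow> continuous_map (mtop X) (mtop Y) f"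
  by (simp add: smooth_map_def)

lemma smooth_map_rep:
  "smooth_map X Y f \<Longrightarrow> (U, \<phi>) \<in> atlas X \<Longrightarrow> (V, \<psi>) \<in> atlas Y \<Longrightarrow>
    Cinf_on (\<psi> \<circ> f \<circ> inv_into U \<phi>) (\<phi> ` {x \<in> U. f x \<in> V})"
  unfolding smooth_map_def by fast

lemma smooth_map_points: "smooth_map X Y f \<Longrightarrow> x \<in> points X \<Longrightarrow> f x \<in> points Y"
  using smooth_map_continuous by (fastforce simp: continuous_map_def)

lemma smooth_map_rep_open:
  assumes "smooth_atlas X" "smooth_atlas Y" "continuous_map (mtop X) (mtop Y) f"
    and "(U, \<phi>) \<in> atlas X" "(V, \<psi>) \<in> atlas Y"
  shows "open (\<phi> ` {x \<in> U. f x \<in> V})"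
  by (intro chart_open_image[OF assms(1,4)] openin_preimage[OF assms(3)]
      chart_openin[OF assms(1,4)] chart_openin[OF assms(2,5)]) auto

lemma smooth_mapI:
  assumes "continuous_map (mtop X) (mtop Y) f"
    and "\<And>U \<phi> V \<psi> x. (U, \<phi>) \<in> atlas X \<Longrightarrow> (V, \<psi>) \<in> atlas Y \<Longrightarrow> x \<in> U \<Longrightarrow> f x \<in> V \<Longrightarrow>
      \<exists>T. open T \<and> \<phi> x \<in> T \<and> Cinf_on (\<psi> \<circ> f \<circ> inv_into U \<phi>) T"
  shows "smooth_map X Y f"
proof -
  have "Cinf_on (\<psi> \<circ> f \<circ> inv_into U \<phi>) (\<phi> ` {x \<in> U. f x \<in> V})"
    if "(U, \<phi>) \<in> atlas X" and "(V, \<psi>) \<in> atlas Y" for U \<phi> V \<psi>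
  proof (rule Cinf_on_local)
    fix e assume "e \<in> \<phi> ` {x \<in> U. f x \<in> V}"
    then obtain x where "x \<in> U" "f x \<in> V" "e = \<phi> x" by blast
    then show "\<exists>T. open T \<and> e \<in> T \<and> Cinf_on (\<psi> \<circ> f \<circ> inv_into U \<phi>) T"
      using assms(2)[OF that] by simp
  qed
  then show ?thesis
    using assms(1) unfolding smooth_map_def by fast
qed

lemma smooth_map_cong:
  assumes X: "smooth_atlas X" and Y: "smooth_atlas Y"
    and f: "smooth_map X Y f" and eq: "\<And>x. x \<in> points X \<Longrightarrow> f x = g x"
  shows "smooth_map X Y g"
proof (rule smooth_mapI)
  show "continuous_map (mtop X) (mtop Y) g"
    by (rule continuous_map_eq[OF smooth_map_continuous[OF f] eq])
  fix U \<phi> V \<psi> x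
  assume c: "(U, \<phi>) \<in> atlas X" "(V, \<psi>) \<in> atlas Y" and x: "x \<in> U" "g x \<in> V"
  let ?T = "\<phi> ` {x \<in> U. f x \<in> V}"
  have op: "open ?T"
    by (rule smooth_map_rep_open[OF X Y smooth_map_continuous[OF f] c])
  have eq': "f x = g x" if "x \<in> U" for x
    using chart_subset[OF X c(1)] that eq by blast
  have "Cinf_on (\<psi> \<circ> g \<circ> inv_into U \<phi>) ?T"
    by (rule Cinf_on_cong[OF smooth_map_rep[OF f c] op])
       (auto simp: chart_inv_into[OF X c(1)] eq')
  then show "\<exists>T. open T \<and> \<phi> x \<in> T \<and> Cinf_on (\<psi> \<circ> g \<circ> inv_into U \<phi>) T"
    using op x by (intro exI[of _ ?T]) (simp add: eq')
qed

lemma smooth_map_compose: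
  assumes X: "smooth_atlas X" and Y: "smooth_atlas Y" and Z: "smooth_atlas Z"
    and f: "smooth_map X Y f" and g: "smooth_map Y Z g"
  shows "smooth_map X Z (g \<circ> f)"
proof (rule smooth_mapI)
  show gf: "continuous_map (mtop X) (mtop Z) (g \<circ> f)"
    by (rule continuous_map_compose[OF smooth_map_continuous[OF f] smooth_map_continuous[OF g]])
  fix U \<phi> V \<psi> x
  assume c: "(U, \<phi>) \<in> atlas X" "(V, \<psi>) \<in> atlas Z" and x: "x \<in> U" "(g \<circ> f) x \<in> V"
  have "f x \<in> points Y"
    using smooth_map_points[OF f] chart_subset[OF X c(1)] x by blast
  then obtain W \<kappa> where W: "(W, \<kappa>) \<in> atlas Y" "f x \<in> W"
    using smooth_atlas_cover[OF Y] by blast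
  let ?T = "\<phi> ` {x \<in> U. f x \<in> W \<and> g (f x) \<in> V}"
  have "openin (mtop X) {x \<in> {x \<in> U. f x \<in> W}. (g \<circ> f) x \<in> V}"
    by (intro openin_preimage[OF gf] openin_preimage[OF smooth_map_continuous[OF f]]
        chart_openin[OF X c(1)] chart_openin[OF Y W(1)] chart_openin[OF Z c(2)])
  then have "open (\<phi> ` {x \<in> {x \<in> U. f x \<in> W}. (g \<circ> f) x \<in> V})"
    by (rule chart_open_image[OF X c(1)]) auto
  then have op: "open ?T"
    by (simp add: conj_assoc)
  have fT: "Cinf_on (\<kappa> \<circ> f \<circ> inv_into U \<phi>) ?T"
    by (rule Cinf_on_subset[OF smooth_map_rep[OF f c(1) W(1)]]) auto
  have "Cinf_on (\<lambda>e. (\<psi> \<circ> g \<circ> inv_into W \<kappa>) ((\<kappa> \<circ> f \<circ> inv_into U \<phi>) e)) ?T"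
    by (rule Cinf_on_compose[OF smooth_map_rep[OF g W(1) c(2)] fT op
          smooth_map_rep_open[OF Y Z smooth_map_continuous[OF g] W(1) c(2)]])
       (auto simp: chart_inv_into[OF X c(1)])
  then have "Cinf_on (\<psi> \<circ> (g \<circ> f) \<circ> inv_into U \<phi>) ?T"
    by (rule Cinf_on_cong[OF _ op])
       (auto simp: chart_inv_into[OF X c(1)] chart_inv_into[OF Y W(1)])
  then show "\<exists>T. open T \<and> \<phi> x \<in> T \<and> Cinf_on (\<psi> \<circ> (g \<circ> f) \<circ> inv_into U \<phi>) T"
    using op x W(2) by (intro exI[of _ ?T]) auto
qed

text \<open>\<open>open_submanifold\<close> keeps a chart map but shrinks its domain, on which the
  inverse chart \<open>inv_into\<close> formally depends.\<close>

lemma inv_into_Int: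
  assumes "inj_on f U" "y \<in> f ` (U \<inter> W)"
  shows "inv_into (U \<inter> W) f y = inv_into U f y"
  using assms by (auto simp: inv_into_f_f inj_on_Int)

section \<open>Open submanifolds, locality of smoothness, and embeddings\<close>

lemma open_submanifold_simps [simp]:
  "mtop (open_submanifold X W) = subtopology (mtop X) W"
  "atlas (open_submanifold X W) = {(U \<inter> W, \<phi>) | U \<phi>. (U, \<phi>) \<in> atlas X}"
  by (simp_all add: open_submanifold_def)

lemma smooth_atlas_open_submanifold:
  assumes X: "smooth_atlas X" and W: "openin (mtop X) W"
  shows "smooth_atlas (open_submanifold X W)"
  unfolding smooth_atlas_def
proof (intro conjI)
  have "\<Union> (fst ` atlas X) = points X"
    using X by (simp add: smooth_atlas_def)
  moreover have "\<Union> (fst ` atlas (open_submanifold X W)) = \<Union> (fst ` atlas X) \<inter> W"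
    by force
  ultimately show "\<Union> (fst ` atlas (open_submanifold X W)) = points (open_submanifold X W)"
    by simp
  have "openin (subtopology (mtop X) W) (U \<inter> W) \<and> open (\<phi> ` (U \<inter> W)) \<and>
      homeomorphic_map (subtopology (subtopology (mtop X) W) (U \<inter> W)) (top_of_set (\<phi> ` (U \<inter> W))) \<phi>"
    if c: "(U, \<phi>) \<in> atlas X" for U \<phi>
  proof (intro conjI)
    show "openin (subtopology (mtop X) W) (U \<inter> W)"
      using chart_openin[OF X c] by (auto simp: openin_subtopology)
    show "open (\<phi> ` (U \<inter> W))"
      using chart_openin[OF X c] W by (intro chart_open_image[OF X c]) auto
    have "homeomorphic_map (subtopology (subtopology (mtop X) U) (U \<inter> W))
        (subtopology (top_of_set (\<phi> ` U)) (\<phi> ` (U \<inter> W))) \<phi>"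
      using chart_subset[OF X c]
      by (intro homeomorphic_map_subtopologies[OF chart_homeomorphic[OF X c]]) auto
    moreover have "\<phi> ` U \<inter> \<phi> ` (U \<inter> W) = \<phi> ` (U \<inter> W)" "U \<inter> (U \<inter> W) = U \<inter> W" "W \<inter> (U \<inter> W) = U \<inter> W"
      by auto
    ultimately show "homeomorphic_map (subtopology (subtopology (mtop X) W) (U \<inter> W))
        (top_of_set (\<phi> ` (U \<inter> W))) \<phi>"
      by (simp only: subtopology_subtopology)
  qed
  then show "\<forall>(U, \<phi>)\<in>atlas (open_submanifold X W). openin (mtop (open_submanifold X W)) U \<and>
      open (\<phi> ` U) \<and>
      homeomorphic_map (subtopology (mtop (open_submanifold X W)) U) (top_of_set (\<phi> ` U)) \<phi>"
    by auto
  have "Cinf_on (\<psi> \<circ> inv_into (U \<inter> W) \<phi>) (\<phi> ` (U \<inter> W \<inter> (V \<inter> W)))"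
    if c: "(U, \<phi>) \<in> atlas X" "(V, \<psi>) \<in> atlas X" for U \<phi> V \<psi>
  proof (rule Cinf_on_cong)
    show "Cinf_on (\<psi> \<circ> inv_into U \<phi>) (\<phi> ` (U \<inter> W \<inter> (V \<inter> W)))"
      by (rule Cinf_on_subset[OF smooth_atlas_transition[OF X c]]) auto
    show "open (\<phi> ` (U \<inter> W \<inter> (V \<inter> W)))"
      using chart_openin[OF X c(1)] chart_openin[OF X c(2)] W by (intro chart_open_image[OF X c(1)]) auto
    show "(\<psi> \<circ> inv_into U \<phi>) e = (\<psi> \<circ> inv_into (U \<inter> W) \<phi>) e"
      if "e \<in> \<phi> ` (U \<inter> W \<inter> (V \<inter> W))" for e
      using that inv_into_Int[OF chart_inj_on[OF X c(1)], of e W] by auto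
  qed
  then show "\<forall>(U, \<phi>)\<in>atlas (open_submanifold X W). \<forall>(V, \<psi>)\<in>atlas (open_submanifold X W).
      Cinf_on (\<psi> \<circ> inv_into U \<phi>) (\<phi> ` (U \<inter> V))"
    by auto
qed

lemma smooth_map_restrict:
  assumes X: "smooth_atlas X" and Y: "smooth_atlas Y" and f: "smooth_map X Y f"
    and W: "openin (mtop Y) W"
  shows "smooth_map (open_submanifold X {x \<in> points X. f x \<in> W}) (open_submanifold Y W) f"
    (is "smooth_map (open_submanifold X ?W) _ _")
proof (rule smooth_mapI)
  have W': "openin (mtop X) ?W"
    by (rule openin_preimage[OF smooth_map_continuous[OF f] _ W]) simp
  show "continuous_map (mtop (open_submanifold X ?W)) (mtop (open_submanifold Y W)) f"
    using smooth_map_continuous[OF f]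
    by (auto simp: continuous_map_in_subtopology intro: continuous_map_from_subtopology)
  fix U' \<phi> V' \<psi> x
  assume "(U', \<phi>) \<in> atlas (open_submanifold X ?W)" "(V', \<psi>) \<in> atlas (open_submanifold Y W)"
    and x: "x \<in> U'" "f x \<in> V'"
  then obtain U V where c: "(U, \<phi>) \<in> atlas X" "(V, \<psi>) \<in> atlas Y"
    and U': "U' = U \<inter> ?W" and V': "V' = V \<inter> W" by auto
  let ?T = "\<phi> ` {x \<in> U \<inter> ?W. f x \<in> V}"
  have op: "open ?T"
    using chart_openin[OF X c(1)] W'
    by (intro chart_open_image[OF X c(1)] openin_preimage[OF smooth_map_continuous[OF f]]
        chart_openin[OF Y c(2)]) auto
  have "Cinf_on (\<psi> \<circ> f \<circ> inv_into U \<phi>) ?T"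
    by (rule Cinf_on_subset[OF smooth_map_rep[OF f c]]) auto
  then have "Cinf_on (\<psi> \<circ> f \<circ> inv_into U' \<phi>) ?T"
  proof (rule Cinf_on_cong[OF _ op])
    show "(\<psi> \<circ> f \<circ> inv_into U \<phi>) e = (\<psi> \<circ> f \<circ> inv_into U' \<phi>) e" if "e \<in> ?T" for e
      using that inv_into_Int[OF chart_inj_on[OF X c(1)], of e ?W] unfolding U' by auto
  qed
  then show "\<exists>T. open T \<and> \<phi> x \<in> T \<and> Cinf_on (\<psi> \<circ> f \<circ> inv_into U' \<phi>) T"
    using op x unfolding U' V' by (intro exI[of _ ?T]) auto
qed

lemma smooth_map_local:
  assumes X: "smooth_atlas X"
    and loc: "\<And>x. x \<in> points X \<Longrightarrow>
      \<exists>W. openin (mtop X) W \<and> x \<in> W \<and> smooth_map (open_submanifold X W) Y f"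
    and Y: "smooth_atlas Y"
  shows "smooth_map X Y f"
proof (rule smooth_mapI)
  show "continuous_map (mtop X) (mtop Y) f"
    by (rule continuous_map_local) (use loc in \<open>fastforce dest: smooth_map_continuous\<close>)
  fix U \<phi> V \<psi> x
  assume c: "(U, \<phi>) \<in> atlas X" "(V, \<psi>) \<in> atlas Y" and x: "x \<in> U" "f x \<in> V"
  then obtain W where W: "openin (mtop X) W" "x \<in> W" "smooth_map (open_submanifold X W) Y f"
    using loc chart_subset[OF X c(1)] by blast
  have c': "(U \<inter> W, \<phi>) \<in> atlas (open_submanifold X W)"
    using c by auto
  let ?T = "\<phi> ` {x \<in> U \<inter> W. f x \<in> V}"
  have op: "open ?T"
    by (rule smooth_map_rep_open[OF smooth_atlas_open_submanifold[OF X W(1)] Y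
          smooth_map_continuous[OF W(3)] c' c(2)])
  have "Cinf_on (\<psi> \<circ> f \<circ> inv_into U \<phi>) ?T"
  proof (rule Cinf_on_cong[OF smooth_map_rep[OF W(3) c' c(2)] op])
    show "(\<psi> \<circ> f \<circ> inv_into (U \<inter> W) \<phi>) e = (\<psi> \<circ> f \<circ> inv_into U \<phi>) e" if "e \<in> ?T" for e
      using that inv_into_Int[OF chart_inj_on[OF X c(1)], of e W] by auto
  qed
  then show "\<exists>T. open T \<and> \<phi> x \<in> T \<and> Cinf_on (\<psi> \<circ> f \<circ> inv_into U \<phi>) T"
    using op x W(2) by (intro exI[of _ ?T]) simp
qed

text \<open>Injectivity of the differential inverts \<open>f\<close> only near \<open>x\<close>;
  distant parts of \<open>X\<close> could still be mapped close to \<open>f x\<close>. The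
  homeomorphism onto the image excludes them after the neighbourhood in \<open>Y\<close> is
  shrunk.\<close>

lemma smooth_embedding_diffeomorphism_onto:
  fixes X :: "('a, 'e::euclidean_space) manifold" and Y :: "('b, 'f::euclidean_space) manifold"
  assumes X: "smooth_atlas X" and Y: "smooth_atlas Y" and f: "smooth_embedding X Y f"
  shows "diffeomorphism_onto X Y (f ` points X) f"
  unfolding diffeomorphism_onto_def
proof (intro conjI ballI)
  have sm: "smooth_map X Y f" and imm: "\<And>c d x. c \<in> atlas X \<Longrightarrow> d \<in> atlas Y \<Longrightarrow> x \<in> fst c \<Longrightarrow>
      f x \<in> fst d \<Longrightarrow> inj (differential c d f x)"
    and emb: "homeomorphic_map (mtop X) (subtopology (mtop Y) (f ` points X)) f"
    using f unfolding smooth_embedding_def smooth_immersion_def embedding_map_def by auto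
  have inj: "inj_on f (points X)"
    by (rule homeomorphic_imp_injective_map[OF emb])
  have cont: "continuous_map (mtop X) (mtop Y) f"
    by (rule smooth_map_continuous[OF sm])
  show "smooth_map X Y f" by (rule sm)
  show "bij_betw f (points X) (f ` points X)"
    using inj by (simp add: bij_betw_def)
  fix y assume "y \<in> f ` points X"
  then obtain x where x: "x \<in> points X" "y = f x" by blast
  obtain U \<phi> where c: "(U, \<phi>) \<in> atlas X" and xU: "x \<in> U"
    using smooth_atlas_cover[OF X x(1)] by blast
  obtain V \<psi> where d: "(V, \<psi>) \<in> atlas Y" and yV: "f x \<in> V"
    using smooth_atlas_cover[OF Y smooth_map_points[OF sm x(1)]] by blast
  let ?D = "\<phi> ` {x \<in> U. f x \<in> V}" and ?f = "\<psi> \<circ> f \<circ> inv_into U \<phi>"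
  have "inj (frechet_derivative ?f (at (\<phi> x)))"
    using imm[OF c d] xU yV by (simp add: differential_def)
  then obtain A B r where A: "open A" "A \<subseteq> ?D" "\<phi> x \<in> A" and B: "open B" "?f ` A \<subseteq> B"
    and r: "r ` B \<subseteq> A" "Cinf_on r B" "\<And>e. e \<in> A \<Longrightarrow> r (?f e) = e"
    using immersion_local_left_inverse[OF smooth_map_rep[OF sm c d]
        smooth_map_rep_open[OF X Y cont c d], of "\<phi> x"] xU yV by blast
  have AU: "A \<subseteq> \<phi> ` U" using A(2) by auto
  define A' where "A' = {x \<in> U. \<phi> x \<in> A}"
  have "openin (subtopology (mtop X) U) {x \<in> U. \<phi> x \<in> A}"
    using openin_preimage[OF chart_continuous_map[OF X c], of U A] chart_openin[OF X c] A(1)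
    by (simp add: openin_open_subtopology)
  then have A': "openin (mtop X) A'"
    using chart_openin[OF X c] unfolding A'_def by (rule openin_trans_full)
  \<comment> \<open>The only topological use of the embedding: it yields \<open>N\<close>, which
    meets the image of \<open>f\<close> exactly in the image of \<open>A'\<close>, where the local
    left inverse is valid.\<close>
  then have "openin (subtopology (mtop Y) (f ` points X)) (f ` A')"
    using homeomorphic_imp_open_map[OF emb] by (simp add: open_map_def)
  then obtain N where N: "openin (mtop Y) N" "f ` A' = N \<inter> f ` points X"
    by (auto simp: openin_subtopology)
  define W where "W = {y \<in> V. \<psi> y \<in> B} \<inter> N"
  have "openin (subtopology (mtop Y) V) {y \<in> V. \<psi> y \<in> B}"
    using openin_preimage[OF chart_continuous_map[OF Y d], of V B] chart_openin[OF Y d] B(1)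
    by (simp add: openin_open_subtopology)
  then have "openin (mtop Y) {y \<in> V. \<psi> y \<in> B}"
    using chart_openin[OF Y d] by (rule openin_trans_full)
  then have W: "openin (mtop Y) W"
    unfolding W_def using N(1) by (rule openin_Int)
  have WV: "W \<subseteq> V" and WB: "\<psi> ` W \<subseteq> B" by (auto simp: W_def)
  define g where "g = inv_into U \<phi> \<circ> r \<circ> \<psi>"
  have xA': "x \<in> A'" using xU A(3) by (simp add: A'_def)
  have gf: "g (f x') = x'" if "x' \<in> A'" for x'
  proof -
    have "x' \<in> U" "\<phi> x' \<in> A" using that by (auto simp: A'_def)
    then show ?thesis
      using r(3)[of "\<phi> x'"] by (simp add: g_def chart_inv_into[OF X c])
  qed
  have "f x \<in> W"
  proof -
    have "?f (\<phi> x) \<in> B" using A(3) B(2) by blast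
    then show ?thesis
      using xA' N(2) yV x(1) by (auto simp: W_def chart_inv_into[OF X c xU])
  qed
  moreover have "g (f x') = x'" if "x' \<in> points X" "f x' \<in> W" for x'
  proof -
    have "f x' \<in> f ` A'" using N(2) that by (auto simp: W_def)
    then obtain x'' where "x'' \<in> A'" "f x' = f x''" by blast
    moreover have "x'' = x'"
      using inj_onD[OF inj, of x'' x'] calculation that openin_subset[OF A'] by auto
    ultimately show ?thesis using gf by simp
  qed
  moreover have "smooth_map (open_submanifold Y W) X g"
  proof (rule smooth_mapI)
    have "continuous_map (subtopology (mtop Y) W) (top_of_set B) \<psi>"
      using continuous_map_from_subtopology_mono[OF chart_continuous_map[OF Y d] WV] WB
      by (auto simp: continuous_map_in_subtopology)
    moreover have "continuous_map (top_of_set B) (top_of_set (\<phi> ` U)) r"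
      using Cinf_on_continuous_on[OF r(2)] r(1) AU by auto
    moreover have "continuous_map (top_of_set (\<phi> ` U)) (mtop X) (inv_into U \<phi>)"
      using chart_inv_continuous_map[OF X c] by (rule continuous_map_into_fulltopology)
    ultimately have "continuous_map (subtopology (mtop Y) W) (mtop X) (inv_into U \<phi> \<circ> (r \<circ> \<psi>))"
      by (blast intro: continuous_map_compose)
    then show "continuous_map (mtop (open_submanifold Y W)) (mtop X) g"
      by (simp add: g_def o_assoc)
    then have gc: "continuous_map (subtopology (mtop Y) W) (mtop X) g" by simp
    fix V' \<psi>' U2 \<phi>2 y'
    assume "(V', \<psi>') \<in> atlas (open_submanifold Y W)" and c2: "(U2, \<phi>2) \<in> atlas X"
      and y': "y' \<in> V'" "g y' \<in> U2"
    then obtain V2 where d2: "(V2, \<psi>') \<in> atlas Y" and V': "V' = V2 \<inter> W" by auto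
    let ?T = "\<psi>' ` {y \<in> V2 \<inter> W. g y \<in> U2}"
    have "open ?T"
      using smooth_map_rep_open[OF smooth_atlas_open_submanifold[OF Y W] X _ _ c2, of g "V2 \<inter> W" \<psi>'] gc d2
      by auto
    moreover have "\<psi>' y' \<in> ?T" using y' V' by auto
    \<comment> \<open>In arbitrary charts \<open>g\<close> is a transition map into
      \<open>\<psi>\<close>, followed by \<open>r\<close>, followed by a transition map out of
      \<open>\<phi>\<close>.\<close>
    moreover have "Cinf_on (\<phi>2 \<circ> g \<circ> inv_into V' \<psi>') ?T"
    proof -
      have "Cinf_on (\<psi> \<circ> inv_into V2 \<psi>') ?T"
        by (rule Cinf_on_subset[OF smooth_atlas_transition[OF Y d2 d]]) (use WV in auto)
      then have "Cinf_on (\<lambda>e. r ((\<psi> \<circ> inv_into V2 \<psi>') e)) ?T"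
        by (rule Cinf_on_compose[OF r(2) _ \<open>open ?T\<close> B(1)])
           (use WB in \<open>auto simp: chart_inv_into[OF Y d2]\<close>)
      then have "Cinf_on (\<lambda>e. (\<phi>2 \<circ> inv_into U \<phi>) (r ((\<psi> \<circ> inv_into V2 \<psi>') e))) ?T"
      proof (rule Cinf_on_compose[OF smooth_atlas_transition[OF X c c2] _ \<open>open ?T\<close>])
        show "open (\<phi> ` (U \<inter> U2))"
          using chart_openin[OF X c] chart_openin[OF X c2] by (intro chart_open_image[OF X c]) auto
        show "(\<lambda>e. r ((\<psi> \<circ> inv_into V2 \<psi>') e)) ` ?T \<subseteq> \<phi> ` (U \<inter> U2)"
        proof clarsimp
          fix y assume y: "y \<in> V2" "y \<in> W" "g y \<in> U2"
          have "r (\<psi> y) \<in> \<phi> ` U" using y WB r(1) AU by blast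
          then have "\<phi> (g y) = r (\<psi> y)" "g y \<in> U"
            by (auto simp: g_def f_inv_into_f inv_into_into)
          then show "r (\<psi> (inv_into V2 \<psi>' (\<psi>' y))) \<in> \<phi> ` (U \<inter> U2)"
            using y by (simp add: chart_inv_into[OF Y d2]) (metis IntI imageI)
        qed
      qed
      then show ?thesis
      proof (rule Cinf_on_cong[OF _ \<open>open ?T\<close>])
        fix e assume "e \<in> ?T"
        then have "inv_into (V2 \<inter> W) \<psi>' e = inv_into V2 \<psi>' e"
          by (intro inv_into_Int chart_inj_on[OF Y d2]) auto
        then show "(\<phi>2 \<circ> inv_into U \<phi>) (r ((\<psi> \<circ> inv_into V2 \<psi>') e)) = (\<phi>2 \<circ> g \<circ> inv_into V' \<psi>') e"
          by (simp add: g_def V')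
      qed
    qed
    ultimately show "\<exists>T. open T \<and> \<psi>' y' \<in> T \<and> Cinf_on (\<phi>2 \<circ> g \<circ> inv_into V' \<psi>') T"
      by blast
  qed
  ultimately show "\<exists>W g. openin (mtop Y) W \<and> y \<in> W \<and> smooth_map (open_submanifold Y W) X g \<and>
      (\<forall>x\<in>points X. f x \<in> W \<longrightarrow> g (f x) = x)"
    using W x(2) by blast
qed

section \<open>Euclidean space as a manifold\<close>

lemma euclidean_manifold_simps [simp]:
  "mtop euclidean_manifold = euclidean" "atlas euclidean_manifold = {(UNIV, id)}"
  by (simp_all add: euclidean_manifold_def)

lemma inv_into_UNIV_id [simp]: "inv_into UNIV id = id"
  by (simp add: inv_id)

lemma smooth_manifold_euclidean: "smooth_manifold (euclidean_manifold :: ('e::euclidean_space, 'e) manifold)"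
proof -
  obtain B :: "'e set set" where B: "countable B" "\<And>C. C \<in> B \<Longrightarrow> open C"
      "\<And>S. open S \<Longrightarrow> \<exists>U. U \<subseteq> B \<and> S = \<Union>U"
    using univ_second_countable by metis
  have "second_countable (euclidean :: 'e topology)"
    unfolding second_countable_def
  proof (intro exI[of _ B] conjI ballI allI impI)
    fix U and x :: 'e
    assume "openin euclidean U \<and> x \<in> U"
    then obtain K where "K \<subseteq> B" "U = \<Union>K" "x \<in> U"
      using B(3)[of U] by auto
    then show "\<exists>V\<in>B. x \<in> V \<and> V \<subseteq> U" by blast
  qed (use B in auto)
  moreover have "Cinf_on (id :: 'e \<Rightarrow> 'e) UNIV"
    using Cinf_on_id by (simp add: id_def)
  ultimately show ?thesis
    unfolding smooth_manifold_def by (simp add: Hausdorff_space_euclidean id_def[symmetric])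
qed

lemma smooth_map_id:
  assumes X: "smooth_atlas X"
  shows "smooth_map X X id"
proof (rule smooth_mapI)
  fix U \<phi> V \<psi> x
  assume c: "(U, \<phi>) \<in> atlas X" "(V, \<psi>) \<in> atlas X" and x: "x \<in> U" "id x \<in> V"
  have "open (\<phi> ` (U \<inter> V))"
    using chart_openin[OF X c(1)] chart_openin[OF X c(2)] by (intro chart_open_image[OF X c(1)]) auto
  then show "\<exists>T. open T \<and> \<phi> x \<in> T \<and> Cinf_on (\<psi> \<circ> id \<circ> inv_into U \<phi>) T"
    using smooth_atlas_transition[OF X c] x by (intro exI[of _ "\<phi> ` (U \<inter> V)"]) auto
qed simp

lemma smooth_map_euclidean_iff:
  "smooth_map (euclidean_manifold :: ('e::euclidean_space, 'e) manifold)
     (euclidean_manifold :: ('f::euclidean_space, 'f) manifold) f \<longleftrightarrow> Cinf_on f UNIV"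
  unfolding smooth_map_def by (auto dest: Cinf_on_continuous_on)

section \<open>Products of manifolds\<close>

lemma prod_manifold_simps [simp]:
  "mtop (prod_manifold X Y) = prod_topology (mtop X) (mtop Y)"
  "atlas (prod_manifold X Y) =
     {(U \<times> V, map_prod \<phi> \<psi>) | U \<phi> V \<psi>. (U, \<phi>) \<in> atlas X \<and> (V, \<psi>) \<in> atlas Y}"
  by (simp_all add: prod_manifold_def)

lemma second_countable_prod_topology:
  assumes "second_countable X" "second_countable Y"
  shows "second_countable (prod_topology X Y)"
proof -
  obtain A where A: "countable A" "\<And>V. V \<in> A \<Longrightarrow> openin X V"
      "\<And>U x. openin X U \<Longrightarrow> x \<in> U \<Longrightarrow> \<exists>V\<in>A. x \<in> V \<and> V \<subseteq> U"
    using assms(1) unfolding second_countable_def by metis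
  obtain B where B: "countable B" "\<And>V. V \<in> B \<Longrightarrow> openin Y V"
      "\<And>U x. openin Y U \<Longrightarrow> x \<in> U \<Longrightarrow> \<exists>V\<in>B. x \<in> V \<and> V \<subseteq> U"
    using assms(2) unfolding second_countable_def by metis
  show ?thesis
    unfolding second_countable_def
  proof (intro exI[of _ "(\<lambda>(U, V). U \<times> V) ` (A \<times> B)"] conjI ballI allI impI)
    show "countable ((\<lambda>(U, V). U \<times> V) ` (A \<times> B))"
      using A(1) B(1) by blast
    show "openin (prod_topology X Y) W" if "W \<in> (\<lambda>(U, V). U \<times> V) ` (A \<times> B)" for W
      using that A(2) B(2) by (auto simp: openin_prod_Times_iff)
    fix W z
    assume W: "openin (prod_topology X Y) W \<and> z \<in> W"
    obtain x y where z: "z = (x, y)" by (cases z)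
    obtain U V where UV: "openin X U" "openin Y V" "x \<in> U" "y \<in> V" "U \<times> V \<subseteq> W"
      using W unfolding z openin_prod_topology_alt by blast
    obtain U' V' where "U' \<in> A" "x \<in> U'" "U' \<subseteq> U" "V' \<in> B" "y \<in> V'" "V' \<subseteq> V"
      using A(3)[OF UV(1,3)] B(3)[OF UV(2,4)] by blast
    then show "\<exists>W'\<in>(\<lambda>(U, V). U \<times> V) ` (A \<times> B). z \<in> W' \<and> W' \<subseteq> W"
      using UV(5) z by (intro bexI[of _ "U' \<times> V'"]) auto
  qed
qed

lemma inv_into_map_prod:
  assumes "inj_on f U" "inj_on g V" "x \<in> f ` U" "y \<in> g ` V"
  shows "inv_into (U \<times> V) (map_prod f g) (x, y) = (inv_into U f x, inv_into V g y)"
proof -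
  obtain a b where "a \<in> U" "x = f a" "b \<in> V" "y = g b"
    using assms(3,4) by blast
  moreover have "inj_on (map_prod f g) (U \<times> V)"
    using assms(1,2) by (rule map_prod_inj_on)
  ultimately show ?thesis
    using inv_into_f_f[of "map_prod f g" "U \<times> V" "(a, b)"] assms(1,2) by simp
qed

lemma homeomorphic_map_map_prod:
  assumes "homeomorphic_map X X' f" "homeomorphic_map Y Y' g"
  shows "homeomorphic_map (prod_topology X Y) (prod_topology X' Y') (map_prod f g)"
proof -
  obtain f' g' where "homeomorphic_maps X X' f f'" "homeomorphic_maps Y Y' g g'"
    using assms by (auto simp: homeomorphic_map_maps)
  then have "homeomorphic_maps (prod_topology X Y) (prod_topology X' Y')
      (\<lambda>(x, y). (f x, g y)) (\<lambda>(x, y). (f' x, g' y))"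
    by (simp add: homeomorphic_maps_prod)
  then show ?thesis
    unfolding homeomorphic_map_maps map_prod_def by blast
qed

lemma Cinf_on_map_prod:
  fixes f :: "'a::euclidean_space \<Rightarrow> 'c::euclidean_space" and g :: "'b::euclidean_space \<Rightarrow> 'd::euclidean_space"
  assumes "open S" "open T" "Cinf_on f S" "Cinf_on g T"
  shows "Cinf_on (map_prod f g) (S \<times> T)"
proof -
  have op: "open (S \<times> T)" using assms by (simp add: open_Times)
  have "Cinf_on (\<lambda>x. f (fst x)) (S \<times> T)"
    by (rule Cinf_on_compose[OF assms(3) Cinf_on_fst[OF op Cinf_on_id] op assms(1)]) auto
  moreover have "Cinf_on (\<lambda>x. g (snd x)) (S \<times> T)"
    by (rule Cinf_on_compose[OF assms(4) Cinf_on_snd[OF op Cinf_on_id] op assms(2)]) auto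
  ultimately have "Cinf_on (\<lambda>x. (f (fst x), g (snd x))) (S \<times> T)"
    by (rule Cinf_on_Pair[OF op])
  then show ?thesis
    by (simp add: map_prod_def split_def)
qed

lemma smooth_atlas_prod:
  assumes X: "smooth_atlas X" and Y: "smooth_atlas Y"
  shows "smooth_atlas (prod_manifold X Y)"
  unfolding smooth_atlas_def
proof (intro conjI)
  have "points X = \<Union> (fst ` atlas X)" "points Y = \<Union> (fst ` atlas Y)"
    using X Y by (simp_all add: smooth_atlas_def)
  moreover have "fst ` atlas (prod_manifold X Y) = (\<lambda>(c, d). fst c \<times> fst d) ` (atlas X \<times> atlas Y)"
  proof -
    have "atlas (prod_manifold X Y) =
        (\<lambda>(c, d). (fst c \<times> fst d, map_prod (snd c) (snd d))) ` (atlas X \<times> atlas Y)"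
      by (auto simp: image_def Bex_def)
    then show ?thesis
      by (simp add: image_image split_def)
  qed
  ultimately show "\<Union> (fst ` atlas (prod_manifold X Y)) = points (prod_manifold X Y)"
    by auto
  have "openin (prod_topology (mtop X) (mtop Y)) (U \<times> V) \<and> open (map_prod \<phi> \<psi> ` (U \<times> V)) \<and>
      homeomorphic_map (subtopology (prod_topology (mtop X) (mtop Y)) (U \<times> V))
        (top_of_set (map_prod \<phi> \<psi> ` (U \<times> V))) (map_prod \<phi> \<psi>)"
    if c: "(U, \<phi>) \<in> atlas X" and d: "(V, \<psi>) \<in> atlas Y" for U \<phi> V \<psi>
  proof (intro conjI)
    show "openin (prod_topology (mtop X) (mtop Y)) (U \<times> V)"
      using chart_openin[OF X c] chart_openin[OF Y d] by (simp add: openin_prod_Times_iff)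
    show "open (map_prod \<phi> \<psi> ` (U \<times> V))"
      using chart_open_range[OF X c] chart_open_range[OF Y d] by (simp add: map_prod_image open_Times)
    show "homeomorphic_map (subtopology (prod_topology (mtop X) (mtop Y)) (U \<times> V))
        (top_of_set (map_prod \<phi> \<psi> ` (U \<times> V))) (map_prod \<phi> \<psi>)"
      using homeomorphic_map_map_prod[OF chart_homeomorphic[OF X c] chart_homeomorphic[OF Y d]]
      by (simp add: subtopology_Times map_prod_image)
  qed
  then show "\<forall>(U, \<phi>)\<in>atlas (prod_manifold X Y). openin (mtop (prod_manifold X Y)) U \<and>
      open (\<phi> ` U) \<and>
      homeomorphic_map (subtopology (mtop (prod_manifold X Y)) U) (top_of_set (\<phi> ` U)) \<phi>"
    by auto
  have "Cinf_on (map_prod \<phi>' \<psi>' \<circ> inv_into (U \<times> V) (map_prod \<phi> \<psi>)) (map_prod \<phi> \<psi> ` (U \<times> V \<inter> U' \<times> V'))"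
    if c: "(U, \<phi>) \<in> atlas X" "(U', \<phi>') \<in> atlas X" and d: "(V, \<psi>) \<in> atlas Y" "(V', \<psi>') \<in> atlas Y"
    for U \<phi> V \<psi> U' \<phi>' V' \<psi>'
  proof -
    have op: "open (\<phi> ` (U \<inter> U'))" "open (\<psi> ` (V \<inter> V'))"
      using chart_openin[OF X c(1)] chart_openin[OF X c(2)] chart_openin[OF Y d(1)] chart_openin[OF Y d(2)]
      by (auto intro!: chart_open_image[OF X c(1)] chart_open_image[OF Y d(1)])
    have "Cinf_on (map_prod (\<phi>' \<circ> inv_into U \<phi>) (\<psi>' \<circ> inv_into V \<psi>)) (\<phi> ` (U \<inter> U') \<times> \<psi> ` (V \<inter> V'))"
      by (rule Cinf_on_map_prod[OF op smooth_atlas_transition[OF X c] smooth_atlas_transition[OF Y d]])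
    then have "Cinf_on (map_prod \<phi>' \<psi>' \<circ> inv_into (U \<times> V) (map_prod \<phi> \<psi>)) (\<phi> ` (U \<inter> U') \<times> \<psi> ` (V \<inter> V'))"
      by (rule Cinf_on_cong)
         (auto simp: op open_Times inv_into_map_prod[OF chart_inj_on[OF X c(1)] chart_inj_on[OF Y d(1)]])
    then show ?thesis
      by (simp add: Times_Int_Times map_prod_image)
  qed
  then show "\<forall>(U, \<phi>)\<in>atlas (prod_manifold X Y). \<forall>(V, \<psi>)\<in>atlas (prod_manifold X Y).
      Cinf_on (\<psi> \<circ> inv_into U \<phi>) (\<phi> ` (U \<inter> V))"
    by fastforce
qed

lemma smooth_manifold_prod:
  "smooth_manifold X \<Longrightarrow> smooth_manifold Y \<Longrightarrow> smooth_manifold (prod_manifold X Y)"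
  by (simp add: smooth_manifold_iff_smooth_atlas smooth_atlas_prod second_countable_prod_topology
      Hausdorff_space_prod_topology)

lemma smooth_map_map_prod:
  assumes X: "smooth_atlas X" and Y: "smooth_atlas Y" and X': "smooth_atlas X'" and Y': "smooth_atlas Y'"
    and f: "smooth_map X X' f" and g: "smooth_map Y Y' g"
  shows "smooth_map (prod_manifold X Y) (prod_manifold X' Y') (map_prod f g)"
proof (rule smooth_mapI)
  show "continuous_map (mtop (prod_manifold X Y)) (mtop (prod_manifold X' Y')) (map_prod f g)"
    using smooth_map_continuous[OF f] smooth_map_continuous[OF g]
    by (simp add: map_prod_def continuous_map_prod_top)
  fix c \<phi>\<psi> d \<phi>\<psi>' x
  assume "(c, \<phi>\<psi>) \<in> atlas (prod_manifold X Y)" "(d, \<phi>\<psi>') \<in> atlas (prod_manifold X' Y')"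
    and x: "x \<in> c" "map_prod f g x \<in> d"
  then obtain U \<phi> V \<psi> U' \<phi>' V' \<psi>' where
    c: "c = U \<times> V" "\<phi>\<psi> = map_prod \<phi> \<psi>" "(U, \<phi>) \<in> atlas X" "(V, \<psi>) \<in> atlas Y" and
    d: "d = U' \<times> V'" "\<phi>\<psi>' = map_prod \<phi>' \<psi>'" "(U', \<phi>') \<in> atlas X'" "(V', \<psi>') \<in> atlas Y'"
    by auto
  let ?S = "\<phi> ` {x \<in> U. f x \<in> U'}" and ?T = "\<psi> ` {y \<in> V. g y \<in> V'}"
  have op: "open ?S" "open ?T"
    by (rule smooth_map_rep_open[OF X X' smooth_map_continuous[OF f] c(3) d(3)])
       (rule smooth_map_rep_open[OF Y Y' smooth_map_continuous[OF g] c(4) d(4)])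
  have "Cinf_on (map_prod (\<phi>' \<circ> f \<circ> inv_into U \<phi>) (\<psi>' \<circ> g \<circ> inv_into V \<psi>)) (?S \<times> ?T)"
    by (rule Cinf_on_map_prod[OF op smooth_map_rep[OF f c(3) d(3)] smooth_map_rep[OF g c(4) d(4)]])
  then have "Cinf_on (\<phi>\<psi>' \<circ> map_prod f g \<circ> inv_into c \<phi>\<psi>) (?S \<times> ?T)"
    unfolding c(1,2) d(1,2)
    by (rule Cinf_on_cong)
       (auto simp: op open_Times inv_into_map_prod[OF chart_inj_on[OF X c(3)] chart_inj_on[OF Y c(4)]])
  then show "\<exists>T. open T \<and> \<phi>\<psi> x \<in> T \<and> Cinf_on (\<phi>\<psi>' \<circ> map_prod f g \<circ> inv_into c \<phi>\<psi>) T"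
    using op x unfolding c(1,2) d(1,2) by (intro exI[of _ "?S \<times> ?T"]) (auto simp: open_Times)
qed

section \<open>Quotients by properly discontinuous actions\<close>

lemma topspace_quotient_topology [simp]: "topspace (quotient_topology X q) = q ` topspace X"
proof -
  have "{x \<in> topspace X. q x \<in> q ` topspace X} = topspace X"
    by auto
  then have "openin (quotient_topology X q) (q ` topspace X)"
    by (simp add: openin_quotient_topology)
  moreover have "openin (quotient_topology X q) (topspace (quotient_topology X q))"
    by simp
  ultimately show ?thesis
    by (meson openin_quotient_topology openin_subset subset_antisym)
qed

lemma quotient_map_quotient_topology: "quotient_map X (quotient_topology X q) q"
  by (simp add: quotient_map_def openin_quotient_topology)

text \<open>Common frame for the circle and the twisted product. \<open>G\<close> is just a set of
  maps: what a group would contribute is contained in \<open>orbit\<close>, whose left side is an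
  equality and so makes reachability an equivalence relation. \<open>slice\<close> provides the
  charts of the quotient, \<open>separated\<close> its Hausdorff property.\<close>

locale orbit_quotient =
  fixes X :: "('a, 'e::euclidean_space) manifold" and q :: "'a \<Rightarrow> 'b" and G :: "('a \<Rightarrow> 'a) set"
  assumes manifold: "smooth_manifold X"
    and smooth: "\<And>g. g \<in> G \<Longrightarrow> smooth_map X X g"
    and orbit: "\<And>x y. x \<in> points X \<Longrightarrow> y \<in> points X \<Longrightarrow> q x = q y \<longleftrightarrow> (\<exists>g\<in>G. y = g x)"
    and slice: "\<And>x. x \<in> points X \<Longrightarrow> \<exists>V. openin (mtop X) V \<and> x \<in> V \<and> inj_on q V"
    and separated: "\<And>x y. x \<in> points X \<Longrightarrow> y \<in> points X \<Longrightarrow> q x \<noteq> q y \<Longrightarrow>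
      \<exists>V W. openin (mtop X) V \<and> openin (mtop X) W \<and> x \<in> V \<and> y \<in> W \<and> q ` V \<inter> q ` W = {}"
begin

lemma smooth_atlas_X: "smooth_atlas X"
  using manifold by (simp add: smooth_manifold_iff_smooth_atlas)

lemma quotient_mtop: "mtop (quotient_manifold X q) = quotient_topology (mtop X) q"
  and quotient_atlas: "atlas (quotient_manifold X q) = {(q ` V, \<phi> \<circ> inv_into V q) | U \<phi> V.
      (U, \<phi>) \<in> atlas X \<and> V \<subseteq> U \<and> openin (mtop X) V \<and> inj_on q V}"
  by (simp_all add: quotient_manifold_def)

lemma continuous_map_q: "continuous_map (mtop X) (mtop (quotient_manifold X q)) q"
  unfolding quotient_mtop by (rule quotient_imp_continuous_map[OF quotient_map_quotient_topology])

text \<open>The saturation of an open \<open>V\<close> is the union of its preimages under the maps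
  of \<open>G\<close>, each of which is open by continuity.\<close>

lemma open_map_q: "open_map (mtop X) (mtop (quotient_manifold X q)) q"
  unfolding open_map_def
proof (intro allI impI)
  fix V assume V: "openin (mtop X) V"
  have "{x \<in> points X. q x \<in> q ` V} = (\<Union>g\<in>G. {x \<in> points X. g x \<in> V})"
    using openin_subset[OF V] orbit by (auto simp: image_iff) (metis orbit smooth smooth_map_points subsetD)+
  moreover have "openin (mtop X) (\<Union>g\<in>G. {x \<in> points X. g x \<in> V})"
    using openin_continuous_map_preimage[OF smooth_map_continuous[OF smooth] V] by blast
  ultimately show "openin (mtop (quotient_manifold X q)) (q ` V)"
    unfolding quotient_mtop openin_quotient_topology using openin_subset[OF V] by auto
qed

lemma quotient_chart_inv:
  assumes c: "(U, \<phi>) \<in> atlas X" "V \<subseteq> U" "inj_on q V" and x: "x \<in> V"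
  shows "inv_into (q ` V) (\<phi> \<circ> inv_into V q) (\<phi> x) = q x"
proof -
  have "inj_on (\<phi> \<circ> inv_into V q) (q ` V)"
    using c by (intro comp_inj_on inj_on_inv_into inj_on_subset[OF chart_inj_on[OF smooth_atlas_X c(1)]])
       (auto simp: inv_into_into)
  moreover have "(\<phi> \<circ> inv_into V q) (q x) = \<phi> x"
    using c x by simp
  ultimately show ?thesis
    using x by (metis imageI inv_into_f_f)
qed

lemma quotient_chart_range:
  assumes "inj_on q V" "W \<subseteq> V"
  shows "(\<phi> \<circ> inv_into V q) ` (q ` W) = \<phi> ` W"
proof -
  have "inv_into V q ` (q ` W) = W"
    using assms by (simp add: inv_into_image_cancel)
  then show ?thesis by (metis image_comp)
qed

text \<open>Two slices that meet in the quotient need not meet in \<open>X\<close>; they are related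
  by some \<open>g\<close> in \<open>G\<close>, and near the point in question the map in quotient
  charts is \<open>g\<close> after \<open>h\<close> in charts of \<open>X\<close>. Allowing a
  general \<open>h\<close> covers descended maps as well as, for the identity, the transition
  maps.\<close>

lemma quotient_chart_rep:
  assumes c: "(U, \<phi>) \<in> atlas X" "V \<subseteq> U" "openin (mtop X) V" "inj_on q V"
    and d: "(U', \<psi>) \<in> atlas X" "V' \<subseteq> U'" "openin (mtop X) V'" "inj_on q V'"
    and h: "smooth_map X X h" and k: "\<And>x. x \<in> points X \<Longrightarrow> k (q x) = q (h x)"
  shows "Cinf_on ((\<psi> \<circ> inv_into V' q) \<circ> k \<circ> inv_into (q ` V) (\<phi> \<circ> inv_into V q))
    ((\<phi> \<circ> inv_into V q) ` {z \<in> q ` V. k z \<in> q ` V'})"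
proof (rule Cinf_on_local)
  have V: "V \<subseteq> points X" and V': "V' \<subseteq> points X"
    using openin_subset c(3) d(3) by auto
  fix e assume "e \<in> (\<phi> \<circ> inv_into V q) ` {z \<in> q ` V. k z \<in> q ` V'}"
  then obtain x where x: "x \<in> V" "e = \<phi> x" "k (q x) \<in> q ` V'"
    using c(4) by auto
  then obtain y where y: "y \<in> V'" "q (h x) = q y"
    using k V by auto
  \<comment> \<open>This \<open>g\<close> is chosen for one point but serves on the whole
    neighbourhood \<open>?T\<close>: wherever \<open>g (h x')\<close> lies in \<open>V'\<close>,
    injectivity of \<open>q\<close> on \<open>V'\<close> makes it the representative that the chart
    selects.\<close>
  then obtain g where g: "g \<in> G" "y = g (h x)"
    using orbit smooth_map_points[OF h] x(1) V V' by blast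
  have gh: "smooth_map X X (g \<circ> h)"
    by (rule smooth_map_compose[OF smooth_atlas_X smooth_atlas_X smooth_atlas_X h smooth[OF g(1)]])
  let ?T = "\<phi> ` {x \<in> V. (g \<circ> h) x \<in> V'}"
  have op: "open ?T"
    using c(2) by (intro chart_open_image[OF smooth_atlas_X c(1)] openin_preimage[OF smooth_map_continuous[OF gh]] c(3) d(3)) auto
  have "Cinf_on (\<psi> \<circ> (g \<circ> h) \<circ> inv_into U \<phi>) ?T"
    by (rule Cinf_on_subset[OF smooth_map_rep[OF gh c(1) d(1)]]) (use c(2) d(2) in auto)
  then have "Cinf_on ((\<psi> \<circ> inv_into V' q) \<circ> k \<circ> inv_into (q ` V) (\<phi> \<circ> inv_into V q)) ?T"
  proof (rule Cinf_on_cong[OF _ op])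
    fix e' assume "e' \<in> ?T"
    then obtain x' where x': "x' \<in> V" "g (h x') \<in> V'" "e' = \<phi> x'" by auto
    have hx': "h x' \<in> points X"
      using smooth_map_points[OF h] x'(1) V by blast
    have "q (h x') = q (g (h x'))"
      using orbit[OF hx', of "g (h x')"] g(1) x'(2) V' by blast
    then have "inv_into V' q (k (q x')) = g (h x')"
      using k x'(1,2) V d(4) by (auto simp: subset_iff)
    then show "(\<psi> \<circ> (g \<circ> h) \<circ> inv_into U \<phi>) e' =
        ((\<psi> \<circ> inv_into V' q) \<circ> k \<circ> inv_into (q ` V) (\<phi> \<circ> inv_into V q)) e'"
      using x' c(2) by (simp add: quotient_chart_inv[OF c(1,2,4)] chart_inv_into[OF smooth_atlas_X c(1)] subset_iff)
  qed
  moreover have "e \<in> ?T"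
    using x y g by auto
  ultimately show "\<exists>T. open T \<and> e \<in> T \<and>
      Cinf_on ((\<psi> \<circ> inv_into V' q) \<circ> k \<circ> inv_into (q ` V) (\<phi> \<circ> inv_into V q)) T"
    using op by blast
qed

lemma smooth_map_quotient:
  assumes h: "smooth_map X X h" and k: "\<And>x. x \<in> points X \<Longrightarrow> k (q x) = q (h x)"
  shows "smooth_map (quotient_manifold X q) (quotient_manifold X q) k"
proof -
  have "continuous_map (mtop X) (mtop (quotient_manifold X q)) (q \<circ> h)"
    by (rule continuous_map_compose[OF smooth_map_continuous[OF h] continuous_map_q])
  then have "continuous_map (mtop X) (mtop (quotient_manifold X q)) (k \<circ> q)"
    by (rule continuous_map_eq) (simp add: k)
  then have "continuous_map (mtop (quotient_manifold X q)) (mtop (quotient_manifold X q)) k"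
    unfolding quotient_mtop by (rule continuous_compose_quotient_map[OF quotient_map_quotient_topology])
  moreover have "Cinf_on (\<psi> \<circ> k \<circ> inv_into U \<phi>) (\<phi> ` {z \<in> U. k z \<in> V})"
    if c: "(U, \<phi>) \<in> atlas (quotient_manifold X q)" and d: "(V, \<psi>) \<in> atlas (quotient_manifold X q)" for U \<phi> V \<psi>
  proof -
    obtain U1 \<phi>1 V1 where 1: "U = q ` V1" "\<phi> = \<phi>1 \<circ> inv_into V1 q"
      "(U1, \<phi>1) \<in> atlas X" "V1 \<subseteq> U1" "openin (mtop X) V1" "inj_on q V1"
      using c unfolding quotient_atlas by blast
    obtain U2 \<phi>2 V2 where 2: "V = q ` V2" "\<psi> = \<phi>2 \<circ> inv_into V2 q"
      "(U2, \<phi>2) \<in> atlas X" "V2 \<subseteq> U2" "openin (mtop X) V2" "inj_on q V2"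
      using d unfolding quotient_atlas by blast
    show ?thesis
      unfolding 1(1,2) 2(1,2) by (rule quotient_chart_rep[OF 1(3-) 2(3-) h k])
  qed
  ultimately show ?thesis
    unfolding smooth_map_def by fast
qed

lemma quotient_smooth_manifold: "smooth_manifold (quotient_manifold X q)"
  unfolding smooth_manifold_def
proof (intro conjI)
  have pts: "points (quotient_manifold X q) = q ` points X"
    by (simp add: quotient_mtop)
  show "Hausdorff_space (mtop (quotient_manifold X q))"
    unfolding Hausdorff_space_def disjnt_def
  proof (intro allI impI)
    fix a b assume "a \<in> points (quotient_manifold X q) \<and> b \<in> points (quotient_manifold X q) \<and> a \<noteq> b"
    then obtain x y where xy: "x \<in> points X" "y \<in> points X" "a = q x" "b = q y" "q x \<noteq> q y"
      unfolding pts by blast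
    then obtain V W where "openin (mtop X) V" "openin (mtop X) W" "x \<in> V" "y \<in> W" "q ` V \<inter> q ` W = {}"
      using separated[OF xy(1,2,5)] by blast
    then show "\<exists>U V. openin (mtop (quotient_manifold X q)) U \<and> openin (mtop (quotient_manifold X q)) V \<and> a \<in> U \<and> b \<in> V \<and> U \<inter> V = {}"
      using open_map_q xy(3,4) unfolding open_map_def by blast
  qed
  show "second_countable (mtop (quotient_manifold X q))"
    using second_countable_open_map_image[OF continuous_map_q open_map_q] manifold pts
    by (simp add: smooth_manifold_def)
  show "\<Union> (fst ` atlas (quotient_manifold X q)) = points (quotient_manifold X q)"
  proof
    show "\<Union> (fst ` atlas (quotient_manifold X q)) \<subseteq> points (quotient_manifold X q)"
      unfolding quotient_atlas pts using openin_subset[of "mtop X"] by fastforce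
    show "points (quotient_manifold X q) \<subseteq> \<Union> (fst ` atlas (quotient_manifold X q))"
    proof
      fix z assume "z \<in> points (quotient_manifold X q)"
      then obtain x where x: "x \<in> points X" "z = q x" unfolding pts by blast
      obtain U \<phi> where c: "(U, \<phi>) \<in> atlas X" "x \<in> U"
        using smooth_atlas_cover[OF smooth_atlas_X x(1)] by blast
      obtain V where V: "openin (mtop X) V" "x \<in> V" "inj_on q V"
        using slice[OF x(1)] by blast
      have "(q ` (U \<inter> V), \<phi> \<circ> inv_into (U \<inter> V) q) \<in> atlas (quotient_manifold X q)"
        unfolding quotient_atlas
        by (intro CollectI exI[of _ U] exI[of _ \<phi>] exI[of _ "U \<inter> V"]
            conjI refl c(1) Int_lower1 openin_Int
            chart_openin[OF smooth_atlas_X c(1)] V(1)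
            inj_on_subset[OF V(3)] Int_lower2)
      moreover have "z \<in> q ` (U \<inter> V)" using x c V by blast
      ultimately show "z \<in> \<Union> (fst ` atlas (quotient_manifold X q))" by force
    qed
  qed
  have "openin (mtop (quotient_manifold X q)) (q ` V) \<and> open ((\<phi> \<circ> inv_into V q) ` (q ` V)) \<and>
      homeomorphic_map (subtopology (mtop (quotient_manifold X q)) (q ` V)) (top_of_set ((\<phi> \<circ> inv_into V q) ` (q ` V)))
        (\<phi> \<circ> inv_into V q)"
    if c: "(U, \<phi>) \<in> atlas X" "V \<subseteq> U" "openin (mtop X) V" "inj_on q V" for U \<phi> V
  proof -
    have oq: "openin (mtop (quotient_manifold X q)) (q ` V)"
      using open_map_q c(3) unfolding open_map_def by blast
    have Vp: "V \<subseteq> points X" by (rule openin_subset[OF c(3)])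
    have r: "(\<phi> \<circ> inv_into V q) ` (q ` V) = \<phi> ` V"
      by (rule quotient_chart_range[OF c(4)]) simp
    have "homeomorphic_map (subtopology (mtop X) V) (subtopology (mtop (quotient_manifold X q)) (q ` V)) q"
    proof (rule bijective_open_imp_homeomorphic_map)
      show "continuous_map (subtopology (mtop X) V) (subtopology (mtop (quotient_manifold X q)) (q ` V)) q"
        using continuous_map_q by (auto simp: continuous_map_in_subtopology intro: continuous_map_from_subtopology)
      show "open_map (subtopology (mtop X) V) (subtopology (mtop (quotient_manifold X q)) (q ` V)) q"
        unfolding open_map_def
      proof (intro allI impI)
        fix W assume "openin (subtopology (mtop X) V) W"
        then have "openin (mtop X) W" "W \<subseteq> V"
          using c(3) by (auto simp: openin_open_subtopology)
        then show "openin (subtopology (mtop (quotient_manifold X q)) (q ` V)) (q ` W)"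
          using open_map_q oq by (auto simp: open_map_def openin_open_subtopology)
      qed
      show "q ` topspace (subtopology (mtop X) V) = topspace (subtopology (mtop (quotient_manifold X q)) (q ` V))"
        using Vp by (auto simp: pts)
      show "inj_on q (topspace (subtopology (mtop X) V))"
        using c(4) Vp by (simp add: inf_absorb2)
    qed
    then obtain r where r1: "homeomorphic_maps (subtopology (mtop X) V) (subtopology (mtop (quotient_manifold X q)) (q ` V)) q r"
      by (auto simp: homeomorphic_map_maps)
    then have "homeomorphic_map (subtopology (mtop (quotient_manifold X q)) (q ` V)) (subtopology (mtop X) V) r"
      unfolding homeomorphic_map_maps using homeomorphic_maps_sym by blast
    moreover have "r z = inv_into V q z" if "z \<in> topspace (subtopology (mtop (quotient_manifold X q)) (q ` V))" for z
    proof -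
      have "z \<in> q ` V" using that by simp
      then obtain x where "x \<in> V" "z = q x" by blast
      then show ?thesis
        using r1 c(4) Vp by (auto simp: homeomorphic_maps_def)
    qed
    ultimately have h1: "homeomorphic_map (subtopology (mtop (quotient_manifold X q)) (q ` V)) (subtopology (mtop X) V) (inv_into V q)"
      using homeomorphic_map_eq by blast
    have "homeomorphic_map (subtopology (subtopology (mtop X) U) V)
        (subtopology (top_of_set (\<phi> ` U)) (\<phi> ` V)) \<phi>"
      using c(2) chart_subset[OF smooth_atlas_X c(1)]
      by (intro homeomorphic_map_subtopologies[OF chart_homeomorphic[OF smooth_atlas_X c(1)]]) auto
    moreover have "U \<inter> V = V" "\<phi> ` U \<inter> \<phi> ` V = \<phi> ` V" using c(2) by auto
    ultimately have h2: "homeomorphic_map (subtopology (mtop X) V) (top_of_set (\<phi> ` V)) \<phi>"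
      by (simp add: subtopology_subtopology)
    show ?thesis
      unfolding r using oq chart_open_image[OF smooth_atlas_X c(1,3,2)] homeomorphic_map_compose[OF h1 h2] by blast
  qed
  then show "\<forall>(U, \<phi>)\<in>atlas (quotient_manifold X q). openin (mtop (quotient_manifold X q)) U \<and> open (\<phi> ` U) \<and>
      homeomorphic_map (subtopology (mtop (quotient_manifold X q)) U) (top_of_set (\<phi> ` U)) \<phi>"
    unfolding quotient_atlas by blast
  \<comment> \<open>Compatibility of the quotient charts is smoothness of the identity, written out
    in charts.\<close>
  have "smooth_map (quotient_manifold X q) (quotient_manifold X q) id"
    by (rule smooth_map_quotient[OF smooth_map_id[OF smooth_atlas_X]]) simp
  then have "Cinf_on (\<psi> \<circ> id \<circ> inv_into U \<phi>) (\<phi> ` {z \<in> U. id z \<in> V})"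
    if "(U, \<phi>) \<in> atlas (quotient_manifold X q)" "(V, \<psi>) \<in> atlas (quotient_manifold X q)" for U \<phi> V \<psi>
    using smooth_map_rep that by blast
  then show "\<forall>(U, \<phi>)\<in>atlas (quotient_manifold X q). \<forall>(V, \<psi>)\<in>atlas (quotient_manifold X q). Cinf_on (\<psi> \<circ> inv_into U \<phi>) (\<phi> ` (U \<inter> V))"
    by (simp add: Int_def) fast
qed

end

text \<open>Freeness separates \<open>x\<close> from \<open>\<sigma> x\<close> by disjoint open sets
  \<open>A\<close> and \<open>B\<close>; points of \<open>A\<close> with partner in \<open>B\<close>
  are never partners of each other, which gives the slice. For the Hausdorff property,
  \<open>x\<close> has to be separated from both points \<open>y\<close> and
  \<open>\<sigma> y\<close> of the other orbit, hence the two pairs of sets.\<close>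

lemma free_involution_orbit_quotient:
  assumes X: "smooth_manifold X" and \<sigma>: "smooth_map X X \<sigma>"
    and inv: "\<And>x. x \<in> points X \<Longrightarrow> \<sigma> (\<sigma> x) = x" and free: "\<And>x. x \<in> points X \<Longrightarrow> \<sigma> x \<noteq> x"
  shows "orbit_quotient X (\<lambda>x. {x, \<sigma> x}) {id, \<sigma>}"
proof
  have at: "smooth_atlas X" and H: "Hausdorff_space (mtop X)"
    using X by (auto simp: smooth_manifold_iff_smooth_atlas)
  have cont: "continuous_map (mtop X) (mtop X) \<sigma>"
    by (rule smooth_map_continuous[OF \<sigma>])
  have pts: "\<sigma> x \<in> points X" if "x \<in> points X" for x
    by (rule smooth_map_points[OF \<sigma> that])
  have sep: "\<exists>A B. openin (mtop X) A \<and> openin (mtop X) B \<and> x \<in> A \<and> y \<in> B \<and> A \<inter> B = {}"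
    if "x \<in> points X" "y \<in> points X" "x \<noteq> y" for x y
    using H that unfolding Hausdorff_space_def disjnt_def by blast
  show "smooth_manifold X" by (rule X)
  show "smooth_map X X g" if "g \<in> {id, \<sigma>}" for g
    using that \<sigma> smooth_map_id[OF at] by auto
  show "{x, \<sigma> x} = {y, \<sigma> y} \<longleftrightarrow> (\<exists>g\<in>{id, \<sigma>}. y = g x)" if "x \<in> points X" "y \<in> points X" for x y
    using inv[OF that(1)] inv[OF that(2)] by (auto simp: doubleton_eq_iff)
  show "\<exists>V. openin (mtop X) V \<and> x \<in> V \<and> inj_on (\<lambda>x. {x, \<sigma> x}) V" if x: "x \<in> points X" for x
  proof -
    obtain A B where AB: "openin (mtop X) A" "openin (mtop X) B" "x \<in> A" "\<sigma> x \<in> B" "A \<inter> B = {}"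
      using sep[OF x pts[OF x]] free[OF x] by metis
    have "openin (mtop X) {x \<in> A. \<sigma> x \<in> B}"
      by (rule openin_preimage[OF cont AB(1,2)])
    moreover have "inj_on (\<lambda>x. {x, \<sigma> x}) {x \<in> A. \<sigma> x \<in> B}"
      using AB(5) by (auto simp: inj_on_def doubleton_eq_iff)
    ultimately show ?thesis using AB by blast
  qed
  show "\<exists>V W. openin (mtop X) V \<and> openin (mtop X) W \<and> x \<in> V \<and> y \<in> W \<and>
      (\<lambda>x. {x, \<sigma> x}) ` V \<inter> (\<lambda>x. {x, \<sigma> x}) ` W = {}"
    if xy: "x \<in> points X" "y \<in> points X" "{x, \<sigma> x} \<noteq> {y, \<sigma> y}" for x y
  proof -
    have ne: "x \<noteq> y" "x \<noteq> \<sigma> y" using xy inv by auto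
    obtain A B where AB: "openin (mtop X) A" "openin (mtop X) B" "x \<in> A" "y \<in> B" "A \<inter> B = {}"
      using sep[OF xy(1,2) ne(1)] by blast
    obtain A' B' where AB': "openin (mtop X) A'" "openin (mtop X) B'" "x \<in> A'" "\<sigma> y \<in> B'" "A' \<inter> B' = {}"
      using sep[OF xy(1) pts[OF xy(2)] ne(2)] by blast
    have "openin (mtop X) (A \<inter> A')" "openin (mtop X) {y \<in> B. \<sigma> y \<in> B'}"
      using AB AB' openin_preimage[OF cont AB(2) AB'(2)] by auto
    moreover have "(\<lambda>x. {x, \<sigma> x}) ` (A \<inter> A') \<inter> (\<lambda>x. {x, \<sigma> x}) ` {y \<in> B. \<sigma> y \<in> B'} = {}"
      using AB(5) AB'(5) by (auto simp: doubleton_eq_iff)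
    ultimately show ?thesis using AB AB' by blast
  qed
qed

section \<open>The circle and the twisted product\<close>

lemma mem_circ: "t \<in> circ t"
  unfolding circ_def by (auto intro!: exI[of _ "0::int"])

lemma circ_eq_iff: "circ s = circ t \<longleftrightarrow> (\<exists>k::int. t = s + 2 * pi * of_int k)"
proof
  assume "circ s = circ t"
  then have "t \<in> circ s" using mem_circ by simp
  then show "\<exists>k::int. t = s + 2 * pi * of_int k" by (auto simp: circ_def)
next
  have *: "circ (s + 2 * pi * of_int k) \<subseteq> circ s" for s and k :: int
  proof
    fix x assume "x \<in> circ (s + 2 * pi * of_int k)"
    then obtain j :: int where "x = s + 2 * pi * of_int (k + j)"
      by (auto simp: circ_def algebra_simps)
    then show "x \<in> circ s" unfolding circ_def by blast
  qed
  assume "\<exists>k::int. t = s + 2 * pi * of_int k"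
  then obtain k :: int where "t = s + 2 * pi * of_int k" by blast
  moreover have "s = (s + 2 * pi * of_int k) + 2 * pi * of_int (- k)" by simp
  ultimately show "circ s = circ t"
    using *[of s k] *[of "s + 2 * pi * of_int k" "- k"] by (metis subset_antisym)
qed

text \<open>Identifies the classes modulo 2 pi with points of the unit circle, so that separation
  can be pulled back from the complex plane and the shift by pi becomes a change of sign.\<close>

lemma circ_eq_iff_cis: "circ s = circ t \<longleftrightarrow> cis s = cis t"
proof -
  have "cis s = cis t \<longleftrightarrow> sin t = sin s \<and> cos t = cos s"
    by (auto simp: complex_eq_iff)
  then show ?thesis
    by (simp add: circ_eq_iff sin_cos_eq_iff)
qed

lemma circ_shift: "(\<lambda>t. t + pi) ` circ t = circ (t + pi)"
  by (auto simp: circ_def image_iff algebra_simps)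

lemma orbit_quotient_circle:
  "orbit_quotient euclidean_manifold circ (range (\<lambda>(k::int) t. t + 2 * pi * of_int k))"
proof
  show "smooth_manifold (euclidean_manifold :: (real, real) manifold)"
    by (rule smooth_manifold_euclidean)
  show "smooth_map euclidean_manifold euclidean_manifold g"
    if "g \<in> range (\<lambda>(k::int) t. t + 2 * pi * of_int k)" for g :: "real \<Rightarrow> real"
    using that by (auto simp: smooth_map_euclidean_iff intro!: Cinf_on_add Cinf_on_id Cinf_on_const)
  show "circ x = circ y \<longleftrightarrow> (\<exists>g\<in>range (\<lambda>(k::int) t. t + 2 * pi * of_int k). y = g x)" for x y
    by (auto simp: circ_eq_iff)
  show "\<exists>V. openin (mtop euclidean_manifold) V \<and> x \<in> V \<and> inj_on circ V" for x :: real
  \<comment> \<open>Any interval of length at most 2 pi would do; with length 2 the crude bound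
    \<open>pi > 3\<close> already forces \<open>k = 0\<close>.\<close>
  proof (intro exI[of _ "{x - 1<..<x + 1}"] conjI inj_onI)
    fix s t assume st: "s \<in> {x - 1<..<x + 1}" "t \<in> {x - 1<..<x + 1}" "circ s = circ t"
    then obtain k :: int where k: "t = s + 2 * pi * of_int k"
      by (auto simp: circ_eq_iff)
    then have "\<bar>2 * pi * of_int k\<bar> < 2"
      using st(1,2) by (auto simp: abs_less_iff)
    then have "pi * \<bar>of_int k\<bar> < 1"
      by (simp add: abs_mult)
    moreover have "pi * \<bar>of_int k\<bar> \<ge> 3 * \<bar>of_int k\<bar>"
      using pi_gt3 by (intro mult_right_mono) auto
    ultimately have "k = 0" by linarith
    then show "s = t" using k by simp
  qed auto
  show "\<exists>V W. openin (mtop euclidean_manifold) V \<and> openin (mtop euclidean_manifold) W \<and>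
      x \<in> V \<and> y \<in> W \<and> circ ` V \<inter> circ ` W = {}"
    if xy: "circ x \<noteq> circ y" for x y
  proof -
    obtain A B where AB: "open A" "open B" "cis x \<in> A" "cis y \<in> B" "A \<inter> B = {}"
      using hausdorff[of "cis x" "cis y"] xy unfolding circ_eq_iff_cis by blast
    have "open (cis -` A)" "open (cis -` B)"
      using AB by (auto intro!: open_vimage continuous_on_cis continuous_on_id)
    moreover have "circ ` (cis -` A) \<inter> circ ` (cis -` B) = {}"
      using AB(5) by (auto simp: circ_eq_iff_cis)
    ultimately show ?thesis using AB(3,4) by (intro exI[of _ "cis -` A"] exI[of _ "cis -` B"]) auto
  qed
qed

interpretation circle: orbit_quotient euclidean_manifold circ "range (\<lambda>(k::int) t. t + 2 * pi * of_int k)"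
  by (rule orbit_quotient_circle)

lemma smooth_manifold_circle: "smooth_manifold circle_manifold"
  by (rule circle.quotient_smooth_manifold[folded circle_manifold_def])

lemma points_circle: "points circle_manifold = range circ"
  by (simp add: circle.quotient_mtop[folded circle_manifold_def])

lemma smooth_map_circle_shift: "smooth_map circle_manifold circle_manifold ((`) (\<lambda>t. t + pi))"
  by (rule circle.smooth_map_quotient[where h = "\<lambda>t. t + pi", folded circle_manifold_def])
     (auto simp: smooth_map_euclidean_iff circ_shift intro!: Cinf_on_add Cinf_on_id Cinf_on_const)

lemma deck_circ: "deck \<tau> (circ t, p) = (circ (t + pi), \<tau> p)"
  by (simp add: deck_def circ_shift)

lemma cis_add_pi: "cis (t + pi) = - cis t"
  by (simp add: complex_eq_iff)

section \<open>The quotient of circle times surface by the deck involution\<close>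

locale involution =
  fixes S :: "('a, 'e::euclidean_space) manifold" and \<tau> :: "'a \<Rightarrow> 'a"
  assumes S: "smooth_manifold S" and \<tau>: "smooth_map S S \<tau>"
    and \<tau>\<tau>: "\<And>p. p \<in> points S \<Longrightarrow> \<tau> (\<tau> p) = p"
begin

lemma smooth_atlas_S: "smooth_atlas S"
  using S by (simp add: smooth_manifold_iff_smooth_atlas)

lemma \<tau>_points: "p \<in> points S \<Longrightarrow> \<tau> p \<in> points S"
  by (rule smooth_map_points[OF \<tau>])

text \<open>The deck map is free whatever \<open>\<tau>\<close> does, since a shift by pi turns
  \<open>cis t\<close> into \<open>- cis t\<close>, which is different. So \<open>\<tau>\<close> may
  fix points, for instance over the origin of C^2.\<close>

lemma orbit_quotient_twisted:
  "orbit_quotient (prod_manifold circle_manifold S) (deck_class \<tau>) {id, deck \<tau>}"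
proof -
  have "deck_class \<tau> = (\<lambda>x. {x, deck \<tau> x})"
    by (simp add: deck_class_def fun_eq_iff)
  moreover have "orbit_quotient (prod_manifold circle_manifold S) (\<lambda>x. {x, deck \<tau> x}) {id, deck \<tau>}"
  proof (rule free_involution_orbit_quotient)
    show "smooth_manifold (prod_manifold circle_manifold S)"
      by (rule smooth_manifold_prod[OF smooth_manifold_circle S])
    have "deck \<tau> = map_prod ((`) (\<lambda>t. t + pi)) \<tau>"
      by (simp add: deck_def map_prod_def)
    then show "smooth_map (prod_manifold circle_manifold S) (prod_manifold circle_manifold S) (deck \<tau>)"
      using smooth_map_map_prod[OF _ smooth_atlas_S _ smooth_atlas_S smooth_map_circle_shift \<tau>]
        smooth_manifold_circle by (simp add: smooth_manifold_iff_smooth_atlas)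
    fix x assume "x \<in> points (prod_manifold circle_manifold S)"
    then obtain t p where x: "x = (circ t, p)" "p \<in> points S"
      by (auto simp: points_circle)
    have "cis (t + pi + pi) = cis t"
      by (simp only: cis_add_pi minus_minus)
    then have "circ (t + pi + pi) = circ t"
      by (simp only: circ_eq_iff_cis)
    then show "deck \<tau> (deck \<tau> x) = x"
      using \<tau>\<tau>[OF x(2)] by (simp add: x(1) deck_circ)
    have "cis t + cis t \<noteq> 0"
      using cis_neq_zero[of t] by (simp flip: mult_2)
    then have "cis (t + pi) \<noteq> cis t"
      unfolding cis_add_pi by (metis add.left_inverse)
    then show "deck \<tau> x \<noteq> x"
      by (simp add: x(1) deck_circ circ_eq_iff_cis)
  qed
  ultimately show ?thesis by simp
qed

sublocale twisted: orbit_quotient "prod_manifold circle_manifold S" "deck_class \<tau>" "{id, deck \<tau>}"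
  by (rule orbit_quotient_twisted)

lemma smooth_atlas_twisted: "smooth_atlas (twisted_product S \<tau>)"
  using twisted.quotient_smooth_manifold[folded twisted_product_def] by (simp add: smooth_manifold_iff_smooth_atlas)

lemma points_twisted:
  "points (twisted_product S \<tau>) = {deck_class \<tau> (circ t, p) | t p. p \<in> points S}"
  by (auto simp: twisted.quotient_mtop[folded twisted_product_def] points_circle image_iff)

text \<open>The right-hand side has the shape of \<open>twist_1_eq_iff\<close>, with
  \<open>\<tau>\<close> in place of the minus sign. Comparing the two yields that the map on orbits
  is well defined, what its fibres are, and when it is injective.\<close>

lemma deck_class_eq_iff:
  assumes "p \<in> points S" "p' \<in> points S"
  shows "deck_class \<tau> (circ s, p) = deck_class \<tau> (circ t, p') \<longleftrightarrow>
    cis s = cis t \<and> p = p' \<or> cis s = - cis t \<and> p = \<tau> p'"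
proof -
  have "deck_class \<tau> (circ t, p') = deck_class \<tau> (circ s, p) \<longleftrightarrow>
      (\<exists>g\<in>{id, deck \<tau>}. (circ s, p) = g (circ t, p'))"
    by (rule twisted.orbit) (use assms in \<open>auto simp: points_circle\<close>)
  also have "\<dots> \<longleftrightarrow> cis s = cis t \<and> p = p' \<or> cis s = - cis t \<and> p = \<tau> p'"
    by (auto simp: deck_circ circ_eq_iff_cis cis_add_pi)
  finally show ?thesis by (simp add: eq_commute)
qed

text \<open>Along this covering by the line times \<open>S\<close>, an open set of orbits pulls back
  to one that contains boxes with a genuine real parameter; openness of the embedding is proved on
  such boxes.\<close>

lemma continuous_map_cover:
  "continuous_map (prod_topology euclidean (mtop S)) (mtop (twisted_product S \<tau>))
    (\<lambda>(t, p). deck_class \<tau> (circ t, p))"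
proof -
  have "continuous_map (prod_topology euclidean (mtop S)) (prod_topology (mtop circle_manifold) (mtop S))
      (\<lambda>(t, p). (circ t, id p))"
    using circle.continuous_map_q[folded circle_manifold_def] by (simp add: continuous_map_prod_top id_def)
  then have "continuous_map (prod_topology euclidean (mtop S)) (mtop (twisted_product S \<tau>))
      (deck_class \<tau> \<circ> (\<lambda>(t, p). (circ t, id p)))"
    using twisted.continuous_map_q[folded twisted_product_def] by (intro continuous_map_compose) auto
  then show ?thesis
    by (simp add: o_def split_def)
qed

text \<open>A chart here is pushed forward twice, from the line to the circle and from the product
  to the orbits. Unwinding both shows that its coordinates are those of some representative, which
  is all that later computations use.\<close>

lemma twisted_chart:
  assumes "c \<in> atlas (twisted_product S \<tau>)"
  obtains U \<psi> where "(U, \<psi>) \<in> atlas S"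
    "\<And>x. x \<in> fst c \<Longrightarrow> \<exists>s p. p \<in> U \<and> x = deck_class \<tau> (circ s, p) \<and> snd c x = (s, \<psi> p)"
proof -
  obtain U' \<phi>' V where V: "c = (deck_class \<tau> ` V, \<phi>' \<circ> inv_into V (deck_class \<tau>))"
      "(U', \<phi>') \<in> atlas (prod_manifold circle_manifold S)" "V \<subseteq> U'" "inj_on (deck_class \<tau>) V"
    using assms unfolding twisted.quotient_atlas[folded twisted_product_def] by blast
  obtain U1 \<phi>1 U \<psi> where U: "U' = U1 \<times> U" "\<phi>' = map_prod \<phi>1 \<psi>"
      "(U1, \<phi>1) \<in> atlas circle_manifold" "(U, \<psi>) \<in> atlas S"
    using V(2) by auto
  obtain I where I: "U1 = circ ` I" "\<phi>1 = id \<circ> inv_into I circ" "inj_on circ I"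
    using U(3) unfolding circle.quotient_atlas[folded circle_manifold_def] by auto
  show thesis
  proof (rule that[OF U(4)])
    fix x assume "x \<in> fst c"
    then obtain T p where Tp: "(T, p) \<in> V" "x = deck_class \<tau> (T, p)"
      using V(1) by auto
    then have "T \<in> circ ` I" "p \<in> U"
      using V(3) U(1) I(1) by auto
    then obtain s where s: "s \<in> I" "T = circ s" by blast
    have "snd c x = (\<phi>1 T, \<psi> p)"
      using V(1,4) U(2) Tp by (simp add: inv_into_f_f)
    also have "\<phi>1 T = s"
      using s I(2,3) by simp
    finally show "\<exists>s p. p \<in> U \<and> x = deck_class \<tau> (circ s, p) \<and> snd c x = (s, \<psi> p)"
      using Tp(2) s(2) \<open>p \<in> U\<close> by blast
  qed
qed

end

section \<open>The total space\<close>

lemma hpoint_eq_iff: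
  "hpoint (z, w, a, b) = hpoint (z', w', a', b') \<longleftrightarrow>
    (\<exists>c. c \<noteq> 0 \<and> z' = c * z \<and> w' = c * w \<and> a' = inverse c * a \<and> b' = inverse c * b)"
  (is "?L \<longleftrightarrow> ?R")
proof
  assume ?L
  moreover have "(z', w', a', b') \<in> hpoint (z', w', a', b')"
    unfolding hpoint_def by (auto intro!: exI[of _ 1])
  ultimately have "(z', w', a', b') \<in> hpoint (z, w, a, b)" by simp
  then show ?R unfolding hpoint_def by auto
next
  assume ?R
  then obtain c where c: "c \<noteq> 0" "z' = c * z" "w' = c * w" "a' = inverse c * a" "b' = inverse c * b"
    by blast
  show ?L
  proof (intro equalityI subsetI)
    fix x assume "x \<in> hpoint (z, w, a, b)"
    then obtain d where "d \<noteq> 0" "x = (d * z, d * w, inverse d * a, inverse d * b)"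
      unfolding hpoint_def by auto
    then show "x \<in> hpoint (z', w', a', b')"
      using c unfolding hpoint_def by (auto intro!: exI[of _ "d / c"] simp: field_simps)
  next
    fix x assume "x \<in> hpoint (z', w', a', b')"
    then obtain d where "d \<noteq> 0" "x = (d * z', d * w', inverse d * a', inverse d * b')"
      unfolding hpoint_def by auto
    then show "x \<in> hpoint (z, w, a, b)"
      using c unfolding hpoint_def by (auto intro!: exI[of _ "d * c"] simp: field_simps)
  qed
qed

lemma herm_norm_neq_0 [simp]: "herm_norm u \<noteq> 0"
proof -
  have "(cmod u)\<^sup>2 + 1 > 0" by (simp add: add_nonneg_pos)
  then show ?thesis by (simp add: herm_norm_def)
qed

text \<open>Rescaling by \<open>1 / w\<close> normalises the second coordinate to 1 and multiplies
  the fibre coordinates by \<open>w\<close>. The right-hand side is thus an explicit inverse of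
  \<open>pt_w\<close> in homogeneous coordinates.\<close>

lemma hpoint_eq_pt_w:
  "hpoint (z, w, a, b) = pt_w (u, \<zeta>1, \<zeta>2) \<longleftrightarrow>
    w \<noteq> 0 \<and> u = z / w \<and> \<zeta>1 = herm_norm (z / w) * (w * a) \<and> \<zeta>2 = herm_norm (z / w) * (w * b)"
    (is "?L \<longleftrightarrow> ?R")
proof
  assume ?L
  then obtain c where c: "c \<noteq> 0" "u = c * z" "1 = c * w" "\<zeta>1 / herm_norm u = inverse c * a"
      "\<zeta>2 / herm_norm u = inverse c * b"
    by (auto simp: pt_w_def hpoint_eq_iff)
  have "w \<noteq> 0" using c(3) by auto
  moreover have c': "inverse c = w" using c(3) by (intro inverse_unique) simp
  moreover have "z / w = u" unfolding c'[symmetric] using c(1,2) by (simp add: divide_inverse mult.commute)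
  ultimately show ?R using c(4,5) by (simp add: field_simps)
next
  assume ?R
  then show ?L
    by (auto simp: pt_w_def hpoint_eq_iff intro!: exI[of _ "inverse w"] simp: field_simps)
qed

lemma hpoint_eq_pt_z:
  "hpoint (z, w, a, b) = pt_z (v, \<zeta>1, \<zeta>2) \<longleftrightarrow>
    z \<noteq> 0 \<and> v = w / z \<and> \<zeta>1 = herm_norm (w / z) * (z * a) \<and> \<zeta>2 = herm_norm (w / z) * (z * b)"
    (is "?L \<longleftrightarrow> ?R")
proof
  assume ?L
  then obtain c where c: "c \<noteq> 0" "v = c * w" "1 = c * z" "\<zeta>1 / herm_norm v = inverse c * a"
      "\<zeta>2 / herm_norm v = inverse c * b"
    by (auto simp: pt_z_def hpoint_eq_iff)
  have "z \<noteq> 0" using c(3) by auto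
  moreover have c': "inverse c = z" using c(3) by (intro inverse_unique) simp
  moreover have "w / z = v" unfolding c'[symmetric] using c(1,2) by (simp add: divide_inverse mult.commute)
  ultimately show ?R using c(4,5) by (simp add: field_simps)
next
  assume ?R
  then show ?L
    by (auto simp: pt_z_def hpoint_eq_iff intro!: exI[of _ "inverse z"] simp: field_simps)
qed

text \<open>By the symmetry of z and w one formula serves both changes of chart. Since
  \<open>herm_norm (1 / u)\<close> is \<open>herm_norm u / |u|\<close>, the fibre coordinates are
  multiplied by the phase \<open>u / |u|\<close>.\<close>

definition bundle_transition :: "complex \<times> complex \<times> complex \<Rightarrow> complex \<times> complex \<times> complex" where
  "bundle_transition = (\<lambda>(u, \<zeta>1, \<zeta>2). (inverse u,
     herm_norm (inverse u) * (u * (\<zeta>1 * inverse (herm_norm u))),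
     herm_norm (inverse u) * (u * (\<zeta>2 * inverse (herm_norm u)))))"

lemma pt_w_eq_pt_z_iff: "pt_w x = pt_z y \<longleftrightarrow> fst x \<noteq> 0 \<and> y = bundle_transition x"
  by (cases x; cases y) (auto simp: pt_w_def hpoint_eq_pt_z bundle_transition_def field_simps)

lemma pt_z_eq_pt_w_iff: "pt_z x = pt_w y \<longleftrightarrow> fst x \<noteq> 0 \<and> y = bundle_transition x"
  by (cases x; cases y) (auto simp: pt_z_def hpoint_eq_pt_w bundle_transition_def field_simps)

lemma inj_pt_w: "inj pt_w"
proof (rule injI)
  fix x y assume "pt_w x = pt_w y"
  then show "x = y"
    by (cases x; cases y) (auto simp: pt_w_def hpoint_eq_iff)
qed

lemma inj_pt_z: "inj pt_z"
proof (rule injI)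
  fix x y assume "pt_z x = pt_z y"
  then show "x = y"
    by (cases x; cases y) (auto simp: pt_z_def hpoint_eq_iff)
qed

text \<open>The squared norm is smooth as the bilinear expression \<open>u \<bullet> u\<close>, and
  the summand 1 keeps the argument of \<open>sqrt\<close> away from 0.\<close>

lemma Cinf_on_herm_norm: "Cinf_on herm_norm UNIV"
proof -
  have "Cinf_on (\<lambda>u::complex. u \<bullet> u + 1) UNIV"
    by (intro Cinf_on_add Cinf_on_bounded_bilinear[OF bounded_bilinear_inner] Cinf_on_id Cinf_on_const) auto
  then have "Cinf_on (\<lambda>u::complex. sqrt (u \<bullet> u + 1)) UNIV"
    by (rule Cinf_on_compose[OF Cinf_on_sqrt]) (auto simp: add_nonneg_pos)
  then have "Cinf_on (\<lambda>u::complex. complex_of_real (sqrt (u \<bullet> u + 1))) UNIV"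
    by (intro Cinf_on_bounded_linear[OF bounded_linear_of_real]) auto
  then show ?thesis
    by (simp add: herm_norm_def[abs_def] power2_norm_eq_inner)
qed

lemma continuous_on_herm_norm: "continuous_on A f \<Longrightarrow> continuous_on A (\<lambda>x. herm_norm (f x))"
  unfolding herm_norm_def by (intro continuous_intros)

lemma Cinf_on_bundle_transition: "Cinf_on bundle_transition {x. fst x \<noteq> 0}"
proof -
  let ?D = "{x :: complex \<times> complex \<times> complex. fst x \<noteq> 0}"
  have D: "open ?D"
    by (intro open_Collect_neq continuous_intros)
  have fst: "Cinf_on (\<lambda>x. fst x) ?D"
    by (rule Cinf_on_fst[OF D Cinf_on_id])
  have inv: "Cinf_on (\<lambda>x. inverse (fst x)) ?D"
    by (rule Cinf_on_compose[OF Cinf_on_inverse fst D]) auto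
  have herm: "Cinf_on (\<lambda>x. herm_norm (f x)) ?D" if "Cinf_on f ?D" for f
    by (rule Cinf_on_compose[OF Cinf_on_herm_norm that D]) auto
  have iherm: "Cinf_on (\<lambda>x. inverse (herm_norm (fst x))) ?D"
    by (rule Cinf_on_compose[OF Cinf_on_inverse herm[OF fst] D]) auto
  have "Cinf_on (\<lambda>x. (inverse (fst x),
     herm_norm (inverse (fst x)) * (fst x * (fst (snd x) * inverse (herm_norm (fst x)))),
     herm_norm (inverse (fst x)) * (fst x * (snd (snd x) * inverse (herm_norm (fst x)))))) ?D"
    by (intro Cinf_on_Pair Cinf_on_mult herm inv fst iherm Cinf_on_fst Cinf_on_snd Cinf_on_id D)
  then show ?thesis
    by (simp add: bundle_transition_def split_def)
qed

section \<open>Topology and charts of the total space\<close>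

abbreviation "base_space \<equiv> {(z, w, \<eta>1, \<eta>2). (z, w) \<noteq> (0, 0)} :: (complex \<times> complex \<times> complex \<times> complex) set"

lemma mtop_total_space: "mtop total_space = quotient_topology (top_of_set base_space) hpoint"
  and atlas_total_space: "atlas total_space = {chart_w, chart_z}"
  by (simp_all add: total_space_def)

lemma open_base_space: "open base_space"
proof -
  have "base_space = {x. fst x \<noteq> 0} \<union> {x. fst (snd x) \<noteq> 0}" by auto
  then show ?thesis
    by (auto intro!: open_Un open_Collect_neq continuous_intros)
qed

lemma openin_total_space:
  assumes "V \<subseteq> hpoint ` base_space" "open {x \<in> base_space. hpoint x \<in> V}"
  shows "openin (mtop total_space) V"
  using assms unfolding mtop_total_space openin_quotient_topology topspace_euclidean_subtopology
    openin_open_eq[OF open_base_space] by blast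

lemma continuous_map_hpoint:
  assumes "continuous_on UNIV f" "range f \<subseteq> base_space"
  shows "continuous_map euclidean (mtop total_space) (\<lambda>x. hpoint (f x))"
proof -
  have "continuous_map euclidean (top_of_set base_space) f"
    using assms by (auto simp: continuous_map_in_subtopology)
  then have "continuous_map euclidean (mtop total_space) (hpoint \<circ> f)"
    unfolding mtop_total_space
    using quotient_imp_continuous_map[OF quotient_map_quotient_topology] by (rule continuous_map_compose)
  then show ?thesis by (simp add: o_def)
qed

lemma continuous_map_pt_w: "continuous_map euclidean (mtop total_space) pt_w"
proof -
  have "continuous_map euclidean (mtop total_space)
      (\<lambda>x. hpoint (fst x, 1, fst (snd x) / herm_norm (fst x), snd (snd x) / herm_norm (fst x)))"
    by (rule continuous_map_hpoint)
       (intro continuous_on_Pair continuous_on_const continuous_on_fst continuous_on_snd continuous_on_id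
          continuous_on_divide continuous_on_herm_norm, auto)
  then show ?thesis by (simp add: pt_w_def split_def)
qed

lemma continuous_map_pt_z: "continuous_map euclidean (mtop total_space) pt_z"
proof -
  have "continuous_map euclidean (mtop total_space)
      (\<lambda>x. hpoint (1, fst x, fst (snd x) / herm_norm (fst x), snd (snd x) / herm_norm (fst x)))"
    by (rule continuous_map_hpoint)
       (intro continuous_on_Pair continuous_on_const continuous_on_fst continuous_on_snd continuous_on_id
          continuous_on_divide continuous_on_herm_norm, auto)
  then show ?thesis by (simp add: pt_z_def split_def)
qed

lemma pt_in_base_space: "pt_w x \<in> hpoint ` base_space" "pt_z x \<in> hpoint ` base_space"
proof -
  obtain u a b where x: "x = (u, a, b)" by (cases x)
  show "pt_w x \<in> hpoint ` base_space" "pt_z x \<in> hpoint ` base_space"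
    unfolding x pt_w_def pt_z_def prod.case by (rule imageI, simp)+
qed

lemma open_map_pt_w: "open_map euclidean (mtop total_space) pt_w"
  unfolding open_map_def
proof (intro allI impI openin_total_space)
  fix V :: "(complex \<times> complex \<times> complex) set" assume V: "openin euclidean V"
  show "pt_w ` V \<subseteq> hpoint ` base_space"
    using pt_in_base_space by blast
  \<comment> \<open>The coordinates found in \<open>hpoint_eq_pt_w\<close>. They are continuous
    where \<open>w\<close> is nonzero, and the saturated preimage of the image of \<open>V\<close>
    is the preimage of \<open>V\<close> under them.\<close>
  let ?f = "\<lambda>(z, w, a, b). (z / w, herm_norm (z / w) * (w * a), herm_norm (z / w) * (w * b))"
  have "continuous_on {x. fst (snd x) \<noteq> 0} ?f"
    unfolding split_def by (intro continuous_intros continuous_on_herm_norm) auto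
  then have "open ({x. fst (snd x) \<noteq> 0} \<inter> ?f -` V)"
    using V by (intro continuous_open_preimage open_Collect_neq continuous_intros) auto
  moreover have "{x. fst (snd x) \<noteq> 0} \<inter> ?f -` V = {x \<in> base_space. hpoint x \<in> pt_w ` V}"
    by (auto simp: image_iff Bex_def hpoint_eq_pt_w)
  ultimately show "open {x \<in> base_space. hpoint x \<in> pt_w ` V}" by simp
qed

lemma open_map_pt_z: "open_map euclidean (mtop total_space) pt_z"
  unfolding open_map_def
proof (intro allI impI openin_total_space)
  fix V :: "(complex \<times> complex \<times> complex) set" assume V: "openin euclidean V"
  show "pt_z ` V \<subseteq> hpoint ` base_space"
    using pt_in_base_space by blast
  let ?f = "\<lambda>(z, w, a, b). (w / z, herm_norm (w / z) * (z * a), herm_norm (w / z) * (z * b))"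
  have "continuous_on {x. fst x \<noteq> 0} ?f"
    unfolding split_def by (intro continuous_intros continuous_on_herm_norm) auto
  then have "open ({x. fst x \<noteq> 0} \<inter> ?f -` V)"
    using V by (intro continuous_open_preimage open_Collect_neq continuous_intros) auto
  moreover have "{x. fst x \<noteq> 0} \<inter> ?f -` V = {x \<in> base_space. hpoint x \<in> pt_z ` V}"
    by (auto simp: image_iff Bex_def hpoint_eq_pt_z)
  ultimately show "open {x \<in> base_space. hpoint x \<in> pt_z ` V}" by simp
qed

text \<open>The charts of the bundle are inverses of parametrisations by all of C^3, so the chart
  axioms are transferred from an injective, continuous and open \<open>p\<close>. The last claim
  removes the double inverse from coordinate expressions.\<close>

lemma parametrization_chart:
  fixes p :: "'e::topological_space \<Rightarrow> 'b"
  assumes "inj p" "continuous_map euclidean X p" "open_map euclidean X p"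
  shows "openin X (range p)" and "inv p ` range p = UNIV"
    and "homeomorphic_map (subtopology X (range p)) euclidean (inv p)"
    and "inv_into (range p) (inv p) = p"
proof -
  show o: "openin X (range p)"
    using assms(3) by (auto simp: open_map_def)
  show r: "inv p ` range p = UNIV"
    using assms(1) by (simp add: image_image)
  have "homeomorphic_map euclidean (subtopology X (range p)) p"
  proof (rule bijective_open_imp_homeomorphic_map)
    show "continuous_map euclidean (subtopology X (range p)) p"
      using assms(2) by (simp add: continuous_map_in_subtopology)
    show "open_map euclidean (subtopology X (range p)) p"
      using assms(3) o by (auto simp: open_map_def openin_open_subtopology)
    show "p ` topspace euclidean = topspace (subtopology X (range p))"
      using openin_subset[OF o] by auto
  qed (use assms(1) in simp)
  then obtain r where r: "homeomorphic_maps euclidean (subtopology X (range p)) p r"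
    by (auto simp: homeomorphic_map_maps)
  then have "homeomorphic_map (subtopology X (range p)) euclidean r"
    unfolding homeomorphic_map_maps using homeomorphic_maps_sym by blast
  moreover have "r y = inv p y" if "y \<in> topspace (subtopology X (range p))" for y
  proof -
    obtain x where x: "y = p x" using \<open>y \<in> topspace (subtopology X (range p))\<close> by auto
    have "r (p x) = x" using r by (simp add: homeomorphic_maps_def)
    then show ?thesis using x assms(1) by simp
  qed
  ultimately show "homeomorphic_map (subtopology X (range p)) euclidean (inv p)"
    using homeomorphic_map_eq by blast
  have "inj_on (inv p) (range p)" by (rule inj_on_inv_into) simp
  then have "inv_into (range p) (inv p) (inv p (p x)) = p x" for x
    by (rule inv_into_f_f) simp
  then show "inv_into (range p) (inv p) = p"
    using assms(1) by (simp add: fun_eq_iff)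
qed

lemmas chart_w_props = parametrization_chart[OF inj_pt_w continuous_map_pt_w open_map_pt_w]
lemmas chart_z_props = parametrization_chart[OF inj_pt_z continuous_map_pt_z open_map_pt_z]

lemma smooth_atlas_total_space: "smooth_atlas total_space"
  unfolding smooth_atlas_def
proof (intro conjI)
  have "hpoint x \<in> range pt_w \<union> range pt_z" if "x \<in> base_space" for x
  proof -
    obtain z w a b where x: "x = (z, w, a, b)" by (cases x)
    show ?thesis
    proof (cases "w = 0")
      case True
      then have "z \<noteq> 0" using that x by auto
      then have "hpoint x = pt_z (w / z, herm_norm (w / z) * (z * a), herm_norm (w / z) * (z * b))"
        unfolding x hpoint_eq_pt_z by simp
      then show ?thesis by blast
    next
      case False
      then have "hpoint x = pt_w (z / w, herm_norm (z / w) * (w * a), herm_norm (z / w) * (w * b))"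
        unfolding x hpoint_eq_pt_w by simp
      then show ?thesis by blast
    qed
  qed
  moreover have "range pt_w \<subseteq> hpoint ` base_space" "range pt_z \<subseteq> hpoint ` base_space"
    using pt_in_base_space by blast+
  ultimately have "range pt_w \<union> range pt_z = hpoint ` base_space" by blast
  then show "\<Union> (fst ` atlas total_space) = points total_space"
    by (simp add: atlas_total_space mtop_total_space chart_w_def chart_z_def)
  show "\<forall>(U, \<phi>)\<in>atlas total_space. openin (mtop total_space) U \<and> open (\<phi> ` U) \<and>
      homeomorphic_map (subtopology (mtop total_space) U) (top_of_set (\<phi> ` U)) \<phi>"
    using chart_w_props chart_z_props by (simp add: atlas_total_space chart_w_def chart_z_def)
  have id: "Cinf_on (\<lambda>x. inv p (p x)) (inv p ` (range p \<inter> range p))"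
    if "inj p" for p :: "complex \<times> complex \<times> complex \<Rightarrow> bundle_point"
    using that Cinf_on_id by simp
  have tr: "Cinf_on (\<lambda>x. inv p' (p x)) (inv p ` (range p \<inter> range p'))"
    if "inj p" "inj p'" "\<And>x y. p x = p' y \<longleftrightarrow> fst x \<noteq> 0 \<and> y = bundle_transition x"
    for p p' :: "complex \<times> complex \<times> complex \<Rightarrow> bundle_point"
  proof -
    have op: "open {x :: complex \<times> complex \<times> complex. fst x \<noteq> 0}"
      by (intro open_Collect_neq continuous_intros)
    have "inv p' (p x) = bundle_transition x" if "fst x \<noteq> 0" for x
    proof -
      have "p x = p' (bundle_transition x)"
        using that \<open>\<And>x y. p x = p' y \<longleftrightarrow> fst x \<noteq> 0 \<and> y = bundle_transition x\<close> by blast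
      then show ?thesis using \<open>inj p'\<close> by simp
    qed
    then have "Cinf_on (\<lambda>x. inv p' (p x)) {x. fst x \<noteq> 0}"
      by (intro Cinf_on_cong[OF Cinf_on_bundle_transition op]) simp
    moreover have "inv p ` (range p \<inter> range p') \<subseteq> {x. fst x \<noteq> 0}"
    proof
      fix y assume "y \<in> inv p ` (range p \<inter> range p')"
      then obtain x x' where x: "y = inv p (p x)" "p x = p' x'" by blast
      have "y = x" using x(1) that(1) by simp
      moreover have "fst x \<noteq> 0" using x(2) that(3) by blast
      ultimately show "y \<in> {x. fst x \<noteq> 0}" by simp
    qed
    ultimately show ?thesis by (rule Cinf_on_subset)
  qed
  show "\<forall>(U, \<phi>)\<in>atlas total_space. \<forall>(V, \<psi>)\<in>atlas total_space.
      Cinf_on (\<psi> \<circ> inv_into U \<phi>) (\<phi> ` (U \<inter> V))"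
    using id[OF inj_pt_w] id[OF inj_pt_z] tr[OF inj_pt_w inj_pt_z pt_w_eq_pt_z_iff]
      tr[OF inj_pt_z inj_pt_w pt_z_eq_pt_w_iff]
    by (simp add: atlas_total_space chart_w_def chart_z_def chart_w_props(4) chart_z_props(4) o_def)
qed

section \<open>The Lagrangian immersion\<close>

text \<open>\<open>\<sigma> = 1\<close> gives the map in the coordinates of \<open>chart_w\<close> and \<open>\<sigma> = -1\<close> in those of \<open>chart_z\<close>.\<close>

definition twist :: "real \<Rightarrow> real \<Rightarrow> complex \<times> complex \<Rightarrow> complex \<times> complex \<times> complex" where
  "twist \<sigma> s z = (cis (2 * \<sigma> * s), cis (- (\<sigma> * s)) * fst z, cis (- (\<sigma> * s)) * snd z)"

text \<open>The derivative of \<open>(s, e) \<mapsto> twist \<sigma> s (f e)\<close>, with \<open>z = f e\<close> and \<open>w\<close> the derivative of \<open>f\<close>.\<close>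

definition dtwist ::
  "real \<Rightarrow> real \<Rightarrow> complex \<times> complex \<Rightarrow> real \<Rightarrow> complex \<times> complex \<Rightarrow> complex \<times> complex \<times> complex" where
  "dtwist \<sigma> s z h w =
     ((2 * \<sigma> * h) *\<^sub>R (\<i> * cis (2 * \<sigma> * s)),
      cis (- (\<sigma> * s)) * fst w - (\<sigma> * h) *\<^sub>R (\<i> * cis (- (\<sigma> * s))) * fst z,
      cis (- (\<sigma> * s)) * snd w - (\<sigma> * h) *\<^sub>R (\<i> * cis (- (\<sigma> * s))) * snd z)"

lemma twist_1: "twist 1 s z = ((cis s)\<^sup>2, cnj (cis s) * fst z, cnj (cis s) * snd z)"
  by (simp add: twist_def Complex.DeMoivre cis_cnj)

text \<open>The base coordinate is the square of \<open>cis s\<close> and so fixes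
  \<open>cis s\<close> up to sign; the fibre coordinates carry that sign over to
  \<open>z\<close>.\<close>

lemma twist_1_eq_iff:
  "twist 1 s z = twist 1 t z' \<longleftrightarrow> cis s = cis t \<and> z = z' \<or> cis s = - cis t \<and> z = - z'"
proof -
  have c: "- (cnj (cis t) * x) = cnj (cis t) * y \<longleftrightarrow> x = - y" for x y
  proof -
    have "- (cnj (cis t) * x) = cnj (cis t) * y \<longleftrightarrow> cnj (cis t) * (- x) = cnj (cis t) * y"
      by simp
    also have "\<dots> \<longleftrightarrow> - x = y"
      by (rule mult_left_cancel) simp
    finally show ?thesis by auto
  qed
  have "(cis s)\<^sup>2 = (cis t)\<^sup>2 \<longleftrightarrow> cis s = cis t \<or> cis s = - cis t"
    by (rule power2_eq_iff)
  then show ?thesis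
    by (cases "cis s = cis t"; cases "cis s = - cis t") (auto simp: twist_1 prod_eq_iff c)
qed

text \<open>On the unit circle \<open>u\<close> and \<open>1 / u\<close> have the same
  \<open>herm_norm\<close>, so the change of chart multiplies the fibres by
  \<open>u = cis (2 * s)\<close> and turns the factor \<open>cis (- s)\<close> into
  \<open>cis s\<close>.\<close>

lemma pt_w_twist: "pt_w (twist 1 s z) = pt_z (twist (-1) s z)"
proof -
  have h: "herm_norm (inverse (cis (2 * s))) = herm_norm (cis (2 * s))"
    by (simp add: herm_norm_def)
  have key: "herm_norm (inverse (cis (2 * s))) * (cis (2 * s) * (cis (- s) * x * inverse (herm_norm (cis (2 * s))))) =
      cis s * x" for x
  proof -
    have "herm_norm (inverse (cis (2 * s))) * (cis (2 * s) * (cis (- s) * x * inverse (herm_norm (cis (2 * s))))) =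
        (herm_norm (cis (2 * s)) * inverse (herm_norm (cis (2 * s)))) * ((cis (2 * s) * cis (- s)) * x)"
      unfolding h by (simp only: ac_simps)
    then show ?thesis by (simp add: cis_mult)
  qed
  have "twist 1 s z = (cis (2 * s), cis (- s) * fst z, cis (- s) * snd z)"
    "twist (-1) s z = (inverse (cis (2 * s)), cis s * fst z, cis s * snd z)"
    by (simp_all add: twist_def)
  then show ?thesis
    unfolding pt_w_eq_pt_z_iff by (simp only: bundle_transition_def prod.case key) simp
qed

lemma has_derivative_twist:
  assumes "(f has_derivative f') (at (snd x))"
  shows "((\<lambda>x. twist \<sigma> (fst x) (f (snd x))) has_derivative
    (\<lambda>v. dtwist \<sigma> (fst x) (f (snd x)) (fst v) (f' (snd v)))) (at x)"
proof -
  have f: "((\<lambda>x. f (snd x)) has_derivative (\<lambda>v. f' (snd v))) (at x)"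
    by (rule has_derivative_compose[OF has_derivative_snd[OF has_derivative_ident] assms])
  show ?thesis
    unfolding twist_def dtwist_def
    by (auto intro!: derivative_eq_intros f simp: algebra_simps scaleR_conv_of_real)
qed

lemma Cinf_on_twist:
  fixes f :: "'e::euclidean_space \<Rightarrow> complex \<times> complex"
  assumes f: "Cinf_on f A" and A: "open A"
  shows "Cinf_on (\<lambda>x. twist \<sigma> (fst x) (f (snd x))) (UNIV \<times> A)"
proof -
  have op: "open ((UNIV :: real set) \<times> A)" using A by (simp add: open_Times)
  have fs: "Cinf_on (\<lambda>x :: real \<times> 'e. f (snd x)) (UNIV \<times> A)"
    by (rule Cinf_on_compose[OF f Cinf_on_snd[OF op Cinf_on_id] op A]) auto
  have cis: "Cinf_on (\<lambda>x :: real \<times> 'e. cis (k * fst x)) (UNIV \<times> A)" for k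
    by (rule Cinf_on_compose[OF Cinf_on_cis _ op open_UNIV])
       (intro Cinf_on_mult Cinf_on_const Cinf_on_fst Cinf_on_id op, auto)
  have "Cinf_on (\<lambda>x :: real \<times> 'e. (cis (2 * \<sigma> * fst x), cis (- \<sigma> * fst x) * fst (f (snd x)),
      cis (- \<sigma> * fst x) * snd (f (snd x)))) (UNIV \<times> A)"
    by (intro Cinf_on_Pair Cinf_on_mult cis Cinf_on_fst[OF op fs] Cinf_on_snd[OF op fs] op)
  then show ?thesis by (simp add: twist_def)
qed

text \<open>The base component recovers the angular direction, because \<open>\<sigma>\<close> is
  nonzero; the terms containing \<open>z\<close> then cancel and injectivity of \<open>f'\<close>
  recovers the rest.\<close>

lemma inj_dtwist:
  assumes "linear f'" "inj f'" "\<sigma> \<noteq> 0"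
  shows "inj (\<lambda>v. dtwist \<sigma> s z (fst v) (f' (snd v)))"
proof (rule injI)
  fix v w assume eq: "dtwist \<sigma> s z (fst v) (f' (snd v)) = dtwist \<sigma> s z (fst w) (f' (snd w))"
  then have 1: "fst v = fst w"
    using assms(3) by (simp add: dtwist_def)
  then have "f' (snd v) = f' (snd w)"
    using eq by (simp add: dtwist_def prod_eq_iff)
  then have "snd v = snd w"
    by (rule injD[OF assms(2)])
  with 1 show "v = w"
    by (rule prod_eqI)
qed

lemma \<Omega>_form_dtwist:
  "\<Omega>_form a (twist 1 s z) (dtwist 1 s z h w) (dtwist 1 s z h' w') = \<omega>_std y w w'"
proof -
  \<comment> \<open>Here \<open>du = 2 k \<i> u\<close> with \<open>|u| = 1\<close>, so
    \<open>Im (cnj u * du)\<close> is \<open>2 * k\<close>, and the denominator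
    \<open>|u|^2 + 1\<close> is 2.\<close>
  have A: "A_form (twist 1 s z) (dtwist 1 s z k x) = k" for k x
  proof -
    have "cos (2 * s) * (2 * k * cos (2 * s)) + sin (2 * s) * (2 * k * sin (2 * s)) = k * 2"
      using sin_cos_squared_add3[of "2 * s"] by algebra
    then show ?thesis
      by (simp add: A_form_def twist_def dtwist_def)
  qed
  have \<pi>: "\<pi>1_form (twist 1 s z) (dtwist 1 s z k x) = cis (- s) * fst x"
    "\<pi>2_form (twist 1 s z) (dtwist 1 s z k x) = cis (- s) * snd x" for k x
    using A[of k x] by (simp_all add: \<pi>1_form_def \<pi>2_form_def twist_def dtwist_def scaleR_conv_of_real)
  have rot: "cis (- s) * p * cnj (cis (- s) * q) = p * cnj q" for p q
  proof -
    have "cis (- s) * p * cnj (cis (- s) * q) = cis (- s) * cnj (cis (- s)) * (p * cnj q)"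
      by simp
    then show ?thesis by (simp add: cis_cnj cis_mult)
  qed
  \<comment> \<open>Both base components are real multiples of the one vector
    \<open>\<i> * cis (2 * s)\<close>.\<close>
  have wedge: "wedge fst (cnj \<circ> fst) (dtwist 1 s z h w) (dtwist 1 s z h' w') = 0"
    by (simp add: wedge_def dtwist_def scaleR_conv_of_real)
  have "wedge (\<pi>1_form (twist 1 s z)) (cnj \<circ> \<pi>1_form (twist 1 s z)) (dtwist 1 s z h w) (dtwist 1 s z h' w') =
      wedge fst (cnj \<circ> fst) w w'"
    "wedge (\<pi>2_form (twist 1 s z)) (cnj \<circ> \<pi>2_form (twist 1 s z)) (dtwist 1 s z h w) (dtwist 1 s z h' w') =
      wedge snd (cnj \<circ> snd) w w'"
    by (simp_all only: wedge_def o_def \<pi> rot)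
  moreover obtain u \<zeta>1 \<zeta>2 where "twist 1 s z = (u, \<zeta>1, \<zeta>2)"
    by (cases "twist 1 s z")
  ultimately show ?thesis
    using wedge by (simp add: \<Omega>_form_def \<omega>_std_def)
qed

section \<open>The immersion of the twisted product\<close>

locale minus_symmetric_immersion = involution S \<tau>
  for S :: "('a, 'e::euclidean_space) manifold" and \<tau> +
  fixes \<iota> :: "'a \<Rightarrow> complex \<times> complex"
  assumes immersion: "smooth_immersion S euclidean_manifold \<iota>"
    and neg: "\<And>p. p \<in> points S \<Longrightarrow> \<iota> (\<tau> p) = - \<iota> p"
begin

text \<open>A description, because an orbit has neither a preferred representative nor a preferred
  real angle; the value does not depend on these choices by the next lemma.\<close>

definition lift_map :: "(real set \<times> 'a) set \<Rightarrow> bundle_point" where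
  "lift_map x = (THE y. \<exists>t. \<exists>p\<in>points S. x = deck_class \<tau> (circ t, p) \<and> y = pt_w (twist 1 t (\<iota> p)))"

lemma lift_map_deck_class:
  assumes p: "p \<in> points S"
  shows "lift_map (deck_class \<tau> (circ t, p)) = pt_w (twist 1 t (\<iota> p))"
  unfolding lift_map_def
proof (rule the_equality)
  fix y assume "\<exists>s. \<exists>p'\<in>points S. deck_class \<tau> (circ t, p) = deck_class \<tau> (circ s, p') \<and>
    y = pt_w (twist 1 s (\<iota> p'))"
  then obtain s p' where p': "p' \<in> points S" "y = pt_w (twist 1 s (\<iota> p'))"
      "deck_class \<tau> (circ t, p) = deck_class \<tau> (circ s, p')" by blast
  \<comment> \<open>Passing to the other point of the orbit changes the sign of the phase and, by
    \<open>neg\<close>, that of \<open>\<iota> p\<close>; the two signs cancel.\<close>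
  have "twist 1 t (\<iota> p) = twist 1 s (\<iota> p')"
    using p'(3) unfolding deck_class_eq_iff[OF p p'(1)] twist_1_eq_iff using neg[OF p'(1)] by auto
  then show "y = pt_w (twist 1 t (\<iota> p))"
    using p'(2) by simp
qed (use p in blast)

lemma lift_map_eq_iff:
  assumes "p \<in> points S"
  shows "lift_map (deck_class \<tau> (circ s, p)) = pt_w (twist 1 t z) \<longleftrightarrow>
    cis s = cis t \<and> \<iota> p = z \<or> cis s = - cis t \<and> \<iota> p = - z"
  using assms inj_eq[OF inj_pt_w] by (simp add: lift_map_deck_class twist_1_eq_iff)

lemma lift_map_image: "lift_map ` points (twisted_product S \<tau>) = M_set (\<iota> ` points S)"
proof -
  have "lift_map ` points (twisted_product S \<tau>) = {pt_w (twist 1 t (\<iota> p)) | t p. p \<in> points S}"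
    unfolding points_twisted using lift_map_deck_class by (auto simp: image_iff) metis
  also have "\<dots> = M_set (\<iota> ` points S)"
  proof (intro equalityI subsetI)
    fix y assume "y \<in> {pt_w (twist 1 t (\<iota> p)) | t p. p \<in> points S}"
    then obtain t p where y: "y = pt_w (twist 1 t (\<iota> p))" "p \<in> points S" by blast
    have "(cis (2 * t / 2) * (cis (- t) * fst (\<iota> p)), cis (2 * t / 2) * (cis (- t) * snd (\<iota> p))) = \<iota> p"
      by (simp add: cis_mult flip: mult.assoc)
    then have "(cis (2 * t / 2) * (cis (- t) * fst (\<iota> p)), cis (2 * t / 2) * (cis (- t) * snd (\<iota> p))) \<in> \<iota> ` points S"
      using y(2) by simp
    moreover have "y = pt_w (cis (2 * t), cis (- t) * fst (\<iota> p), cis (- t) * snd (\<iota> p))"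
      using y(1) by (simp add: twist_def)
    ultimately show "y \<in> M_set (\<iota> ` points S)"
      unfolding M_set_def by blast
  next
    fix y assume "y \<in> M_set (\<iota> ` points S)"
    then obtain \<phi> \<zeta>1 \<zeta>2 p where y: "y = pt_w (cis \<phi>, \<zeta>1, \<zeta>2)" "p \<in> points S"
        "\<iota> p = (cis (\<phi> / 2) * \<zeta>1, cis (\<phi> / 2) * \<zeta>2)"
      unfolding M_set_def by fastforce
    have "twist 1 (\<phi> / 2) (\<iota> p) = (cis \<phi>, \<zeta>1, \<zeta>2)"
      unfolding y(3) by (simp add: twist_def cis_mult flip: mult.assoc)
    then show "y \<in> {pt_w (twist 1 t (\<iota> p)) | t p. p \<in> points S}"
      using y(1,2) by (metis (mono_tags, lifting) mem_Collect_eq)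
  qed
  finally show ?thesis .
qed

text \<open>Shows that the twisted product does not cover its image more often than the surface
  covers its own. A preimage has a representative with angle \<open>t\<close> or
  \<open>t + pi\<close> up to full turns; in the second case the deck map brings the angle back to
  \<open>t\<close> and turns \<open>- z\<close> into \<open>z\<close>.\<close>

lemma lift_map_fibre:
  "bij_betw (\<lambda>p. deck_class \<tau> (circ t, p)) {p \<in> points S. \<iota> p = z}
    {x \<in> points (twisted_product S \<tau>). lift_map x = pt_w (twist 1 t z)}"
proof (rule bij_betw_imageI)
  show "inj_on (\<lambda>p. deck_class \<tau> (circ t, p)) {p \<in> points S. \<iota> p = z}"
  proof (rule inj_onI)
    fix p p' assume p: "p \<in> {p \<in> points S. \<iota> p = z}" "p' \<in> {p \<in> points S. \<iota> p = z}"
      "deck_class \<tau> (circ t, p) = deck_class \<tau> (circ t, p')"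
    have "cis t + cis t \<noteq> 0"
      using cis_neq_zero[of t] by (simp flip: mult_2)
    then have "cis t \<noteq> - cis t"
      by (metis add.right_inverse)
    then show "p = p'"
      using p by (simp add: deck_class_eq_iff)
  qed
  show "(\<lambda>p. deck_class \<tau> (circ t, p)) ` {p \<in> points S. \<iota> p = z} =
      {x \<in> points (twisted_product S \<tau>). lift_map x = pt_w (twist 1 t z)}"
  proof (intro equalityI subsetI)
    fix x assume "x \<in> (\<lambda>p. deck_class \<tau> (circ t, p)) ` {p \<in> points S. \<iota> p = z}"
    then show "x \<in> {x \<in> points (twisted_product S \<tau>). lift_map x = pt_w (twist 1 t z)}"
      by (auto simp: points_twisted lift_map_deck_class)
  next
    fix x assume x: "x \<in> {x \<in> points (twisted_product S \<tau>). lift_map x = pt_w (twist 1 t z)}"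
    then obtain s p where sp: "p \<in> points S" "x = deck_class \<tau> (circ s, p)"
      by (auto simp: points_twisted)
    then consider "cis s = cis t" "\<iota> p = z" | "cis s = - cis t" "\<iota> p = - z"
      using x lift_map_eq_iff by auto
    then show "x \<in> (\<lambda>p. deck_class \<tau> (circ t, p)) ` {p \<in> points S. \<iota> p = z}"
    proof cases
      case 1
      then have "circ s = circ t" by (simp add: circ_eq_iff_cis)
      then show ?thesis using sp 1 by auto
    next
      case 2
      have "x = deck_class \<tau> (circ t, \<tau> p)"
        using sp 2 deck_class_eq_iff[OF sp(1) \<tau>_points[OF sp(1)]] by (simp add: \<tau>\<tau>)
      then show ?thesis
        using 2 neg[OF sp(1)] \<tau>_points[OF sp(1)] by auto
    qed
  qed
qed

text \<open>All chart bookkeeping is concentrated here: in any pair of charts the map is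
  \<open>twist \<sigma>\<close> applied to the angle and to \<open>\<iota>\<close> in a chart of
  \<open>S\<close>, with \<open>\<sigma>\<close> recording the chart of the target. The whole domain
  of \<open>c\<close> maps into that of \<open>d\<close>, since points with \<open>|u| = 1\<close>
  lie in both charts of the bundle.\<close>

lemma lift_map_chart:
  assumes c: "c \<in> atlas (twisted_product S \<tau>)" and d: "d \<in> atlas total_space"
  obtains U \<psi> \<sigma> where "(U, \<psi>) \<in> atlas S" "\<sigma> \<noteq> 0" "d = chart_w \<Longrightarrow> \<sigma> = 1"
    "\<And>x. x \<in> fst c \<Longrightarrow> lift_map x \<in> fst d"
    "\<And>x. x \<in> fst c \<Longrightarrow> snd (snd c x) \<in> \<psi> ` U"
    "\<And>x. x \<in> fst c \<Longrightarrow>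
      snd d (lift_map x) = twist \<sigma> (fst (snd c x)) ((\<iota> \<circ> inv_into U \<psi>) (snd (snd c x)))"
proof -
  obtain U \<psi> where U: "(U, \<psi>) \<in> atlas S"
    and Ux: "\<And>x. x \<in> fst c \<Longrightarrow> \<exists>s p. p \<in> U \<and> x = deck_class \<tau> (circ s, p) \<and> snd c x = (s, \<psi> p)"
    by (rule twisted_chart[OF c]) blast
  \<comment> \<open>Makes the case distinction defining \<open>\<sigma>\<close> meaningful: the
    point with \<open>u = 0\<close> is missing from \<open>chart_z\<close>.\<close>
  have ne: "chart_w \<noteq> chart_z"
  proof
    assume "chart_w = chart_z"
    then have "pt_w (0, 0, 0) \<in> range pt_z" unfolding chart_w_def chart_z_def by (metis Pair_inject rangeI)
    then show False by (auto simp: pt_w_eq_pt_z_iff)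
  qed
  define \<sigma> :: real where "\<sigma> = (if d = chart_w then 1 else -1)"
  have d': "pt_w (twist 1 s z) \<in> fst d" "snd d (pt_w (twist 1 s z)) = twist \<sigma> s z" for s z
  proof -
    have "d = chart_w \<or> d = chart_z" using d by (simp add: atlas_total_space)
    then show "pt_w (twist 1 s z) \<in> fst d" "snd d (pt_w (twist 1 s z)) = twist \<sigma> s z"
    proof (atomize(full), elim disjE)
      assume "d = chart_w"
      then show "pt_w (twist 1 s z) \<in> fst d \<and> snd d (pt_w (twist 1 s z)) = twist \<sigma> s z"
        using inj_pt_w by (simp add: \<sigma>_def chart_w_def)
    next
      assume "d = chart_z"
      then show "pt_w (twist 1 s z) \<in> fst d \<and> snd d (pt_w (twist 1 s z)) = twist \<sigma> s z"
        using inj_pt_z ne[symmetric] unfolding pt_w_twist by (simp add: \<sigma>_def chart_z_def)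
    qed
  qed
  show thesis
  proof (rule that[OF U, of \<sigma>])
    fix x assume "x \<in> fst c"
    then obtain s p where p: "p \<in> U" "x = deck_class \<tau> (circ s, p)" "snd c x = (s, \<psi> p)"
      using Ux by blast
    have "p \<in> points S" using chart_subset[OF smooth_atlas_S U] p(1) by blast
    then show "lift_map x \<in> fst d" "snd (snd c x) \<in> \<psi> ` U"
      "snd d (lift_map x) = twist \<sigma> (fst (snd c x)) ((\<iota> \<circ> inv_into U \<psi>) (snd (snd c x)))"
      using p d' by (simp_all add: lift_map_deck_class chart_inv_into[OF smooth_atlas_S U])
  qed (auto simp: \<sigma>_def)
qed

lemma Cinf_on_\<iota>_chart: "(U, \<psi>) \<in> atlas S \<Longrightarrow> Cinf_on (\<iota> \<circ> inv_into U \<psi>) (\<psi> ` U)"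
  using immersion smooth_map_rep[of S euclidean_manifold \<iota> U \<psi> UNIV id]
  by (simp add: smooth_immersion_def)

lemma lift_map_rep:
  assumes c: "c \<in> atlas (twisted_product S \<tau>)" and d: "d \<in> atlas total_space"
    and U: "(U, \<psi>) \<in> atlas S" and V: "\<And>x. x \<in> fst c \<Longrightarrow> snd (snd c x) \<in> \<psi> ` U"
    and rep: "\<And>x. x \<in> fst c \<Longrightarrow>
      snd d (lift_map x) = twist \<sigma> (fst (snd c x)) ((\<iota> \<circ> inv_into U \<psi>) (snd (snd c x)))"
  shows "Cinf_on (snd d \<circ> lift_map \<circ> inv_into (fst c) (snd c)) (snd c ` fst c)"
    and "x \<in> fst c \<Longrightarrow> differential c d lift_map x =
      (\<lambda>v. dtwist \<sigma> (fst (snd c x)) ((\<iota> \<circ> inv_into U \<psi>) (snd (snd c x))) (fst v)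
        (frechet_derivative (\<iota> \<circ> inv_into U \<psi>) (at (snd (snd c x))) (snd v)))"
proof -
  have c': "(fst c, snd c) \<in> atlas (twisted_product S \<tau>)" using c by simp
  have op: "open (snd c ` fst c)"
    by (rule chart_open_range[OF smooth_atlas_twisted c'])
  have eq: "twist \<sigma> (fst e) ((\<iota> \<circ> inv_into U \<psi>) (snd e)) =
      (snd d \<circ> lift_map \<circ> inv_into (fst c) (snd c)) e" if "e \<in> snd c ` fst c" for e
    using that rep chart_inv_into[OF smooth_atlas_twisted c'] by auto
  have sub: "snd c ` fst c \<subseteq> UNIV \<times> \<psi> ` U"
  proof
    fix e assume "e \<in> snd c ` fst c"
    then obtain y where "y \<in> fst c" "e = snd c y" by blast
    then show "e \<in> UNIV \<times> \<psi> ` U"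
      using V by (simp add: mem_Times_iff)
  qed
  have "Cinf_on (\<lambda>e. twist \<sigma> (fst e) ((\<iota> \<circ> inv_into U \<psi>) (snd e))) (snd c ` fst c)"
    by (rule Cinf_on_subset[OF Cinf_on_twist[OF Cinf_on_\<iota>_chart[OF U] chart_open_range[OF smooth_atlas_S U]] sub])
  then show "Cinf_on (snd d \<circ> lift_map \<circ> inv_into (fst c) (snd c)) (snd c ` fst c)"
    by (rule Cinf_on_cong[OF _ op eq])
  assume x: "x \<in> fst c"
  have "((\<iota> \<circ> inv_into U \<psi>) has_derivative frechet_derivative (\<iota> \<circ> inv_into U \<psi>) (at (snd (snd c x))))
      (at (snd (snd c x)))"
    by (rule Cinf_on_has_derivative[OF Cinf_on_\<iota>_chart[OF U] V[OF x]])
  from has_derivative_transform_within_open[OF has_derivative_twist[OF this, of \<sigma>] op _ eq]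
  have "((snd d \<circ> lift_map \<circ> inv_into (fst c) (snd c)) has_derivative
      (\<lambda>v. dtwist \<sigma> (fst (snd c x)) ((\<iota> \<circ> inv_into U \<psi>) (snd (snd c x))) (fst v)
        (frechet_derivative (\<iota> \<circ> inv_into U \<psi>) (at (snd (snd c x))) (snd v)))) (at (snd c x))"
    using x by blast
  then show "differential c d lift_map x =
      (\<lambda>v. dtwist \<sigma> (fst (snd c x)) ((\<iota> \<circ> inv_into U \<psi>) (snd (snd c x))) (fst v)
        (frechet_derivative (\<iota> \<circ> inv_into U \<psi>) (at (snd (snd c x))) (snd v)))"
    unfolding differential_def by (rule frechet_derivative_at[symmetric])
qed

lemma differential_\<iota>:
  assumes U: "(U, \<psi>) \<in> atlas S" and e: "e \<in> \<psi> ` U"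
  shows "differential (U, \<psi>) (UNIV, id) \<iota> (inv_into U \<psi> e) = frechet_derivative (\<iota> \<circ> inv_into U \<psi>) (at e)"
  using e by (simp add: differential_def f_inv_into_f)

text \<open>The image lies in the domain of \<open>chart_w\<close>, so locally the map is
  \<open>pt_w\<close> after a smooth coordinate expression after a chart.\<close>

lemma continuous_map_lift_map: "continuous_map (mtop (twisted_product S \<tau>)) (mtop total_space) lift_map"
proof (rule continuous_map_local)
  fix x assume "x \<in> points (twisted_product S \<tau>)"
  then obtain V \<phi> where c: "(V, \<phi>) \<in> atlas (twisted_product S \<tau>)" "x \<in> V"
    using smooth_atlas_cover[OF smooth_atlas_twisted] by blast
  have d: "chart_w \<in> atlas total_space" by (simp add: atlas_total_space)
  obtain U \<psi> \<sigma> where U: "(U, \<psi>) \<in> atlas S" and dw: "\<And>x. x \<in> V \<Longrightarrow> lift_map x \<in> fst chart_w"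
    and r: "\<And>x. x \<in> V \<Longrightarrow> snd (\<phi> x) \<in> \<psi> ` U"
    "\<And>x. x \<in> V \<Longrightarrow> snd chart_w (lift_map x) = twist \<sigma> (fst (\<phi> x)) ((\<iota> \<circ> inv_into U \<psi>) (snd (\<phi> x)))"
    using lift_map_chart[OF c(1) d] by (metis fst_conv snd_conv)
  let ?h = "snd chart_w \<circ> lift_map \<circ> inv_into V \<phi>"
  have "Cinf_on ?h (\<phi> ` V)"
    using lift_map_rep(1)[OF c(1) d U] r by simp
  then have "continuous_on (\<phi> ` V) ?h"
    by (rule Cinf_on_continuous_on)
  then have "continuous_map (top_of_set (\<phi> ` V)) euclidean ?h"
    by (simp only: continuous_map_iff_continuous)
  moreover have "continuous_map (subtopology (mtop (twisted_product S \<tau>)) V) (top_of_set (\<phi> ` V)) \<phi>"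
    by (rule homeomorphic_imp_continuous_map[OF chart_homeomorphic[OF smooth_atlas_twisted c(1)]])
  ultimately have "continuous_map (subtopology (mtop (twisted_product S \<tau>)) V) (mtop total_space) (pt_w \<circ> (?h \<circ> \<phi>))"
    by (rule continuous_map_compose[OF continuous_map_compose continuous_map_pt_w, rotated])
  then have "continuous_map (subtopology (mtop (twisted_product S \<tau>)) V) (mtop total_space) lift_map"
  proof (rule continuous_map_eq)
    fix y assume "y \<in> topspace (subtopology (mtop (twisted_product S \<tau>)) V)"
    then have y: "y \<in> V" by simp
    then have "lift_map y \<in> range pt_w" using dw by (simp add: chart_w_def)
    then show "(pt_w \<circ> (?h \<circ> \<phi>)) y = lift_map y"
      using y by (simp add: chart_inv_into[OF smooth_atlas_twisted c(1)] chart_w_def f_inv_into_f)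
  qed
  then show "\<exists>W. openin (mtop (twisted_product S \<tau>)) W \<and> x \<in> W \<and>
      continuous_map (subtopology (mtop (twisted_product S \<tau>)) W) (mtop total_space) lift_map"
    using c chart_openin[OF smooth_atlas_twisted c(1)] by blast
qed

lemma smooth_immersion_lift_map: "smooth_immersion (twisted_product S \<tau>) total_space lift_map"
  unfolding smooth_immersion_def
proof (intro conjI ballI impI)
  show "smooth_map (twisted_product S \<tau>) total_space lift_map"
  proof (rule smooth_mapI[OF continuous_map_lift_map])
    fix U1 \<phi> V1 \<psi>1 x
    assume c: "(U1, \<phi>) \<in> atlas (twisted_product S \<tau>)" and d: "(V1, \<psi>1) \<in> atlas total_space"
      and x: "x \<in> U1"
    obtain U \<psi> \<sigma> where U: "(U, \<psi>) \<in> atlas S"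
      and r: "\<And>x. x \<in> fst (U1, \<phi>) \<Longrightarrow> snd (snd (U1, \<phi>) x) \<in> \<psi> ` U"
      "\<And>x. x \<in> fst (U1, \<phi>) \<Longrightarrow> snd (V1, \<psi>1) (lift_map x) =
         twist \<sigma> (fst (snd (U1, \<phi>) x)) ((\<iota> \<circ> inv_into U \<psi>) (snd (snd (U1, \<phi>) x)))"
      using lift_map_chart[OF c d] by metis
    have "Cinf_on (\<psi>1 \<circ> lift_map \<circ> inv_into U1 \<phi>) (\<phi> ` U1)"
      using lift_map_rep(1)[OF c d U r] by simp
    then show "\<exists>T. open T \<and> \<phi> x \<in> T \<and> Cinf_on (\<psi>1 \<circ> lift_map \<circ> inv_into U1 \<phi>) T"
      using x chart_open_range[OF smooth_atlas_twisted c] by blast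
  qed
  fix c d x
  assume c: "c \<in> atlas (twisted_product S \<tau>)" and d: "d \<in> atlas total_space" and x: "x \<in> fst c"
  obtain U \<psi> \<sigma> where U: "(U, \<psi>) \<in> atlas S" and \<sigma>: "\<sigma> \<noteq> 0"
    and r: "\<And>x. x \<in> fst c \<Longrightarrow> snd (snd c x) \<in> \<psi> ` U"
    "\<And>x. x \<in> fst c \<Longrightarrow> snd d (lift_map x) = twist \<sigma> (fst (snd c x)) ((\<iota> \<circ> inv_into U \<psi>) (snd (snd c x)))"
    using lift_map_chart[OF c d] by metis
  let ?e = "snd (snd c x)"
  have "inv_into U \<psi> ?e \<in> U"
    using r(1)[OF x] by (rule inv_into_into)
  then have "inj (differential (U, \<psi>) (UNIV, id) \<iota> (inv_into U \<psi> ?e))"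
    using immersion U unfolding smooth_immersion_def by simp
  then have "inj (frechet_derivative (\<iota> \<circ> inv_into U \<psi>) (at ?e))"
    by (simp only: differential_\<iota>[OF U r(1)[OF x]])
  moreover have "linear (frechet_derivative (\<iota> \<circ> inv_into U \<psi>) (at ?e))"
    by (rule linear_frechet_derivative[OF Cinf_on_differentiable[OF Cinf_on_\<iota>_chart[OF U] r(1)[OF x]]])
  ultimately show "inj (differential c d lift_map x)"
    by (subst lift_map_rep(2)[OF c d U r x]) (assumption | intro inj_dtwist \<sigma>)+
qed

lemma lagrangian_immersion_lift_map:
  assumes L: "lagrangian_immersion S euclidean_manifold (UNIV, id) \<omega>_std \<iota>"
  shows "lagrangian_immersion (twisted_product S \<tau>) total_space chart_w (\<Omega>_form a) lift_map"
  unfolding lagrangian_immersion_def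
proof (intro conjI ballI allI)
  show "smooth_immersion (twisted_product S \<tau>) total_space lift_map"
    by (rule smooth_immersion_lift_map)
  show "2 * DIM(real \<times> 'e) = DIM(complex \<times> complex \<times> complex)"
    using L by (simp add: lagrangian_immersion_def)
  show d: "chart_w \<in> atlas total_space"
    by (simp add: atlas_total_space)
  show "lift_map ` points (twisted_product S \<tau>) \<subseteq> fst chart_w"
    by (auto simp: points_twisted lift_map_deck_class chart_w_def)
  fix c x v w
  assume c: "c \<in> atlas (twisted_product S \<tau>)" and x: "x \<in> fst c"
  obtain U \<psi> \<sigma> where U: "(U, \<psi>) \<in> atlas S" and \<sigma>: "chart_w = chart_w \<Longrightarrow> \<sigma> = 1"
    and r: "\<And>x. x \<in> fst c \<Longrightarrow> snd (snd c x) \<in> \<psi> ` U"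
    "\<And>x. x \<in> fst c \<Longrightarrow>
      snd chart_w (lift_map x) = twist \<sigma> (fst (snd c x)) ((\<iota> \<circ> inv_into U \<psi>) (snd (snd c x)))"
    using lift_map_chart[OF c d] by metis
  have \<sigma>1: "\<sigma> = 1" using \<sigma> by simp
  let ?e = "snd (snd c x)"
  have "inv_into U \<psi> ?e \<in> U"
    using r(1)[OF x] by (rule inv_into_into)
  then have "\<omega>_std (\<iota> (inv_into U \<psi> ?e)) (differential (U, \<psi>) (UNIV, id) \<iota> (inv_into U \<psi> ?e) v')
      (differential (U, \<psi>) (UNIV, id) \<iota> (inv_into U \<psi> ?e) w') = 0" for v' w'
    using L U unfolding lagrangian_immersion_def by fastforce
  then have "\<omega>_std (\<iota> (inv_into U \<psi> ?e)) (frechet_derivative (\<iota> \<circ> inv_into U \<psi>) (at ?e) v')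
      (frechet_derivative (\<iota> \<circ> inv_into U \<psi>) (at ?e) w') = 0" for v' w'
    by (simp only: differential_\<iota>[OF U r(1)[OF x]])
  moreover have "differential c chart_w lift_map x =
      (\<lambda>v. dtwist \<sigma> (fst (snd c x)) ((\<iota> \<circ> inv_into U \<psi>) ?e) (fst v)
        (frechet_derivative (\<iota> \<circ> inv_into U \<psi>) (at ?e) (snd v)))"
    by (rule lift_map_rep(2)[OF c d U r x])
  ultimately show "\<Omega>_form a (snd chart_w (lift_map x)) (differential c chart_w lift_map x v)
      (differential c chart_w lift_map x w) = 0"
    by (simp only: r(2)[OF x] \<sigma>1 \<Omega>_form_dtwist[where y = "\<iota> (inv_into U \<psi> ?e)"])
qed

text \<open>What remains beyond the immersion is injectivity and openness onto the image. For the
  latter, near a given image point the angle is recovered continuously from \<open>u\<close>, and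
  the point of the surface from the fibre coordinates rotated back by that angle.\<close>

lemma smooth_embedding_lift_map:
  assumes emb: "smooth_embedding S euclidean_manifold \<iota>"
  shows "smooth_embedding (twisted_product S \<tau>) total_space lift_map"
proof -
  let ?X = "twisted_product S \<tau>" and ?M = "lift_map ` points (twisted_product S \<tau>)"
  have \<iota>: "homeomorphic_map (mtop S) (top_of_set (\<iota> ` points S)) \<iota>"
    using emb by (simp add: smooth_embedding_def embedding_map_def)
  have inj: "p = p'" if "\<iota> p = \<iota> p'" "p \<in> points S" "p' \<in> points S" for p p'
    using inj_onD[OF homeomorphic_imp_injective_map[OF \<iota>]] that by blast
  have "homeomorphic_map (mtop ?X) (subtopology (mtop total_space) ?M) lift_map"
  proof (rule bijective_open_imp_homeomorphic_map)
    show "continuous_map (mtop ?X) (subtopology (mtop total_space) ?M) lift_map"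
      using continuous_map_lift_map by (simp add: continuous_map_in_subtopology)
    show "lift_map ` points ?X = topspace (subtopology (mtop total_space) ?M)"
      using smooth_map_points[of ?X total_space lift_map] smooth_immersion_lift_map
      by (auto simp: smooth_immersion_def)
    show "inj_on lift_map (points ?X)"
    proof (rule inj_onI)
      fix x y assume "x \<in> points ?X" "y \<in> points ?X" and eq: "lift_map x = lift_map y"
      then obtain s p t p' where *: "x = deck_class \<tau> (circ s, p)" "p \<in> points S"
          "y = deck_class \<tau> (circ t, p')" "p' \<in> points S"
        by (auto simp: points_twisted)
      have "cis s = cis t \<and> \<iota> p = \<iota> p' \<or> cis s = - cis t \<and> \<iota> p = - \<iota> p'"
        using eq lift_map_eq_iff[OF *(2)] by (simp add: *(1,3) lift_map_deck_class[OF *(4)])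
      then have "cis s = cis t \<and> p = p' \<or> cis s = - cis t \<and> p = \<tau> p'"
        using inj *(2,4) \<tau>_points neg by metis
      then show "x = y"
        unfolding *(1,3) deck_class_eq_iff[OF *(2,4)] .
    qed
    show "open_map (mtop ?X) (subtopology (mtop total_space) ?M) lift_map"
      unfolding open_map_def
    proof (intro allI impI)
      fix Z assume Z: "openin (mtop ?X) Z"
      have "\<exists>N. openin (mtop total_space) N \<and> lift_map x \<in> N \<and> N \<inter> ?M \<subseteq> lift_map ` Z" if "x \<in> Z" for x
      proof -
        obtain t0 p0 where x: "x = deck_class \<tau> (circ t0, p0)" "p0 \<in> points S"
          using openin_subset[OF Z] \<open>x \<in> Z\<close> by (auto simp: points_twisted)
        define P where "P = {y \<in> topspace (prod_topology euclidean (mtop S)).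
          (case y of (t, p) \<Rightarrow> deck_class \<tau> (circ t, p)) \<in> Z}"
        have "openin (prod_topology euclidean (mtop S)) P"
          unfolding P_def by (rule openin_continuous_map_preimage[OF continuous_map_cover Z])
        moreover have "(t0, p0) \<in> P"
          using x \<open>x \<in> Z\<close> by (simp add: P_def)
        ultimately obtain I B where "openin euclidean I" "t0 \<in> I" and B: "openin (mtop S) B" "p0 \<in> B"
          and IBP: "I \<times> B \<subseteq> P"
          unfolding openin_prod_topology_alt by meson
        then have I: "open I" "t0 \<in> I" by simp_all
        have IB: "deck_class \<tau> (circ t, p) \<in> Z" if "t \<in> I" "p \<in> B" for t p
        proof -
          have "(t, p) \<in> P" using IBP that by blast
          then show ?thesis by (simp add: P_def)
        qed
        have Bp: "B \<subseteq> points S" by (rule openin_subset[OF B(1)])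
        have "openin (top_of_set (\<iota> ` points S)) (\<iota> ` B)"
          using homeomorphic_imp_open_map[OF \<iota>] B(1) by (simp add: open_map_def)
        then obtain B' where B': "open B'" "\<iota> ` B = B' \<inter> \<iota> ` points S"
          by (auto simp: openin_open Int_commute)
        \<comment> \<open>Rotating \<open>u\<close> by \<open>- 2 * t0\<close> moves the base point
          to 1; the right half-plane around it avoids the cut of \<open>Arg\<close>. Hence
          \<open>\<theta>\<close>, half an argument of \<open>u\<close>, is continuous on
          \<open>D\<close> and equals \<open>t0\<close> at the base point.\<close>
        define D where "D = {y :: complex \<times> complex \<times> complex. Re (fst y * cis (- (2 * t0))) > 0}"
        define \<theta> where "\<theta> y = t0 + Arg (fst y * cis (- (2 * t0))) / 2" for y :: "complex \<times> complex \<times> complex"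
        define k where "k y = (cis (\<theta> y) * fst (snd y), cis (\<theta> y) * snd (snd y))" for y :: "complex \<times> complex \<times> complex"
        have D: "open D"
          unfolding D_def by (intro open_Collect_less continuous_intros)
        have c\<theta>: "continuous_on D \<theta>"
          unfolding \<theta>_def D_def
          by (intro continuous_intros) (auto simp: complex_nonpos_Reals_iff)
        have ck: "continuous_on D k"
          unfolding k_def by (intro continuous_intros continuous_on_cis c\<theta>)
        \<comment> \<open>The points whose recovered angle lies in \<open>I\<close> and whose
          recovered point of C^2 lies in \<open>B'\<close>.\<close>
        define N where "N = (D \<inter> \<theta> -` I) \<inter> (D \<inter> k -` B')"
        have "open N"
          unfolding N_def using continuous_open_preimage[OF c\<theta> D I(1)] continuous_open_preimage[OF ck D B'(1)]
          by blast
        then have "openin (mtop total_space) (pt_w ` N)"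
          using open_map_pt_w by (simp add: open_map_def)
        moreover have "lift_map x \<in> pt_w ` N"
        proof -
          let ?y = "twist 1 t0 (\<iota> p0)"
          have fy: "fst ?y * cis (- (2 * t0)) = 1"
            by (simp add: twist_def cis_mult)
          have "\<theta> ?y = t0" "?y \<in> D"
            unfolding \<theta>_def D_def mem_Collect_eq fy by simp_all
          moreover have "k ?y = \<iota> p0"
            using \<open>\<theta> ?y = t0\<close> by (simp add: k_def twist_def cis_mult flip: mult.assoc)
          moreover have "\<iota> p0 \<in> B'" using B(2) B'(2) by blast
          ultimately have "?y \<in> N" using I(2) by (simp add: N_def)
          then show ?thesis using x lift_map_deck_class by simp
        qed
        moreover have "pt_w ` N \<inter> ?M \<subseteq> lift_map ` Z"
        proof
          fix y assume "y \<in> pt_w ` N \<inter> ?M"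
          then obtain n s p where n: "n \<in> N" "y = pt_w n" and
            p: "p \<in> points S" "y = lift_map (deck_class \<tau> (circ s, p))"
            by (auto simp: points_twisted)
          have n_eq: "n = twist 1 s (\<iota> p)"
            using n(2) p inj_pt_w by (simp add: lift_map_deck_class inj_eq)
          have \<theta>I: "\<theta> n \<in> I" and kB: "k n \<in> B'" using n(1) by (auto simp: N_def)
          have fn: "fst n = cis (2 * s)" by (simp add: n_eq twist_def)
          \<comment> \<open>Only twice the angle is visible in \<open>u\<close>, so
            \<open>\<theta> n\<close> agrees with \<open>s\<close> modulo pi. In the case of
            opposite signs the orbit is represented by \<open>\<tau> p\<close> at angle
            \<open>\<theta> n\<close>, and it is \<open>\<tau> p\<close> that is found to lie in
            \<open>B\<close>.\<close>
          have "cis (2 * \<theta> n) = cis (2 * t0) * cis (Arg (cis (2 * s - 2 * t0)))"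
            by (simp add: \<theta>_def fn cis_mult algebra_simps)
          also have "\<dots> = cis (2 * t0) * cis (2 * s - 2 * t0)"
            by (simp add: cis_Arg sgn_eq)
          also have "\<dots> = cis (2 * s)"
            by (simp add: cis_mult)
          finally have "(cis (\<theta> n))\<^sup>2 = (cis s)\<^sup>2"
            by (simp add: Complex.DeMoivre)
          then consider "cis s = cis (\<theta> n)" | "cis s = - cis (\<theta> n)"
            by (auto simp: power2_eq_iff)
          then have "deck_class \<tau> (circ s, p) \<in> Z"
          proof cases
            case 1
            have "k n = \<iota> p"
              unfolding k_def n_eq[symmetric] 1[symmetric]
              by (simp add: n_eq twist_def cis_mult flip: mult.assoc)
            then have "\<iota> p \<in> \<iota> ` B" using kB p(1) B'(2) by auto
            then have "p \<in> B" using inj p(1) Bp by blast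
            moreover have "circ s = circ (\<theta> n)" using 1 by (simp add: circ_eq_iff_cis)
            ultimately show ?thesis using IB[OF \<theta>I] by simp
          next
            case 2
            then have "cis (\<theta> n) = - cis s" by simp
            then have "k n = - \<iota> p"
              unfolding k_def by (simp add: n_eq twist_def cis_mult prod_eq_iff flip: mult.assoc)
            then have "\<iota> (\<tau> p) \<in> \<iota> ` B" using kB p(1) B'(2) neg \<tau>_points by force
            then have "\<tau> p \<in> B" using inj \<tau>_points[OF p(1)] Bp by blast
            moreover have "deck_class \<tau> (circ s, p) = deck_class \<tau> (circ (\<theta> n), \<tau> p)"
              using 2 by (simp add: deck_class_eq_iff p(1) \<tau>_points \<tau>\<tau>)
            ultimately show ?thesis using IB[OF \<theta>I] by simp
          qed
          then show "y \<in> lift_map ` Z" using p(2) by blast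
        qed
        ultimately show ?thesis by blast
      qed
      then obtain N where N: "\<And>x. x \<in> Z \<Longrightarrow> openin (mtop total_space) (N x) \<and> lift_map x \<in> N x \<and>
          N x \<inter> ?M \<subseteq> lift_map ` Z" by metis
      have "openin (mtop total_space) (\<Union> (N ` Z))"
        using N by (intro openin_Union) auto
      moreover have "lift_map ` Z = \<Union> (N ` Z) \<inter> ?M"
        using N openin_subset[OF Z] by blast
      ultimately show "openin (subtopology (mtop total_space) ?M) (lift_map ` Z)"
        by (auto simp: openin_subtopology)
    qed
  qed
  then show ?thesis
    using smooth_immersion_lift_map by (simp add: smooth_embedding_def embedding_map_def)
qed

end

text \<open>\<open>\<tau>\<close> is forced to be the inverse of \<open>\<iota>\<close> applied to
  \<open>- \<iota>\<close>. It is smooth because near each point of the image this inverse extends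
  to a smooth map \<open>g\<close> on an open subset of C^2, so that \<open>\<tau>\<close> is
  locally a composite of smooth maps.\<close>

lemma minus_involution_exists:
  assumes S: "smooth_manifold S" and emb: "smooth_embedding S euclidean_manifold \<iota>"
    and sym: "uminus ` \<iota> ` points S = \<iota> ` points S"
  shows "\<exists>\<tau>. minus_involution S \<iota> \<tau>"
proof -
  let ?E = "euclidean_manifold :: (complex \<times> complex, complex \<times> complex) manifold"
  have at: "smooth_atlas S" "smooth_atlas ?E"
    using S smooth_manifold_euclidean by (auto simp: smooth_manifold_iff_smooth_atlas)
  have \<iota>: "smooth_map S ?E \<iota>"
    using emb by (simp add: smooth_embedding_def smooth_immersion_def)
  have inj: "inj_on \<iota> (points S)"
    using homeomorphic_imp_injective_map emb
    by (auto simp: smooth_embedding_def embedding_map_def)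
  define \<tau> where "\<tau> p = inv_into (points S) \<iota> (- \<iota> p)" for p
  have mem: "- \<iota> p \<in> \<iota> ` points S" if "p \<in> points S" for p
    using that sym by (metis imageI)
  have \<tau>: "\<tau> p \<in> points S" "\<iota> (\<tau> p) = - \<iota> p" if "p \<in> points S" for p
    using mem[OF that] by (auto simp: \<tau>_def inv_into_into f_inv_into_f)
  have "\<tau> (\<tau> p) = p" if "p \<in> points S" for p
    using inj_onD[OF inj, of "\<tau> (\<tau> p)" p] \<tau>[OF that] \<tau>[OF \<tau>(1)[OF that]] that by simp
  moreover have "smooth_map S S \<tau>"
  proof (rule smooth_map_local[OF at(1) _ at(1)])
    fix p assume p: "p \<in> points S"
    have "diffeomorphism_onto S ?E (\<iota> ` points S) \<iota>"
      by (rule smooth_embedding_diffeomorphism_onto[OF at emb])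
    then obtain W g where W: "open W" "- \<iota> p \<in> W" "smooth_map (open_submanifold ?E W) S g"
        "\<And>x. x \<in> points S \<Longrightarrow> \<iota> x \<in> W \<Longrightarrow> g (\<iota> x) = x"
      using mem[OF p] unfolding diffeomorphism_onto_def by auto
    have "smooth_map ?E ?E uminus"
      unfolding smooth_map_euclidean_iff by (rule Cinf_on_uminus[OF open_UNIV Cinf_on_id])
    then have n: "smooth_map S ?E (uminus \<circ> \<iota>)"
      by (rule smooth_map_compose[OF at at(2) \<iota>])
    have W': "openin (mtop ?E) W" using W(1) by simp
    let ?W = "{x \<in> points S. (uminus \<circ> \<iota>) x \<in> W}"
    have oW: "openin (mtop S) ?W"
      by (rule openin_continuous_map_preimage[OF smooth_map_continuous[OF n] W'])
    have sW: "smooth_atlas (open_submanifold S ?W)"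
      by (rule smooth_atlas_open_submanifold[OF at(1) oW])
    have "smooth_map (open_submanifold S ?W) S (g \<circ> (uminus \<circ> \<iota>))"
      by (rule smooth_map_compose[OF sW smooth_atlas_open_submanifold[OF at(2) W'] at(1)
            smooth_map_restrict[OF at n W'] W(3)])
    then have "smooth_map (open_submanifold S ?W) S \<tau>"
    proof (rule smooth_map_cong[OF sW at(1)])
      fix x assume "x \<in> points (open_submanifold S ?W)"
      then have "x \<in> points S" "- \<iota> x \<in> W" by auto
      then show "(g \<circ> (uminus \<circ> \<iota>)) x = \<tau> x"
        using W(4)[OF \<tau>(1)] \<tau>(2) by simp
    qed
    then show "\<exists>W. openin (mtop S) W \<and> p \<in> W \<and> smooth_map (open_submanifold S W) S \<tau>"
      using oW W(2) p by (intro exI[of _ ?W]) simp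
  qed
  ultimately show ?thesis
    unfolding minus_involution_def using \<tau>(2) by blast
qed

text \<open>For an immersed surface, invariance under -1 is a choice of \<open>\<tau>\<close>, hence
  the quantifier; for an embedded one, invariance of the image suffices, and the last conjunct
  supplies \<open>\<tau>\<close>. The \<open>bij_betw\<close> clause matches the preimages of a
  point of M with those of the corresponding point of L, so \<open>F\<close> parametrises M with the
  multiplicities of L.\<close>

theorem mainTheorem3:
  fixes S :: "('a, real ^ 2) manifold"
    and \<iota> :: "'a \<Rightarrow> complex \<times> complex"
    and a :: real
  assumes "a > 0"
    and "smooth_manifold S"
    and "lagrangian_immersion S euclidean_manifold (UNIV, id) \<omega>_std \<iota>"
  shows "(\<forall>\<tau>. minus_involution S \<iota> \<tau> \<longrightarrow>
            smooth_manifold (twisted_product S \<tau>) \<and>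
            (\<exists>F. (\<forall>t. \<forall>p\<in>points S.
                    F (deck_class \<tau> (circ t, p)) =
                      pt_w (cis (2 * t), cis (- t) * fst (\<iota> p), cis (- t) * snd (\<iota> p))) \<and>
                 lagrangian_immersion (twisted_product S \<tau>) total_space chart_w (\<Omega>_form a) F \<and>
                 F ` points (twisted_product S \<tau>) = M_set (\<iota> ` points S) \<and>
                 (\<forall>t \<zeta>1 \<zeta>2. bij_betw (\<lambda>p. deck_class \<tau> (circ t, p))
                    {p \<in> points S. \<iota> p = (cis t * \<zeta>1, cis t * \<zeta>2)}
                    {x \<in> points (twisted_product S \<tau>). F x = pt_w (cis (2 * t), \<zeta>1, \<zeta>2)}) \<and>
                 (smooth_embedding S euclidean_manifold \<iota> \<longrightarrow>
                    smooth_embedding (twisted_product S \<tau>) total_space F \<and>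
                    diffeomorphism_onto (twisted_product S \<tau>) total_space (M_set (\<iota> ` points S)) F)))
       \<and> (smooth_embedding S euclidean_manifold \<iota> \<and> uminus ` \<iota> ` points S = \<iota> ` points S \<longrightarrow>
            (\<exists>\<tau>. minus_involution S \<iota> \<tau>))"
proof (intro conjI allI impI)
  fix \<tau> assume \<tau>: "minus_involution S \<iota> \<tau>"
  interpret minus_symmetric_immersion S \<tau> \<iota>
    using assms \<tau> by unfold_locales (auto simp: minus_involution_def lagrangian_immersion_def)
  show "smooth_manifold (twisted_product S \<tau>)"
    by (rule twisted.quotient_smooth_manifold[folded twisted_product_def])
  have fibre: "bij_betw (\<lambda>p. deck_class \<tau> (circ t, p))
      {p \<in> points S. \<iota> p = (cis t * \<zeta>1, cis t * \<zeta>2)}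
      {x \<in> points (twisted_product S \<tau>). lift_map x = pt_w (cis (2 * t), \<zeta>1, \<zeta>2)}" for t \<zeta>1 \<zeta>2
  proof -
    have "twist 1 t (cis t * \<zeta>1, cis t * \<zeta>2) = (cis (2 * t), \<zeta>1, \<zeta>2)"
      by (simp add: twist_def cis_mult flip: mult.assoc)
    then show ?thesis
      using lift_map_fibre[of t "(cis t * \<zeta>1, cis t * \<zeta>2)"] by simp
  qed
  have diffeo: "diffeomorphism_onto (twisted_product S \<tau>) total_space (M_set (\<iota> ` points S)) lift_map"
    if "smooth_embedding S euclidean_manifold \<iota>"
    using smooth_embedding_diffeomorphism_onto[OF smooth_atlas_twisted smooth_atlas_total_space
        smooth_embedding_lift_map[OF that]] by (simp add: lift_map_image)
  show "\<exists>F. (\<forall>t. \<forall>p\<in>points S.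
                    F (deck_class \<tau> (circ t, p)) =
                      pt_w (cis (2 * t), cis (- t) * fst (\<iota> p), cis (- t) * snd (\<iota> p))) \<and>
                 lagrangian_immersion (twisted_product S \<tau>) total_space chart_w (\<Omega>_form a) F \<and>
                 F ` points (twisted_product S \<tau>) = M_set (\<iota> ` points S) \<and>
                 (\<forall>t \<zeta>1 \<zeta>2. bij_betw (\<lambda>p. deck_class \<tau> (circ t, p))
                    {p \<in> points S. \<iota> p = (cis t * \<zeta>1, cis t * \<zeta>2)}
                    {x \<in> points (twisted_product S \<tau>). F x = pt_w (cis (2 * t), \<zeta>1, \<zeta>2)}) \<and>
                 (smooth_embedding S euclidean_manifold \<iota> \<longrightarrow>
                    smooth_embedding (twisted_product S \<tau>) total_space F \<and>
                    diffeomorphism_onto (twisted_product S \<tau>) total_space (M_set (\<iota> ` points S)) F)"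
    using fibre diffeo smooth_embedding_lift_map lift_map_image lagrangian_immersion_lift_map[OF assms(3)]
    by (intro exI[of _ lift_map] conjI) (simp_all add: lift_map_deck_class twist_def)
next
  assume "smooth_embedding S euclidean_manifold \<iota> \<and> uminus ` \<iota> ` points S = \<iota> ` points S"
  then show "\<exists>\<tau>. minus_involution S \<iota> \<tau>"
    using minus_involution_exists[OF assms(2)] by blast
qed

end
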